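(* Let $d \geq 0$ and $k \geq 1$ be integers and let $0 < \delta, M < \infty$. There exists $c_0(d,k,\delta,M) > 0$ (independent of $N$, of the functions below, of $\mu$ and of $N_1$) such that the following holds. Let $N$ be a prime and let $f_{U^\perp}, f_{UAP}: \mathbb{Z}_N \to [0,1]$ satisfy $$ \| f_{U^\perp} - f_{UAP}\|_{L^2} \leq \frac{\delta^2}{1024 k}, \qquad \mathbf{E}(f_{U^\perp} \mid \mathbb{Z}_N) \geq \delta, \qquad \|f_{UAP}\|_{UAP^d} < M.$$ Then for every $\mu \in \mathbb{Z}_N$ and every integer $N_1 \geq 1$, $$ \mathbf{E}\Big( \prod_{j=0}^{k-1} T^{\mu j r} f_{U^\perp}(x) \,\Big|\, x \in \mathbb{Z}_N,\ 0 \leq r \leq N_1 \Big) \geq c_0(d,k,\delta,M),$$ where the average is uniform over $x \in \mathbb{Z}_N$ and integers $0 \leq r \leq N_1$ (with $\mu j r$ interpreted in $\mathbb{Z}_N$).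
   Context: $N$ is a prime, $\mathbb{Z}_N=\mathbb{Z}/N\mathbb{Z}$, $\mathbf{E}(F(x)\mid x\in A)$ denotes the uniform average over a finite set $A$, $T^n f(x) := f(x+n)$, $\|f\|_{L^2} := \mathbf{E}(|f|^2\mid\mathbb{Z}_N)^{1/2}$, $\|f\|_{L^\infty}:=\sup_x |f(x)|$. A function $g:\mathbb{Z}_N\to\mathbb{C}$ is bounded if $\|g\|_{L^\infty}\le 1$. Banach algebra: a vector space $A$ of functions $\mathbb{Z}_N \to \mathbb{C}$ with a norm $\|\cdot\|_A$ invariant under complex conjugation, closed under pointwise product with $\|fg\|_A \leq \|f\|_A\|g\|_A$, and with $\|F\|_{L^\infty} \leq \|F\|_A$; set $\|f\|_A = \infty$ if $f \notin A$. It is shift-invariant if $\|T^n f\|_A = \|f\|_A$ for all $n$. For a shift-invariant Banach algebra $A$, $UAP[A]$ is the space of functions $F$ admitting a representation $T^n F = M' \,\mathbf{E}(c_{n,h} g_h)$ for all $n \in \mathbb{Z}_N$, where $M' \geq 0$, $H$ is a finite nonempty set, $h$ is an $H$-valued random variable (the expectation is over $h$), $(g_h)_{h\in H}$ are bounded functions, and $(c_{n,h})_{n \in \mathbb{Z}_N, h\in H}$ are functions in $A$ with $\|c_{n,h}\|_A \leq 1$; $\|F\|_{UAP[A]}$ is the infimum of such $M'$. $UAP^0$ is the algebra of constant functions with the $L^\infty$ norm, and $UAP^d := UAP[UAP^{d-1}]$ for $d\ge 1$ (these are shift-invariant Banach algebras). *)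

theory Defs
  imports "HOL-Probability.Probability" "HOL-Computational_Algebra.Primes"
begin

text \<open>
  The modulus \<open>N\<close> has to be quantified inside the statement, so functions on the
  integers modulo \<open>N\<close> are represented as \<open>N\<close>-periodic functions on the integers, and
  averages and suprema are taken over the residues \<open>0, \<dots>, N - 1\<close>.
\<close>

definition ZN :: "nat \<Rightarrow> int set" where
  "ZN N = {0..<int N}"

definition ZN_fun :: "nat \<Rightarrow> (int \<Rightarrow> 'a) set" where
  "ZN_fun N = {f. \<forall>x. f (x + int N) = f x}"

definition shift :: "int \<Rightarrow> (int \<Rightarrow> 'a) \<Rightarrow> int \<Rightarrow> 'a" where
  "shift n f = (\<lambda>x. f (x + n))"

definition avg :: "'b set \<Rightarrow> ('b \<Rightarrow> real) \<Rightarrow> real" where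
  "avg A F = (\<Sum>x\<in>A. F x) / real (card A)"

definition L2_norm :: "nat \<Rightarrow> (int \<Rightarrow> 'a::real_normed_vector) \<Rightarrow> real" where
  "L2_norm N f = sqrt (avg (ZN N) (\<lambda>x. (norm (f x))\<^sup>2))"

definition Linf_norm :: "nat \<Rightarrow> (int \<Rightarrow> 'a::real_normed_vector) \<Rightarrow> real" where
  "Linf_norm N f = (SUP x\<in>ZN N. norm (f x))"

definition bounded_fun :: "nat \<Rightarrow> (int \<Rightarrow> complex) \<Rightarrow> bool" where
  "bounded_fun N g \<longleftrightarrow> g \<in> ZN_fun N \<and> Linf_norm N g \<le> 1"

text \<open>
  A Banach algebra \<open>A\<close> of functions is given by its extended norm, which is \<open>\<infinity>\<close> exactly
  outside \<open>A\<close>; thus \<open>nA f \<le> 1\<close> includes membership of \<open>f\<close> in \<open>A\<close>.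

  In the next definition, the \<open>H\<close>-valued random variable \<open>h\<close> is given by its law \<open>p\<close>.
  Taking the finite index set \<open>H\<close> inside the natural numbers loses no generality.
\<close>

definition UAP_rep ::
  "nat \<Rightarrow> ((int \<Rightarrow> complex) \<Rightarrow> ennreal) \<Rightarrow> (int \<Rightarrow> complex) \<Rightarrow> real \<Rightarrow> bool" where
  "UAP_rep N nA F M' \<longleftrightarrow> 0 \<le> M' \<and>
     (\<exists>(H :: nat set) (p :: nat pmf) (g :: nat \<Rightarrow> int \<Rightarrow> complex)
        (c :: int \<Rightarrow> nat \<Rightarrow> int \<Rightarrow> complex).
        finite H \<and> H \<noteq> {} \<and> set_pmf p \<subseteq> H \<and>
        (\<forall>h\<in>H. bounded_fun N (g h)) \<and>
        (\<forall>n\<in>ZN N. \<forall>h\<in>H. c n h \<in> ZN_fun N \<and> nA (c n h) \<le> 1) \<and>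
        (\<forall>n\<in>ZN N. \<forall>x. shift n F x =
           complex_of_real M' * measure_pmf.expectation p (\<lambda>h. c n h x * g h x)))"

text \<open>The infimum of the empty set is \<open>\<infinity>\<close>, so the norm is \<open>\<infinity>\<close> off the space \<open>UAP[A]\<close>.\<close>

definition UAP_norm ::
  "nat \<Rightarrow> ((int \<Rightarrow> complex) \<Rightarrow> ennreal) \<Rightarrow> (int \<Rightarrow> complex) \<Rightarrow> ennreal" where
  "UAP_norm N nA F = (INF M'\<in>{M'. UAP_rep N nA F M'}. ennreal M')"

definition const_norm :: "nat \<Rightarrow> (int \<Rightarrow> complex) \<Rightarrow> ennreal" where
  "const_norm N f = (if \<exists>z. f = (\<lambda>_. z) then ennreal (Linf_norm N f) else \<infinity>)"

primrec UAP_pow_norm :: "nat \<Rightarrow> nat \<Rightarrow> (int \<Rightarrow> complex) \<Rightarrow> ennreal" where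
  "UAP_pow_norm N 0 = const_norm N"
| "UAP_pow_norm N (Suc d) = UAP_norm N (UAP_pow_norm N d)"

end

theory Submission
  imports Defs
begin

text \<open>
  Recurrence is proved by induction on the order, in the following form.  Let \<open>U\<close> be finitely
  many functions of order \<open>d\<close>, let \<open>S\<close> have density at least \<open>\<delta>\<close> and let every point at
  which \<open>U\<close> takes nearly the values of a point of \<open>S\<close> lie in \<open>\<Omega> \<union> E\<close>, where \<open>E\<close> has density
  at most \<open>\<delta>\<^sup>2 / (16 k)\<close>.  Then \<open>\<Omega>\<close> contains a positive proportion of the progressions.

  For order \<open>d + 1\<close>, an energy increment argument for \<open>F = 1\<^sub>S - (8 k / \<delta>) 1\<^sub>E\<close> gives partitions
  \<open>R\<close> and \<open>R'\<close> determined by boundedly many functions of order \<open>d\<close>, with nearly the same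
  energy, such that \<open>R'\<close> gains almost no energy, at a scale depending on \<open>R\<close>, when one adjoins
  its own shifts and the level sets of finitely many sampled coefficients \<open>c\<^bsub>n,h\<^esub>\<close>.  The
  set where the conditional expectation of \<open>F\<close> is large is then recurrent by induction.  On an
  atom of the refined partition the shifts \<open>u (z + j n)\<close> are combinations of the fixed functions
  \<open>g\<^sub>h\<close> with nearly constant coefficients, so they form a totally bounded family in \<open>L\<^sup>2\<close>, with
  a bound independent of the number of samples; van der Waerden's theorem yields a progression of
  shifts that are close to each other, and hence a progression in \<open>\<Omega>\<close>.
\<close>

section \<open>Van der Waerden's theorem\<close>

text \<open>The obstacle is a circular choice of parameters. The number \<open>D\<close> of samples
  has to be large in terms of the recurrence constant \<open>c\<close> of a partition,
  \<open>c\<close> depends on the van der Waerden length \<open>K\<close>, and \<open>K\<close>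
  depends on the number of colours. The circle is broken by bounding the colours through \<eta>
  alone, without reference to \<open>D\<close>. A second circle is that adjoining the sampled
  coefficients makes the partition more complex, which would lower \<open>c\<close> again. This is
  why two partitions occur: recurrence is applied only to level sets of the coarse \<open>R\<close>,
  whose \<open>c\<close> is known, while \<open>R'\<close> is stable at a scale chosen after
  \<open>c\<close>. The two conditional expectations differ by less than
  \<open>\<delta> / 16\<close> outside a set whose density is bounded in terms of \<delta> and
  \<open>K\<close> alone, and this set is absorbed by the exceptional set \<open>E\<close> that the
  induction carries along. If the energies of \<open>R\<close> and \<open>R'\<close> are not close,
  \<open>R'\<close> takes the place of \<open>R\<close>; each replacement gains a fixed amount of
  energy, so their number is bounded independently of \<open>N\<close>.\<close>

definition vdw_bound :: "nat \<Rightarrow> nat \<Rightarrow> nat \<Rightarrow> bool" where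
  "vdw_bound k C K \<longleftrightarrow> 1 \<le> K \<and> (\<forall>col :: nat \<Rightarrow> nat. card (col ` {..<K}) \<le> C \<longrightarrow>
     (\<exists>a s. 1 \<le> s \<and> s \<le> K \<and> (\<forall>i<k. a + s * i < K) \<and> (\<forall>i<k. col (a + s * i) = col a)))"

text \<open>Colour focusing: the progressions carry the colours in \<open>Q\<close>, and all of them
  would continue to the same point \<open>e\<close>. If \<open>e\<close> itself has a colour of
  \<open>Q\<close>, the progression in that colour gets length \<open>k + 1\<close>.\<close>

definition focused :: "(nat \<Rightarrow> nat) \<Rightarrow> nat \<Rightarrow> nat \<Rightarrow> nat set \<Rightarrow> bool" where
  "focused col k e Q \<longleftrightarrow>
     (\<forall>q\<in>Q. \<exists>a s. 1 \<le> s \<and> a + s * k = e \<and> (\<forall>i<k. col (a + s * i) = q))"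

text \<open>Induction on the number \<open>f\<close> of focused colours. Blocks of length
  \<open>W\<close> are coloured by their whole pattern, so a \<open>k\<close>-term progression of
  equal blocks repeats every focused configuration. Moving on by one block per step along an old
  progression keeps its colour, and the copies of the focus \<open>e\<close> form a progression in
  the colour of \<open>e\<close>; all of them now focus on the copy of \<open>e\<close> in the next
  block.\<close>

lemma vdw_focusing:
  assumes k: "1 \<le> k" and IH: "\<And>C. \<exists>K. vdw_bound k C K"
  shows "\<exists>W\<ge>1. \<forall>col :: nat \<Rightarrow> nat. card (col ` {..<W}) \<le> C \<longrightarrow>
     (\<exists>a s. 1 \<le> s \<and> a + s * k < W \<and> (\<forall>i\<le>k. col (a + s * i) = col a)) \<or>
     (\<exists>e Q. e < W \<and> finite Q \<and> card Q = f \<and> focused col k e Q)"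
proof (induction f)
  case 0
  show ?case
    by (intro exI[of _ 1]) (auto simp: focused_def)
next
  case (Suc f)
  then obtain W where W1: "W \<ge> 1" and W: "\<And>col :: nat \<Rightarrow> nat. card (col ` {..<W}) \<le> C \<Longrightarrow>
     (\<exists>a s. 1 \<le> s \<and> a + s * k < W \<and> (\<forall>i\<le>k. col (a + s * i) = col a)) \<or>
     (\<exists>e Q. e < W \<and> finite Q \<and> card Q = f \<and> focused col k e Q)"
    by blast
  obtain K where K: "vdw_bound k (C ^ W) K"
    using IH by blast
  have K1: "K \<ge> 1" using K by (simp add: vdw_bound_def)
  \<comment> \<open>The new focus lies in block \<open>b + s * k\<close>, one step beyond the
    progression of blocks; it is below \<open>2 * K\<close> because
    \<open>s \<le> K\<close>.\<close>
  define W' where "W' = W * (2 * K)"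
  have "(\<exists>a s. 1 \<le> s \<and> a + s * k < W' \<and> (\<forall>i\<le>k. col (a + s * i) = col a)) \<or>
     (\<exists>e Q. e < W' \<and> finite Q \<and> card Q = Suc f \<and> focused col k e Q)"
    if card: "card (col ` {..<W'}) \<le> C" for col :: "nat \<Rightarrow> nat"
  proof -
    define blk where "blk b = map (\<lambda>t. col (b * W + t)) [0..<W]" for b
    define bc where "bc b = list_encode (blk b)" for b
    have inW': "b * W + t < W'" if "b < 2 * K" "t < W" for b t
    proof -
      have "b * W + t < (b + 1) * W" using that by simp
      also have "\<dots> \<le> (2 * K) * W" using that by (intro mult_le_mono1) simp
      finally show ?thesis by (simp add: W'_def mult.commute)
    qed
    have "bc ` {..<K} \<subseteq> list_encode ` {xs. set xs \<subseteq> col ` {..<W'} \<and> length xs = W}"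
      unfolding bc_def blk_def using inW' by (auto intro!: imageI)
    hence "card (bc ` {..<K}) \<le> card (list_encode ` {xs. set xs \<subseteq> col ` {..<W'} \<and> length xs = W})"
      by (intro card_mono finite_imageI finite_lists_length_eq) auto
    also have "\<dots> \<le> card {xs. set xs \<subseteq> col ` {..<W'} \<and> length xs = W}"
      by (intro card_image_le finite_lists_length_eq) auto
    also have "\<dots> = card (col ` {..<W'}) ^ W"
      by (intro card_lists_length_eq) auto
    also have "\<dots> \<le> C ^ W" using card by (rule power_mono) simp
    finally obtain b s where s: "1 \<le> s" "s \<le> K" and bs: "\<forall>i<k. b + s * i < K"
      and mono: "\<forall>i<k. bc (b + s * i) = bc b"
      using K unfolding vdw_bound_def by blast
    have same: "col ((b + s * i) * W + t) = col (b * W + t)" if "i < k" "t < W" for i t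
    proof -
      have "blk (b + s * i) = blk b"
        using mono that(1) by (simp add: bc_def list_encode_eq)
      hence "blk (b + s * i) ! t = blk b ! t" by simp
      thus ?thesis using that(2) by (simp add: blk_def)
    qed
    have b2: "b + s * k < 2 * K"
    proof -
      have "b + s * (k - 1) < K" using bs k by simp
      moreover have "s * k = s * (k - 1) + s" using k by (cases k) auto
      ultimately show ?thesis using s by linarith
    qed
    have bK: "b < 2 * K" using b2 by simp
    define col' where "col' t = col (b * W + t)" for t
    have "col' ` {..<W} \<subseteq> col ` {..<W'}"
      unfolding col'_def using inW'[OF bK] by auto
    hence "card (col' ` {..<W}) \<le> C"
      using card card_mono[of "col ` {..<W'}" "col' ` {..<W}"] by simp
    from W[OF this] show ?thesis
    proof
      assume "\<exists>a s. 1 \<le> s \<and> a + s * k < W \<and> (\<forall>i\<le>k. col' (a + s * i) = col' a)"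
      then obtain a t where "1 \<le> t" "a + t * k < W" "\<forall>i\<le>k. col' (a + t * i) = col' a" by blast
      thus ?thesis using inW'[OF bK, of "a + t * k"]
        by (intro disjI1 exI[of _ "b * W + a"] exI[of _ t]) (auto simp: col'_def add.assoc)
    next
      assume "\<exists>e Q. e < W \<and> finite Q \<and> card Q = f \<and> focused col' k e Q"
      then obtain e Q where e: "e < W" and Q: "finite Q" "card Q = f" "focused col' k e Q" by blast
      show ?thesis
      proof (cases "col' e \<in> Q")
        case True
        then obtain a t where t: "1 \<le> t" "a + t * k = e" "\<forall>i<k. col' (a + t * i) = col' e"
          using Q(3) unfolding focused_def by blast
        have "col' (a + t * i) = col' e" if "i \<le> k" for i
          using that t by (cases "i = k") auto
        hence "\<forall>i\<le>k. col (b * W + a + t * i) = col (b * W + a)"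
          using k unfolding col'_def
          by (metis add.assoc add.right_neutral le0 mult_0_right)
        thus ?thesis using inW'[OF bK e] t
          by (intro disjI1 exI[of _ "b * W + a"] exI[of _ t]) (auto simp: add.assoc)
      next
        case False
        define e' where "e' = (b + s * k) * W + e"
        have "focused col k e' (insert (col' e) Q)"
          unfolding focused_def
        proof
          fix q assume "q \<in> insert (col' e) Q"
          then consider "q = col' e" | "q \<in> Q" by blast
          thus "\<exists>a s. 1 \<le> s \<and> a + s * k = e' \<and> (\<forall>i<k. col (a + s * i) = q)"
          proof cases
            case 1
            have "col (b * W + e + s * W * i) = q" if "i < k" for i
              using same[OF that e] 1 by (simp add: col'_def algebra_simps)
            thus ?thesis using s W1
              by (intro exI[of _ "b * W + e"] exI[of _ "s * W"]) (auto simp: e'_def algebra_simps)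
          next
            case 2
            then obtain a t where t: "1 \<le> t" "a + t * k = e" "\<forall>i<k. col' (a + t * i) = q"
              using Q(3) unfolding focused_def by blast
            have "col (b * W + a + (t + s * W) * i) = q" if "i < k" for i
            proof -
              have "t * i \<le> t * k" using that by simp
              hence "a + t * i < W" using t(2) e by linarith
              from same[OF that this] have "col ((b + s * i) * W + (a + t * i)) = q"
                using t(3) that by (simp add: col'_def)
              moreover have "b * W + a + (t + s * W) * i = (b + s * i) * W + (a + t * i)"
                by (simp add: algebra_simps)
              ultimately show ?thesis by (simp only:)
            qed
            thus ?thesis using t
              by (intro exI[of _ "b * W + a"] exI[of _ "t + s * W"]) (auto simp: e'_def algebra_simps)
          qed
        qed
        thus ?thesis using inW'[OF b2 e] False Q
          by (intro disjI2 exI[of _ e'] exI[of _ "insert (col' e) Q"]) (auto simp: e'_def)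
      qed
    qed
  qed
  thus ?case using W1 K1 by (intro exI[of _ W']) (auto simp: W'_def)
qed

lemma vdw_bound_exists:
  assumes "1 \<le> k" shows "\<exists>K. vdw_bound k C K"
  using assms
proof (induction k arbitrary: C rule: dec_induct)
  case base
  have "\<exists>a s :: nat. 1 \<le> s \<and> s \<le> 1 \<and> (\<forall>i<1. a + s * i < 1) \<and> (\<forall>i<1. col (a + s * i) = col a)"
    for col :: "nat \<Rightarrow> nat"
    by (rule exI[of _ 0], rule exI[of _ 1]) simp
  hence "vdw_bound 1 C 1" by (simp add: vdw_bound_def)
  thus ?case ..
next
  case (step k)
  \<comment> \<open>A set of \<open>Suc C\<close> focused colours cannot occur when only
    \<open>C\<close> colours are in use, so the first alternative remains.\<close>
  from vdw_focusing[OF step(1) step(3), of C "Suc C"] obtain W where W1: "W \<ge> 1"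
    and W: "\<And>col :: nat \<Rightarrow> nat. card (col ` {..<W}) \<le> C \<Longrightarrow>
     (\<exists>a s. 1 \<le> s \<and> a + s * k < W \<and> (\<forall>i\<le>k. col (a + s * i) = col a)) \<or>
     (\<exists>e Q. e < W \<and> finite Q \<and> card Q = Suc C \<and> focused col k e Q)"
    by blast
  have "\<exists>a s. 1 \<le> s \<and> s \<le> W \<and> (\<forall>i<Suc k. a + s * i < W) \<and> (\<forall>i<Suc k. col (a + s * i) = col a)"
    if card: "card (col ` {..<W}) \<le> C" for col :: "nat \<Rightarrow> nat"
    using W[OF card]
  proof
    assume "\<exists>a s. 1 \<le> s \<and> a + s * k < W \<and> (\<forall>i\<le>k. col (a + s * i) = col a)"
    then obtain a s where s: "1 \<le> s" "a + s * k < W" "\<forall>i\<le>k. col (a + s * i) = col a" by blast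
    have "s * 1 \<le> s * k" using step(1) by (intro mult_le_mono2)
    hence "s \<le> W" using s(2) by linarith
    moreover have "a + s * i < W" if "i < Suc k" for i
      using s(2) that mult_le_mono2[of i k s] by linarith
    ultimately show ?thesis using s by (rule_tac exI[of _ a], rule_tac exI[of _ s]) auto
  next
    assume "\<exists>e Q. e < W \<and> finite Q \<and> card Q = Suc C \<and> focused col k e Q"
    then obtain e Q where e: "e < W" and Q: "card Q = Suc C" "focused col k e Q" by blast
    have "Q \<subseteq> col ` {..<W}"
    proof
      fix q assume "q \<in> Q"
      then obtain a s where "1 \<le> s" "a + s * k = e" "\<forall>i<k. col (a + s * i) = q"
        using Q(2) unfolding focused_def by blast
      hence "col a = q" "a < W" using step(1) e by (auto dest: spec[of _ 0])
      thus "q \<in> col ` {..<W}" by auto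
    qed
    hence "card Q \<le> C" using card card_mono[of "col ` {..<W}" Q] by simp
    thus ?thesis using Q by simp
  qed
  hence "vdw_bound (Suc k) C W" unfolding vdw_bound_def using W1 by (intro conjI allI impI)
  thus ?case ..
qed

text \<open>Other colour types are needed because the colour of a shift will be a tuple indexed by
  functions; numbering the finitely many colours in use reduces this to \<open>nat\<close>.\<close>

lemma van_der_Waerden:
  assumes "1 \<le> k"
  shows "\<exists>K. 1 \<le> K \<and> (\<forall>col :: nat \<Rightarrow> 'a. card (col ` {..<K}) \<le> C \<longrightarrow>
     (\<exists>a s. 1 \<le> s \<and> s \<le> K \<and> (\<forall>i<k. a + s * i < K) \<and> (\<forall>i<k. col (a + s * i) = col a)))"
proof -
  obtain K where K: "vdw_bound k C K" using vdw_bound_exists[OF assms] by blast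
  have "\<exists>a s. 1 \<le> s \<and> s \<le> K \<and> (\<forall>i<k. a + s * i < K) \<and> (\<forall>i<k. col (a + s * i) = col a)"
    if "card (col ` {..<K}) \<le> C" for col :: "nat \<Rightarrow> 'a"
  proof -
    define num where "num = to_nat_on (col ` {..<K})"
    have inj: "inj_on num (col ` {..<K})"
      unfolding num_def by (intro inj_on_to_nat_on countable_finite) auto
    have "card ((\<lambda>j. num (col j)) ` {..<K}) = card (num ` col ` {..<K})"
      by (simp add: image_image)
    hence "card ((\<lambda>j. num (col j)) ` {..<K}) \<le> C"
      using card_image_le[of "col ` {..<K}" num] that by simp
    then obtain a s where s: "1 \<le> s" "s \<le> K" "\<forall>i<k. a + s * i < K"
      "\<forall>i<k. num (col (a + s * i)) = num (col a)"
      using K unfolding vdw_bound_def by blast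
    have "col (a + s * i) = col a" if "i < k" for i
    proof (rule inj_onD[OF inj])
      have "a < K" using s(3) assms by (auto dest: spec[of _ 0])
      thus "col a \<in> col ` {..<K}" by blast
    qed (use s that in auto)
    thus ?thesis using s by blast
  qed
  moreover have "1 \<le> K" using K unfolding vdw_bound_def by (rule conjunct1)
  ultimately show ?thesis by (intro exI[of _ K]) simp
qed

section \<open>Sampling and total boundedness\<close>

lemma weighted_average_witness:
  fixes q X :: "'h \<Rightarrow> real"
  assumes "finite H" and q: "\<And>h. h \<in> H \<Longrightarrow> 0 \<le> q h" and q1: "sum q H = 1"
  shows "\<exists>h\<in>H. X h \<le> (\<Sum>h\<in>H. q h * X h)"
proof (rule ccontr)
  define m where "m = (\<Sum>h\<in>H. q h * X h)"
  assume "\<not> ?thesis"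
  hence less: "m < X h" if "h \<in> H" for h using that by (auto simp: m_def not_le)
  have "(\<Sum>h\<in>H. q h * (X h - m)) = (\<Sum>h\<in>H. q h * X h) - (\<Sum>h\<in>H. q h) * m"
    by (simp only: right_diff_distrib sum_subtractf sum_distrib_right)
  hence "(\<Sum>h\<in>H. q h * (X h - m)) = 0" using q1 by (simp add: m_def)
  moreover have "0 \<le> q h * (X h - m)" if "h \<in> H" for h
    using q[OF that] less[OF that] by simp
  ultimately have "\<forall>h\<in>H. q h * (X h - m) = 0"
    using sum_nonneg_eq_0_iff[OF assms(1), of "\<lambda>h. q h * (X h - m)"] by blast
  hence "\<forall>h\<in>H. q h = 0" using less by fastforce
  thus False using q1 by simp
qed

text \<open>
  The second moment method, derandomised: each sample is chosen so that the sum grows by at most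
  its mean increase.
\<close>

lemma sampling:
  fixes q :: "'h \<Rightarrow> real" and \<phi> :: "'t \<Rightarrow> 'h \<Rightarrow> complex"
  assumes H: "finite H" and q: "\<And>h. h \<in> H \<Longrightarrow> 0 \<le> q h" and q1: "sum q H = 1"
    and \<phi>: "\<And>t h. t \<in> T \<Longrightarrow> h \<in> H \<Longrightarrow> cmod (\<phi> t h) \<le> 1"
  shows "\<exists>w :: nat \<Rightarrow> 'h. (\<forall>s. w s \<in> H) \<and>
    (\<Sum>t\<in>T. (cmod (\<Sum>s<D. \<phi> t (w s) - (\<Sum>h\<in>H. q h * \<phi> t h)))\<^sup>2) \<le> real D * real (card T)"
proof (induction D)
  case 0
  have "H \<noteq> {}" using q1 by auto
  then obtain h where "h \<in> H" by blast
  thus ?case by (intro exI[of _ "\<lambda>_. h"]) simp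
next
  case (Suc D)
  define m where "m t = (\<Sum>h\<in>H. q h * \<phi> t h)" for t
  define \<psi> where "\<psi> t h = \<phi> t h - m t" for t h
  from Suc obtain w where w: "\<forall>s. w s \<in> H"
    and le: "(\<Sum>t\<in>T. (cmod (\<Sum>s<D. \<psi> t (w s)))\<^sup>2) \<le> real D * real (card T)"
    by (auto simp: \<psi>_def m_def)
  define S where "S t = (\<Sum>s<D. \<psi> t (w s))" for t
  \<comment> \<open>Since the mean of \<open>\<phi> t\<close> is \<open>m t\<close>, expanding
    around \<open>S t - m t\<close> gives \<open>|S t|^2 - |m t|^2\<close> plus the mean of
    \<open>|\<phi> t|^2\<close>, which is at most 1.\<close>
  have mean: "(\<Sum>h\<in>H. q h * (cmod (S t + \<psi> t h))\<^sup>2) \<le> (cmod (S t))\<^sup>2 + 1" if t: "t \<in> T" for t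
  proof -
    have sq: "(cmod (a + b))\<^sup>2 = (cmod a)\<^sup>2 + 2 * (a \<bullet> b) + (cmod b)\<^sup>2" for a b
      by (simp add: power2_norm_eq_inner inner_add_left inner_add_right inner_commute)
    have m: "m t = (\<Sum>h\<in>H. q h *\<^sub>R \<phi> t h)" by (simp add: m_def scaleR_conv_of_real)
    have inner: "(\<Sum>h\<in>H. q h * (a \<bullet> \<phi> t h)) = a \<bullet> m t" for a
      by (simp add: m inner_sum_right)
    have "(\<Sum>h\<in>H. q h * (cmod (S t + \<psi> t h))\<^sup>2)
        = (\<Sum>h\<in>H. q h * (cmod (S t - m t))\<^sup>2 + 2 * (q h * ((S t - m t) \<bullet> \<phi> t h)) + q h * (cmod (\<phi> t h))\<^sup>2)"
    proof (intro sum.cong refl)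
      fix h
      have "S t + \<psi> t h = (S t - m t) + \<phi> t h" by (simp add: \<psi>_def)
      thus "q h * (cmod (S t + \<psi> t h))\<^sup>2 =
        q h * (cmod (S t - m t))\<^sup>2 + 2 * (q h * ((S t - m t) \<bullet> \<phi> t h)) + q h * (cmod (\<phi> t h))\<^sup>2"
        by (simp only: sq distrib_left mult.left_commute)
    qed
    also have "\<dots> = (cmod (S t - m t))\<^sup>2 + 2 * ((S t - m t) \<bullet> m t) + (\<Sum>h\<in>H. q h * (cmod (\<phi> t h))\<^sup>2)"
      by (simp only: sum.distrib sum_distrib_right[symmetric] sum_distrib_left[symmetric] inner q1 mult_1)
    also have "\<dots> = (cmod (S t))\<^sup>2 - (cmod (m t))\<^sup>2 + (\<Sum>h\<in>H. q h * (cmod (\<phi> t h))\<^sup>2)"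
      using sq[of "S t - m t" "m t"] by simp
    also have "(\<Sum>h\<in>H. q h * (cmod (\<phi> t h))\<^sup>2) \<le> (\<Sum>h\<in>H. q h * 1)"
      using \<phi>[OF t] q by (intro sum_mono mult_left_mono) (auto intro: power_le_one)
    finally show ?thesis using q1 zero_le_power2[of "cmod (m t)"] unfolding mult_1_right by linarith
  qed
  obtain h where h: "h \<in> H" and le':
    "(\<Sum>t\<in>T. (cmod (S t + \<psi> t h))\<^sup>2) \<le> (\<Sum>h\<in>H. q h * (\<Sum>t\<in>T. (cmod (S t + \<psi> t h))\<^sup>2))"
    using weighted_average_witness[OF H q q1, of "\<lambda>h. \<Sum>t\<in>T. (cmod (S t + \<psi> t h))\<^sup>2"] by blast
  have "(\<Sum>t\<in>T. (cmod (\<Sum>s<Suc D. \<psi> t ((w(D := h)) s)))\<^sup>2) = (\<Sum>t\<in>T. (cmod (S t + \<psi> t h))\<^sup>2)"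
    by (simp add: S_def)
  also note le'
  also have "(\<Sum>h\<in>H. q h * (\<Sum>t\<in>T. (cmod (S t + \<psi> t h))\<^sup>2)) =
      (\<Sum>t\<in>T. \<Sum>h\<in>H. q h * (cmod (S t + \<psi> t h))\<^sup>2)"
    unfolding sum_distrib_left by (rule sum.swap)
  also have "\<dots> \<le> (\<Sum>t\<in>T. (cmod (S t))\<^sup>2 + 1)"
    by (intro sum_mono mean)
  also have "\<dots> \<le> real (Suc D) * real (card T)"
    using le by (simp add: S_def sum.distrib ring_distribs)
  finally have "(\<Sum>t\<in>T. (cmod (\<Sum>s<Suc D. \<psi> t ((w(D := h)) s)))\<^sup>2) \<le> real (Suc D) * real (card T)" .
  moreover have "\<forall>s. (w(D := h)) s \<in> H" using w h by simp
  ultimately show ?case unfolding \<psi>_def m_def by blast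
qed

lemma separated_net:
  fixes close :: "nat \<Rightarrow> nat \<Rightarrow> bool"
  assumes refl: "\<And>j. close j j" and sym: "\<And>i j. close i j \<Longrightarrow> close j i"
  shows "\<exists>X\<subseteq>{..<K}. (\<forall>i\<in>X. \<forall>j\<in>X. i \<noteq> j \<longrightarrow> \<not> close i j) \<and> (\<forall>j<K. \<exists>x\<in>X. close j x)"
proof (induction K)
  case (Suc K)
  then obtain X where X: "X \<subseteq> {..<K}" "\<forall>i\<in>X. \<forall>j\<in>X. i \<noteq> j \<longrightarrow> \<not> close i j"
    "\<forall>j<K. \<exists>x\<in>X. close j x" by blast
  show ?case
  proof (cases "\<exists>x\<in>X. close K x")
    case True
    thus ?thesis using X by (intro exI[of _ X]) (auto simp: less_Suc_eq)
  next
    case False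
    have "\<not> close x K" if "x \<in> X" for x using False sym that by blast
    thus ?thesis using X refl False
      by (intro exI[of _ "insert K X"]) (auto simp: less_Suc_eq)
  qed
qed simp

lemma norm_add3_power2_le:
  fixes a b c :: "'a :: real_normed_vector"
  shows "(norm (a + b + c))\<^sup>2 \<le> 3 * ((norm a)\<^sup>2 + (norm b)\<^sup>2 + (norm c)\<^sup>2)"
proof -
  have "(x + y + z)\<^sup>2 \<le> 3 * (x\<^sup>2 + y\<^sup>2 + z\<^sup>2)" for x y z :: real
    using zero_le_power2[of "x - y"] zero_le_power2[of "x - z"] zero_le_power2[of "y - z"]
    by (simp add: power2_eq_square algebra_simps)
  moreover have "(norm (a + b + c))\<^sup>2 \<le> (norm a + norm b + norm c)\<^sup>2"
    by (intro power_mono norm_triangle_mono) auto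
  ultimately show ?thesis using order_trans by blast
qed

lemma norm_add2_power2_le:
  fixes a b :: "'a :: real_normed_vector"
  shows "(norm (a + b))\<^sup>2 \<le> 2 * ((norm a)\<^sup>2 + (norm b)\<^sup>2)"
proof -
  have "(x + y)\<^sup>2 \<le> 2 * (x\<^sup>2 + y\<^sup>2)" for x y :: real
    using zero_le_power2[of "x - y"] by (simp add: power2_eq_square algebra_simps)
  moreover have "(norm (a + b))\<^sup>2 \<le> (norm a + norm b)\<^sup>2"
    by (intro power_mono norm_triangle_ineq) auto
  ultimately show ?thesis using order_trans by blast
qed

text \<open>
  Sampling replaces the \<open>n\<close> terms by a number of terms that depends only on \<open>\<eta>\<close>,
  for at least half of the indices in \<open>X\<close>; the sampled coefficients are then discretised.
\<close>

lemma separated_card_bound: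
  assumes \<eta>: "0 < (\<eta>::real)"
  shows "\<exists>C. \<forall>X n A (g :: nat \<Rightarrow> 'a \<Rightarrow> complex) (c :: nat \<Rightarrow> nat \<Rightarrow> complex).
    finite X \<longrightarrow> 1 \<le> n \<longrightarrow> finite A \<longrightarrow> A \<noteq> {} \<longrightarrow>
    (\<forall>s<n. \<forall>z\<in>A. cmod (g s z) \<le> 1) \<longrightarrow> (\<forall>j\<in>X. \<forall>s<n. cmod (c j s) \<le> 1) \<longrightarrow>
    (\<forall>i\<in>X. \<forall>j\<in>X. i \<noteq> j \<longrightarrow>
      \<eta> * real (card A) < (\<Sum>z\<in>A. (cmod ((\<Sum>s<n. c i s * g s z) / n - (\<Sum>s<n. c j s * g s z) / n))\<^sup>2)) \<longrightarrow>
    card X \<le> C"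
proof -
  \<comment> \<open>The choices balance the two errors in the final estimate: \<open>12 D\<close>
    from the sampling and \<open>12 D^2 \<kappa>^2\<close> from the rounding are each at most
    \<open>D^2 \<eta> / 2\<close>.\<close>
  define D where "D = nat \<lceil>24 / \<eta>\<rceil>"
  define \<kappa> where "\<kappa> = sqrt (\<eta> / 24)"
  define J where "J = {\<lfloor>- 1 / \<kappa>\<rfloor>..\<lfloor>1 / \<kappa>\<rfloor>}"
  define L where "L = {xs :: (int \<times> int) list. set xs \<subseteq> J \<times> J \<and> length xs = D}"
  have \<kappa>: "\<kappa> > 0" "\<kappa>\<^sup>2 = \<eta> / 24" using \<eta> by (auto simp: \<kappa>_def)
  have D: "24 / \<eta> \<le> real D" unfolding D_def using real_nat_ceiling_ge by blast
  hence D0: "real D > 0" using \<eta> less_le_trans[of 0 "24 / \<eta>" "real D"] by simp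
  have finL: "finite L" unfolding L_def J_def by (intro finite_lists_length_eq) auto
  have "card X \<le> 2 * card L"
    if X: "finite X" and n: "1 \<le> n" and A: "finite A" "A \<noteq> {}"
      and g: "\<forall>s<n. \<forall>z\<in>A. cmod (g s z) \<le> 1" and c: "\<forall>j\<in>X. \<forall>s<n. cmod (c j s) \<le> 1"
      and sep: "\<forall>i\<in>X. \<forall>j\<in>X. i \<noteq> j \<longrightarrow>
        \<eta> * real (card A) < (\<Sum>z\<in>A. (cmod ((\<Sum>s<n. c i s * g s z) / n - (\<Sum>s<n. c j s * g s z) / n))\<^sup>2)"
    for X n A and g :: "nat \<Rightarrow> 'a \<Rightarrow> complex" and c :: "nat \<Rightarrow> nat \<Rightarrow> complex"
  proof -
    define F where "F j z = (\<Sum>s<n. c j s * g s z) / n" for j z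
    have cg: "cmod (c j s * g s z) \<le> 1" if "j \<in> X" "s < n" "z \<in> A" for j s z
      using that g c by (auto simp: norm_mult intro: mult_le_one)
    have "\<exists>w :: nat \<Rightarrow> nat. (\<forall>s. w s \<in> {..<n}) \<and>
      (\<Sum>t\<in>X \<times> A. (cmod (\<Sum>s<D. (case t of (j, z) \<Rightarrow> c j (w s) * g (w s) z)
         - (\<Sum>h\<in>{..<n}. complex_of_real (1 / n) * (case t of (j, z) \<Rightarrow> c j h * g h z))))\<^sup>2)
        \<le> real D * real (card (X \<times> A))"
      by (rule sampling) (use n cg in auto)
    then obtain w where w: "\<And>s. w s < n" and
      "(\<Sum>t\<in>X \<times> A. (cmod (\<Sum>s<D. (case t of (j, z) \<Rightarrow> c j (w s) * g (w s) z)
         - (\<Sum>h\<in>{..<n}. complex_of_real (1 / n) * (case t of (j, z) \<Rightarrow> c j h * g h z))))\<^sup>2)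
        \<le> real D * real (card (X \<times> A))" by auto
    hence w': "(\<Sum>j\<in>X. \<Sum>z\<in>A. (cmod (\<Sum>s<D. c j (w s) * g (w s) z - F j z))\<^sup>2)
        \<le> real D * (real (card X) * real (card A))"
      by (simp add: sum.cartesian_product F_def sum_divide_distrib card_cartesian_product case_prod_unfold)
    define err where "err j = (\<Sum>z\<in>A. (cmod (\<Sum>s<D. c j (w s) * g (w s) z - F j z))\<^sup>2)" for j
    \<comment> \<open>By Markov's inequality at most half of the indices exceed twice the bound
      \<open>D * card A\<close> on the mean error; the others turn out to have distinct
      labels.\<close>
    define Bad where "Bad = {j \<in> X. 2 * real D * real (card A) < err j}"
    define Good where "Good = X - Bad"
    have cA: "real (card A) > 0" using A by (simp add: card_gt_0_iff)
    have fin: "finite Bad" "finite Good" "Bad \<subseteq> X" using X by (auto simp: Bad_def Good_def)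
    have err0: "0 \<le> err j" for j unfolding err_def by (intro sum_nonneg) auto
    have "real (card Bad) * (2 * real D * real (card A)) \<le> (\<Sum>j\<in>Bad. err j)"
      using sum_bounded_below[of Bad "2 * real D * real (card A)" err] by (auto simp: Bad_def)
    also have "\<dots> \<le> (\<Sum>j\<in>X. err j)" using X fin err0 by (intro sum_mono2) auto
    also have "\<dots> \<le> real D * (real (card X) * real (card A))" using w' by (simp add: err_def)
    finally have "real (card Bad) * 2 \<le> real (card X)"
      using D0 cA by (simp add: mult.assoc mult.left_commute)
    hence bad: "2 * card Bad \<le> card X" by linarith
    define lab where "lab j = map (\<lambda>s. (\<lfloor>Re (c j (w s)) / \<kappa>\<rfloor>, \<lfloor>Im (c j (w s)) / \<kappa>\<rfloor>)) [0..<D]" for j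
    have lab_in: "lab j \<in> L" if "j \<in> X" for j
    proof -
      have "\<lfloor>r / \<kappa>\<rfloor> \<in> J" if "\<bar>r\<bar> \<le> 1" for r
      proof -
        have "- 1 / \<kappa> \<le> r / \<kappa>" "r / \<kappa> \<le> 1 / \<kappa>"
          using that \<kappa> by (intro divide_right_mono; simp)+
        thus ?thesis unfolding J_def using floor_mono atLeastAtMost_iff by blast
      qed
      moreover have "\<bar>Re (c j (w s))\<bar> \<le> 1" "\<bar>Im (c j (w s))\<bar> \<le> 1" for s
        using c that w abs_Re_le_cmod[of "c j (w s)"] abs_Im_le_cmod[of "c j (w s)"]
        by (auto intro: order_trans)
      ultimately show ?thesis unfolding L_def lab_def by auto
    qed
    have "inj_on lab Good"
    proof (rule inj_onI, rule ccontr)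
      fix i j assume ij: "i \<in> Good" "j \<in> Good" "lab i = lab j" "i \<noteq> j"
      hence ijX: "i \<in> X" "j \<in> X" by (auto simp: Good_def)
      have errij: "err i \<le> 2 * real D * real (card A)" "err j \<le> 2 * real D * real (card A)"
        using ij by (auto simp: Good_def Bad_def)
      have diff: "cmod (c i (w s) - c j (w s)) \<le> 2 * \<kappa>" if "s < D" for s
      proof -
        have fl: "\<bar>a - b\<bar> \<le> \<kappa>" if "\<lfloor>a / \<kappa>\<rfloor> = \<lfloor>b / \<kappa>\<rfloor>" for a b
        proof -
          have "\<bar>a / \<kappa> - b / \<kappa>\<bar> \<le> 1" using that by linarith
          hence "\<bar>a - b\<bar> / \<kappa> \<le> 1" using \<kappa> by (simp add: diff_divide_distrib[symmetric])
          thus ?thesis using \<kappa> by simp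
        qed
        have "lab i ! s = lab j ! s" using ij by simp
        hence "\<bar>Re (c i (w s)) - Re (c j (w s))\<bar> \<le> \<kappa>" "\<bar>Im (c i (w s)) - Im (c j (w s))\<bar> \<le> \<kappa>"
          using that by (auto simp: lab_def intro!: fl)
        thus ?thesis using cmod_le[of "c i (w s) - c j (w s)"] by simp
      qed
      define V where "V k z = (\<Sum>s<D. c k (w s) * g (w s) z - F k z)" for k z
      have V: "V k z = (\<Sum>s<D. c k (w s) * g (w s) z) - D * F k z" for k z
        by (simp add: V_def sum_subtractf)
      have pt: "(cmod (D * (F i z - F j z)))\<^sup>2 \<le> 3 * ((cmod (V i z))\<^sup>2 + (cmod (V j z))\<^sup>2 + (D * (2 * \<kappa>))\<^sup>2)"
        if z: "z \<in> A" for z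
      proof -
        let ?d = "\<Sum>s<D. (c i (w s) - c j (w s)) * g (w s) z"
        have "cmod ?d \<le> (\<Sum>s<D. 2 * \<kappa>)"
        proof (rule order_trans[OF norm_sum sum_mono])
          fix s assume "s \<in> {..<D}"
          hence "cmod (c i (w s) - c j (w s)) * cmod (g (w s) z) \<le> 2 * \<kappa> * 1"
            using diff g w z \<kappa> by (intro mult_mono) auto
          thus "cmod ((c i (w s) - c j (w s)) * g (w s) z) \<le> 2 * \<kappa>" by (simp add: norm_mult)
        qed
        hence "(cmod ?d)\<^sup>2 \<le> (D * (2 * \<kappa>))\<^sup>2" by (intro power_mono) auto
        moreover have "D * (F i z - F j z) = - V i z + V j z + ?d"
          by (simp add: V algebra_simps sum_subtractf)
        ultimately show ?thesis
          using norm_add3_power2_le[of "- V i z" "V j z" ?d] by simp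
      qed
      have "D\<^sup>2 * (\<Sum>z\<in>A. (cmod (F i z - F j z))\<^sup>2) = (\<Sum>z\<in>A. (cmod (D * (F i z - F j z)))\<^sup>2)"
        by (simp add: norm_mult power_mult_distrib sum_distrib_left)
      also have "\<dots> \<le> (\<Sum>z\<in>A. 3 * ((cmod (V i z))\<^sup>2 + (cmod (V j z))\<^sup>2 + (D * (2 * \<kappa>))\<^sup>2))"
        by (intro sum_mono pt)
      also have "\<dots> = 3 * (err i + err j + card A * (D * (2 * \<kappa>))\<^sup>2)"
        by (simp add: sum_distrib_left[symmetric] sum.distrib err_def V_def)
      also have "\<dots> \<le> 3 * (4 * real D * real (card A) + card A * (D * (2 * \<kappa>))\<^sup>2)"
        using errij by simp
      also have "\<dots> = real (card A) * (12 * real D + 12 * D\<^sup>2 * \<kappa>\<^sup>2)"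
        by (simp add: power_mult_distrib algebra_simps)
      also have "\<dots> \<le> real (card A) * (D\<^sup>2 * \<eta>)"
      proof (intro mult_left_mono)
        have "24 \<le> real D * \<eta>" using D \<eta> by (simp add: field_simps)
        hence "24 * real D \<le> real D * \<eta> * real D" by (intro mult_right_mono) auto
        thus "12 * real D + 12 * D\<^sup>2 * \<kappa>\<^sup>2 \<le> D\<^sup>2 * \<eta>"
          unfolding \<kappa> by (simp add: power2_eq_square algebra_simps)
      qed simp
      finally have "(\<Sum>z\<in>A. (cmod (F i z - F j z))\<^sup>2) \<le> \<eta> * real (card A)"
        using D0 by (simp add: mult.left_commute mult.commute)
      thus False using sep ijX ij(4) unfolding F_def by fastforce
    qed
    hence "card Good \<le> card L"
      using lab_in finL by (intro card_inj_on_le[of lab]) (auto simp: Good_def)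
    moreover have "card Good = card X - card Bad"
      unfolding Good_def using fin by (intro card_Diff_subset) auto
    moreover have "card Bad \<le> card X" using X fin by (intro card_mono) auto
    ultimately show ?thesis using bad by linarith
  qed
  thus ?thesis by blast
qed

text \<open>Each index is coloured by a close member of a maximal separated set at squared distance
  \<open>\<eta> / 4\<close>; two such steps and the factor 2 of the squared triangle inequality add
  up to \<eta>. The bound \<open>C\<close> precedes \<open>n\<close> and \<open>K\<close>, so the
  colours grow neither with the number of samples nor with the number of shifts.\<close>

lemma total_boundedness_colouring:
  assumes \<eta>: "0 < (\<eta>::real)"
  shows "\<exists>C\<ge>1. \<forall>K n A (g :: nat \<Rightarrow> 'a \<Rightarrow> complex) (c :: nat \<Rightarrow> nat \<Rightarrow> complex).
    1 \<le> n \<longrightarrow> finite A \<longrightarrow> A \<noteq> {} \<longrightarrow>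
    (\<forall>s<n. \<forall>z\<in>A. cmod (g s z) \<le> 1) \<longrightarrow> (\<forall>j<K. \<forall>s<n. cmod (c j s) \<le> 1) \<longrightarrow>
    (\<exists>col :: nat \<Rightarrow> nat. card (col ` {..<K}) \<le> C \<and> (\<forall>i<K. \<forall>j<K. col i = col j \<longrightarrow>
      (\<Sum>z\<in>A. (cmod ((\<Sum>s<n. c i s * g s z) / n - (\<Sum>s<n. c j s * g s z) / n))\<^sup>2) \<le> \<eta> * real (card A)))"
proof -
  from \<eta> have "0 < \<eta> / 4" by simp
  from separated_card_bound[OF this, where 'a = 'a] obtain C where C:
    "\<forall>X n A (g :: nat \<Rightarrow> 'a \<Rightarrow> complex) (c :: nat \<Rightarrow> nat \<Rightarrow> complex).
    finite X \<longrightarrow> 1 \<le> n \<longrightarrow> finite A \<longrightarrow> A \<noteq> {} \<longrightarrow>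
    (\<forall>s<n. \<forall>z\<in>A. cmod (g s z) \<le> 1) \<longrightarrow> (\<forall>j\<in>X. \<forall>s<n. cmod (c j s) \<le> 1) \<longrightarrow>
    (\<forall>i\<in>X. \<forall>j\<in>X. i \<noteq> j \<longrightarrow>
      \<eta> / 4 * real (card A) < (\<Sum>z\<in>A. (cmod ((\<Sum>s<n. c i s * g s z) / n - (\<Sum>s<n. c j s * g s z) / n))\<^sup>2)) \<longrightarrow>
    card X \<le> C" ..
  have "\<exists>col :: nat \<Rightarrow> nat. card (col ` {..<K}) \<le> max 1 C \<and> (\<forall>i<K. \<forall>j<K. col i = col j \<longrightarrow>
      (\<Sum>z\<in>A. (cmod ((\<Sum>s<n. c i s * g s z) / n - (\<Sum>s<n. c j s * g s z) / n))\<^sup>2) \<le> \<eta> * real (card A))"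
    if n: "1 \<le> n" and A: "finite A" "A \<noteq> {}"
      and g: "\<forall>s<n. \<forall>z\<in>A. cmod (g s z) \<le> 1" and c: "\<forall>j<K. \<forall>s<n. cmod (c j s) \<le> 1"
    for K n A and g :: "nat \<Rightarrow> 'a \<Rightarrow> complex" and c :: "nat \<Rightarrow> nat \<Rightarrow> complex"
  proof -
    define F where "F j z = (\<Sum>s<n. c j s * g s z) / n" for j z
    define close where "close i j \<longleftrightarrow> (\<Sum>z\<in>A. (cmod (F i z - F j z))\<^sup>2) \<le> \<eta> / 4 * real (card A)" for i j
    have "close j j" for j using \<eta> by (simp add: close_def)
    moreover have "close j i" if "close i j" for i j
      using that unfolding close_def by (simp add: norm_minus_commute)
    ultimately obtain X where X: "X \<subseteq> {..<K}" "\<forall>i\<in>X. \<forall>j\<in>X. i \<noteq> j \<longrightarrow> \<not> close i j"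
      "\<forall>j<K. \<exists>x\<in>X. close j x" using separated_net[of close K] by blast
    have finX: "finite X" using X(1) finite_subset by blast
    have "card X \<le> C"
      by (rule C[rule_format, where n = n and A = A and g = g and c = c])
        (use X c g n A finX in \<open>auto simp: close_def F_def not_le\<close>)
    define col where "col j = (SOME x. x \<in> X \<and> close j x)" for j
    have col: "col j \<in> X \<and> close j (col j)" if "j < K" for j
      unfolding col_def by (rule someI_ex) (use X(3) that in blast)
    have "card (col ` {..<K}) \<le> card X"
      using col finX by (intro card_mono) auto
    moreover have "(\<Sum>z\<in>A. (cmod (F i z - F j z))\<^sup>2) \<le> \<eta> * real (card A)"
      if "i < K" "j < K" "col i = col j" for i j
    proof -
      have "close i (col i)" "close j (col i)" using col that by metis+
      hence le: "(\<Sum>z\<in>A. (cmod (F i z - F (col i) z))\<^sup>2) \<le> \<eta> / 4 * real (card A)"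
        "(\<Sum>z\<in>A. (cmod (F (col i) z - F j z))\<^sup>2) \<le> \<eta> / 4 * real (card A)"
        unfolding close_def by (auto simp: norm_minus_commute)
      have "(\<Sum>z\<in>A. (cmod (F i z - F j z))\<^sup>2) \<le>
          (\<Sum>z\<in>A. 2 * ((cmod (F i z - F (col i) z))\<^sup>2 + (cmod (F (col i) z - F j z))\<^sup>2))"
        by (intro sum_mono order_trans[OF _ norm_add2_power2_le]) simp
      also have "\<dots> = 2 * ((\<Sum>z\<in>A. (cmod (F i z - F (col i) z))\<^sup>2) + (\<Sum>z\<in>A. (cmod (F (col i) z - F j z))\<^sup>2))"
        by (simp add: sum.distrib sum_distrib_left)
      also have "\<dots> \<le> 2 * (\<eta> / 4 * real (card A) + \<eta> / 4 * real (card A))"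
        using le by (intro mult_left_mono add_mono) auto
      finally show ?thesis by simp
    qed
    ultimately show ?thesis using \<open>card X \<le> C\<close> unfolding F_def
      by (intro exI[of _ col]) auto
  qed
  thus ?thesis by (intro exI[of _ "max 1 C"]) auto
qed

section \<open>Averages and conditional expectations\<close>

lemma finite_ZN [simp]: "finite (ZN N)"
  by (simp add: ZN_def)

lemma card_ZN [simp]: "card (ZN N) = N"
  by (simp add: ZN_def)

lemma avg_ZN: "avg (ZN N) f = (\<Sum>x\<in>ZN N. f x) / real N"
  by (simp add: avg_def)

lemma ZN_funD:
  assumes "f \<in> ZN_fun N" shows "f (x + int N) = f x" "f (x + int N + t) = f (x + t)"
  using assms spec[of "\<lambda>x. f (x + int N) = f x" "x + t"] by (auto simp: ZN_fun_def algebra_simps)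

lemma ZN_fun_mult:
  assumes "f \<in> ZN_fun N" shows "f (x + k * int N) = f x"
proof (induction k rule: int_induct[of _ 0])
  case (step1 i)
  thus ?case using ZN_funD(1)[OF assms, of "x + i * int N"] by (simp add: algebra_simps)
next
  case (step2 i)
  thus ?case using ZN_funD(1)[OF assms, of "x + (i - 1) * int N"] by (simp add: algebra_simps)
qed simp

lemma ZN_fun_mod:
  assumes "f \<in> ZN_fun N" shows "f (x mod int N) = f x" "f (x + n mod int N) = f (x + n)"
proof -
  show "f (x mod int N) = f x"
    using ZN_fun_mult[OF assms, of "x mod int N" "x div int N"] by simp
  show "f (x + n mod int N) = f (x + n)"
    using ZN_fun_mult[OF assms, of "x + n mod int N" "n div int N"] by (simp add: add.assoc)
qed

lemma ZN_fun_shift: "f \<in> ZN_fun N \<Longrightarrow> (\<lambda>x. f (x + t)) \<in> ZN_fun N"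
  by (simp add: ZN_fun_def algebra_simps) (metis add.assoc add.commute)

lemma ZN_fun_comp: "f \<in> ZN_fun N \<Longrightarrow> (\<lambda>x. h (f x)) \<in> ZN_fun N"
  by (simp add: ZN_fun_def)

lemma ZN_fun_comp2: "f \<in> ZN_fun N \<Longrightarrow> g \<in> ZN_fun N \<Longrightarrow> (\<lambda>x. h (f x) (g x)) \<in> ZN_fun N"
  by (simp add: ZN_fun_def)

lemma ZN_fun_Ball: "(\<And>i. P i \<Longrightarrow> f i \<in> ZN_fun N) \<Longrightarrow> (\<lambda>x. \<forall>i. P i \<longrightarrow> f i x) \<in> ZN_fun N"
  by (simp add: ZN_fun_def)

lemma ZN_fun_Bex: "(\<And>i. P i \<Longrightarrow> f i \<in> ZN_fun N) \<Longrightarrow> (\<lambda>x. \<exists>i. P i \<and> f i x) \<in> ZN_fun N"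
  by (auto simp: ZN_fun_def)

lemma sum_ZN_shift:
  assumes f: "f \<in> ZN_fun N" shows "(\<Sum>x\<in>ZN N. f (x + t)) = (\<Sum>x\<in>ZN N. f x)"
proof (cases "N = 0")
  case False
  have "bij_betw (\<lambda>x. (x + t) mod int N) (ZN N) (ZN N)"
  proof (rule bij_betwI[of _ _ _ "\<lambda>x. (x - t) mod int N"])
    show "((x + t) mod int N - t) mod int N = x" if "x \<in> ZN N" for x
      using that by (simp add: ZN_def mod_diff_left_eq)
    show "((x - t) mod int N + t) mod int N = x" if "x \<in> ZN N" for x
      using that by (simp add: ZN_def mod_add_left_eq)
  qed (use False in \<open>auto simp: ZN_def\<close>)
  from sum.reindex_bij_betw[OF this, of f] show ?thesis
    using ZN_fun_mod(1)[OF f] by simp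
qed (simp add: ZN_def)

lemma avg_ZN_shift: "f \<in> ZN_fun N \<Longrightarrow> avg (ZN N) (\<lambda>x. f (x + t)) = avg (ZN N) f"
  by (simp add: avg_ZN sum_ZN_shift)

lemma avg_mono: "(\<And>x. x \<in> A \<Longrightarrow> f x \<le> g x) \<Longrightarrow> avg A f \<le> avg A g"
  unfolding avg_def by (intro divide_right_mono sum_mono) auto

lemma avg_nonneg: "(\<And>x. x \<in> A \<Longrightarrow> 0 \<le> f x) \<Longrightarrow> 0 \<le> avg A f"
  unfolding avg_def by (intro divide_nonneg_nonneg sum_nonneg) auto

lemma avg_add: "avg A (\<lambda>x. f x + g x) = avg A f + avg A g"
  by (simp add: avg_def sum.distrib add_divide_distrib)

lemma avg_diff: "avg A (\<lambda>x. f x - g x) = avg A f - avg A g"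
  by (simp add: avg_def sum_subtractf diff_divide_distrib)

lemma avg_cmult: "avg A (\<lambda>x. c * f x) = c * avg A f"
  by (simp add: avg_def sum_distrib_left)

lemma avg_divide: "avg A (\<lambda>x. f x / c) = avg A f / c"
  by (simp add: avg_def sum_divide_distrib mult.commute)

lemma avg_sum: "avg A (\<lambda>x. \<Sum>i\<in>I. f i x) = (\<Sum>i\<in>I. avg A (f i))"
  unfolding avg_def by (subst sum.swap) (simp add: sum_divide_distrib)

lemma avg_ZN_const: "0 < N \<Longrightarrow> avg (ZN N) (\<lambda>_. c) = c"
  by (simp add: avg_ZN)

lemma markov_avg:
  assumes "0 < t" "\<And>x. x \<in> A \<Longrightarrow> 0 \<le> f x"
  shows "avg A (\<lambda>x. of_bool (t \<le> f x)) \<le> avg A f / t"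
proof -
  have "avg A (\<lambda>x. of_bool (t \<le> f x)) \<le> avg A (\<lambda>x. f x / t)"
    by (intro avg_mono) (use assms in auto)
  thus ?thesis by (simp add: avg_divide)
qed

lemma markov_avg_square:
  assumes "0 < t"
  shows "avg A (\<lambda>x. of_bool (t \<le> \<bar>f x\<bar>)) \<le> avg A (\<lambda>x. (f x)\<^sup>2) / t\<^sup>2"
proof -
  have "(t \<le> \<bar>f x\<bar>) = (t\<^sup>2 \<le> (f x)\<^sup>2)" for x
    using assms power_mono_iff[of t "\<bar>f x\<bar>" 2] by simp
  thus ?thesis using markov_avg[of "t\<^sup>2" A "\<lambda>x. (f x)\<^sup>2"] assms by simp
qed

section \<open>Partitions, conditional expectation and energy\<close>

definition zrel :: "nat \<Rightarrow> (int \<Rightarrow> int \<Rightarrow> bool) \<Rightarrow> bool" where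
  "zrel N R \<longleftrightarrow> equivp R \<and> (\<forall>x. R x (x + int N))"

lemma zrelD:
  assumes "zrel N R"
  shows "R x x" "R x y \<Longrightarrow> R y x" "R x y \<Longrightarrow> R y z \<Longrightarrow> R x z" "R x (x + int N)"
  using assms unfolding zrel_def by (auto dest: equivp_reflp equivp_symp equivp_transp)

lemma zrel_sym: "zrel N R \<Longrightarrow> R x y = R y x"
  using zrelD(2) by blast

lemma zrel_cong: "zrel N R \<Longrightarrow> R x y \<Longrightarrow> R x z = R y z"
  using zrelD(2,3) by metis

lemma zrel_ZN_fun: "zrel N R \<Longrightarrow> R x \<in> ZN_fun N"
  unfolding ZN_fun_def using zrelD(2-4)[of N R] by blast

lemma zrelI:
  assumes "\<And>x. R x x" "\<And>x y. R x y \<Longrightarrow> R y x" "\<And>x y z. R x y \<Longrightarrow> R y z \<Longrightarrow> R x z"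
    "\<And>x. R x (x + int N)"
  shows "zrel N R"
  unfolding zrel_def using assms by (intro conjI equivpI reflpI sympI transpI) blast+

lemma zrel_invariant_ZN_fun:
  assumes "zrel N R" "\<And>x y. R x y \<Longrightarrow> g x = g y" shows "g \<in> ZN_fun N"
  unfolding ZN_fun_def using assms(2)[OF zrelD(4)[OF assms(1)]] by auto

text \<open>
  A finite \<open>\<sigma>\<close>-algebra is represented by the equivalence relation of lying in the same atom,
  so that refinement is \<open>\<le>\<close> and the join is the intersection.
\<close>

definition cexp :: "nat \<Rightarrow> (int \<Rightarrow> int \<Rightarrow> bool) \<Rightarrow> (int \<Rightarrow> real) \<Rightarrow> int \<Rightarrow> real" where
  "cexp N R f x = (\<Sum>y\<in>ZN N. of_bool (R x y) * f y) / (\<Sum>y\<in>ZN N. of_bool (R x y))"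

definition energy :: "nat \<Rightarrow> (int \<Rightarrow> real) \<Rightarrow> (int \<Rightarrow> int \<Rightarrow> bool) \<Rightarrow> real" where
  "energy N f R = avg (ZN N) (\<lambda>x. (cexp N R f x)\<^sup>2)"

definition shift_rel :: "int \<Rightarrow> (int \<Rightarrow> int \<Rightarrow> bool) \<Rightarrow> int \<Rightarrow> int \<Rightarrow> bool" where
  "shift_rel t R x y \<longleftrightarrow> R (x + t) (y + t)"

lemma atom_weight_pos:
  assumes "zrel N R" "0 < N" shows "0 < (\<Sum>y\<in>ZN N. of_bool (R x y) :: real)"
proof -
  have "R x (x mod int N)"
    using ZN_fun_mod(1)[OF zrel_ZN_fun[OF assms(1)], of x x] zrelD(1)[OF assms(1)] by simp
  moreover have "x mod int N \<in> ZN N" using assms(2) by (simp add: ZN_def)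
  ultimately show ?thesis by (intro sum_pos2[of _ "x mod int N"]) auto
qed

lemma cexp_cong:
  assumes "zrel N R" "R x y" shows "cexp N R f x = cexp N R f y"
  unfolding cexp_def using zrel_cong[OF assms] by simp

lemma cexp_ZN_fun: "zrel N R \<Longrightarrow> cexp N R f \<in> ZN_fun N"
  using zrel_invariant_ZN_fun cexp_cong by blast

text \<open>Conditional expectation is the orthogonal projection onto the functions constant on
  atoms: its kernel \<open>of_bool (R x y) / w x\<close> is symmetric, because the atom size
  \<open>w\<close> is itself constant on atoms.\<close>

lemma sum_cexp_mult:
  assumes R: "zrel N R" and N: "0 < N" and g: "\<And>x y. R x y \<Longrightarrow> g x = g y"
  shows "(\<Sum>x\<in>ZN N. cexp N R f x * g x) = (\<Sum>x\<in>ZN N. f x * g x)"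
proof -
  define w where "w x = (\<Sum>y\<in>ZN N. of_bool (R x y) :: real)" for x
  have w: "w x > 0" for x unfolding w_def by (rule atom_weight_pos[OF R N])
  have inv: "w x = w y" if "R x y" for x y
    unfolding w_def using zrel_cong[OF R that] by simp
  have "(\<Sum>x\<in>ZN N. cexp N R f x * g x) = (\<Sum>x\<in>ZN N. \<Sum>y\<in>ZN N. of_bool (R x y) * f y / w x * g x)"
    unfolding cexp_def w_def[symmetric] sum_divide_distrib sum_distrib_right ..
  also have "\<dots> = (\<Sum>y\<in>ZN N. \<Sum>x\<in>ZN N. of_bool (R x y) * f y / w x * g x)"
    by (rule sum.swap)
  also have "\<dots> = (\<Sum>y\<in>ZN N. \<Sum>x\<in>ZN N. of_bool (R y x) * (f y / w y * g y))"
  proof (intro sum.cong refl)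
    fix x y
    show "of_bool (R x y) * f y / w x * g x = of_bool (R y x) * (f y / w y * g y)"
      using zrel_sym[OF R, of x y] inv[of x y] g[of x y] by (cases "R x y") auto
  qed
  also have "\<dots> = (\<Sum>y\<in>ZN N. w y * (f y / w y * g y))"
    unfolding w_def sum_distrib_right[symmetric] ..
  also have "\<dots> = (\<Sum>y\<in>ZN N. f y * g y)"
    using w by (intro sum.cong refl) (simp add: less_imp_neq[THEN not_sym])
  finally show ?thesis .
qed

lemma avg_cexp:
  assumes "zrel N R" "0 < N" shows "avg (ZN N) (cexp N R f) = avg (ZN N) f"
  using sum_cexp_mult[OF assms, of "\<lambda>_. 1" f] by (simp add: avg_ZN)

text \<open>Pythagoras: \<open>cexp N R f\<close> is constant on the atoms of the refinement
  \<open>R'\<close> and is the projection of \<open>cexp N R' f\<close>, so the cross term equals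
  the smaller energy.\<close>

lemma energy_diff:
  assumes R: "zrel N R" and R': "zrel N R'" and le: "R' \<le> R" and N: "0 < N"
  shows "avg (ZN N) (\<lambda>x. (cexp N R' f x - cexp N R f x)\<^sup>2) = energy N f R' - energy N f R"
proof -
  let ?c = "cexp N R f" and ?c' = "cexp N R' f"
  have "?c x = ?c y" if "R' x y" for x y using le that cexp_cong[OF R] by blast
  hence "(\<Sum>x\<in>ZN N. ?c' x * ?c x) = (\<Sum>x\<in>ZN N. f x * ?c x)"
    by (intro sum_cexp_mult[OF R' N])
  moreover have "(\<Sum>x\<in>ZN N. ?c x * ?c x) = (\<Sum>x\<in>ZN N. f x * ?c x)"
    by (intro sum_cexp_mult[OF R N] cexp_cong[OF R])
  ultimately have *: "(\<Sum>x\<in>ZN N. ?c' x * ?c x) = (\<Sum>x\<in>ZN N. (?c x)\<^sup>2)"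
    by (simp add: power2_eq_square)
  have "(\<Sum>x\<in>ZN N. (?c' x - ?c x)\<^sup>2) =
      (\<Sum>x\<in>ZN N. (?c' x)\<^sup>2) + (\<Sum>x\<in>ZN N. (?c x)\<^sup>2) - 2 * (\<Sum>x\<in>ZN N. ?c' x * ?c x)"
    by (simp add: power2_diff sum_subtractf sum.distrib sum_distrib_left mult.assoc)
  also have "\<dots> = (\<Sum>x\<in>ZN N. (?c' x)\<^sup>2) - (\<Sum>x\<in>ZN N. (?c x)\<^sup>2)" using * by simp
  finally show ?thesis by (simp add: avg_ZN energy_def diff_divide_distrib)
qed

lemma cexp_le:
  assumes "zrel N R" "0 < N" "\<And>x. f x \<le> B" shows "cexp N R f x \<le> B"
proof -
  have "(\<Sum>y\<in>ZN N. of_bool (R x y) * f y) \<le> (\<Sum>y\<in>ZN N. of_bool (R x y) * B)"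
    using assms(3) by (intro sum_mono mult_left_mono) auto
  thus ?thesis using atom_weight_pos[OF assms(1,2), of x]
    by (simp add: cexp_def pos_divide_le_eq sum_distrib_right mult.commute sum_distrib_left)
qed

lemma cexp_uminus: "cexp N R (\<lambda>x. - f x) x = - cexp N R f x"
  by (simp add: cexp_def sum_negf)

lemma energy_bounds:
  assumes "zrel N R" "0 < N" "\<And>x. \<bar>f x\<bar> \<le> B" shows "0 \<le> energy N f R" "energy N f R \<le> B\<^sup>2"
proof -
  show "0 \<le> energy N f R" unfolding energy_def by (intro avg_nonneg) auto
  have "\<bar>cexp N R f x\<bar> \<le> B" for x
    using cexp_le[OF assms(1,2), of f B x] cexp_le[OF assms(1,2), of "\<lambda>x. - f x" B x] assms(3)
    unfolding cexp_uminus by (smt (verit))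
  hence "(cexp N R f x)\<^sup>2 \<le> B\<^sup>2" for x
    by (metis abs_ge_zero power2_abs power_mono)
  hence "energy N f R \<le> avg (ZN N) (\<lambda>_. B\<^sup>2)" unfolding energy_def by (intro avg_mono)
  thus "energy N f R \<le> B\<^sup>2" using assms(2) by (simp add: avg_ZN_const)
qed

lemma zrel_shift: "zrel N R \<Longrightarrow> zrel N (shift_rel t R)"
  unfolding shift_rel_def
  by (rule zrelI) (auto intro: zrelD simp: zrel_ZN_fun[THEN ZN_funD(2)])

lemma shift_rel_shift_rel: "shift_rel t (shift_rel s R) = shift_rel (s + t) R"
  by (auto simp: shift_rel_def fun_eq_iff algebra_simps)

lemma shift_rel_0 [simp]: "shift_rel 0 R = R"
  by (simp add: shift_rel_def fun_eq_iff)

text \<open>Energy comparisons concern one fixed function on varying partitions. The identity moves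
  a shift from the function to the partition, so that they also apply to shifts of the
  function.\<close>

lemma cexp_shift:
  assumes "zrel N R" "f \<in> ZN_fun N"
  shows "cexp N R (\<lambda>y. f (y + t)) x = cexp N (shift_rel (- t) R) f (x + t)"
proof -
  have R: "shift_rel (- t) R (x + t) \<in> ZN_fun N"
    using zrel_ZN_fun[OF zrel_shift[OF assms(1)]] .
  have eq: "R x y = shift_rel (- t) R (x + t) (y + t)" for y
    by (simp add: shift_rel_def)
  have 1: "(\<lambda>z. of_bool (shift_rel (- t) R (x + t) z) * f z) \<in> ZN_fun N"
    by (rule ZN_fun_comp2[OF R assms(2)])
  have 2: "(\<lambda>z. of_bool (shift_rel (- t) R (x + t) z) :: real) \<in> ZN_fun N"
    by (rule ZN_fun_comp[OF R])
  show ?thesis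
    unfolding cexp_def eq sum_ZN_shift[OF 1] sum_ZN_shift[OF 2] ..
qed

lemma zrel_join:
  "(\<And>Q. Q \<in> \<Q> \<Longrightarrow> zrel N Q) \<Longrightarrow> zrel N (\<lambda>x y. \<forall>Q\<in>\<Q>. Q x y)"
  by (rule zrelI) (meson zrelD)+

section \<open>Almost periodic functions and the partitions they determine\<close>

text \<open>The strict inequality makes the infimum in the norm yield an actual representation with
  a constant below \<open>M\<close>. Coefficients of norm at most 1 are accordingly placed in balls
  of radius 2.\<close>

definition UAP_ball :: "nat \<Rightarrow> nat \<Rightarrow> real \<Rightarrow> (int \<Rightarrow> complex) set" where
  "UAP_ball N d M = {u \<in> ZN_fun N. UAP_pow_norm N d u < ennreal M}"

lemma cmod_le_Linf_norm:
  assumes N: "0 < N" and g: "g \<in> ZN_fun N" shows "cmod (g x) \<le> Linf_norm N g"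
proof -
  have "x mod int N \<in> ZN N" using N by (simp add: ZN_def)
  hence "cmod (g (x mod int N)) \<le> Linf_norm N g"
    unfolding Linf_norm_def by (intro cSUP_upper) auto
  thus ?thesis by (simp add: ZN_fun_mod(1)[OF g])
qed

lemma UAP_rep_expand:
  assumes N: "0 < N" and rep: "UAP_rep N nA F M'" and F: "F \<in> ZN_fun N"
  obtains H q and g :: "nat \<Rightarrow> int \<Rightarrow> complex" and C :: "int \<Rightarrow> nat \<Rightarrow> int \<Rightarrow> complex" where
    "finite (H :: nat set)" "\<And>h. h \<in> H \<Longrightarrow> 0 \<le> q h" "sum q H = (1 :: real)"
    "\<And>h x. h \<in> H \<Longrightarrow> cmod (g h x) \<le> 1"
    "\<And>n h. h \<in> H \<Longrightarrow> C n h \<in> ZN_fun N" "\<And>n h. h \<in> H \<Longrightarrow> nA (C n h) \<le> 1"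
    "\<And>n x. F (x + n) = M' * (\<Sum>h\<in>H. q h * (C n h x * g h x))"
proof -
  from rep obtain H :: "nat set" and p g c where H: "finite H" "set_pmf p \<subseteq> H" and g: "\<forall>h\<in>H. bounded_fun N (g h)"
    and c: "\<forall>n\<in>ZN N. \<forall>h\<in>H. c n h \<in> ZN_fun N \<and> nA (c n h) \<le> 1"
    and eq: "\<forall>n\<in>ZN N. \<forall>x. shift n F x =
           complex_of_real M' * measure_pmf.expectation p (\<lambda>h. c n h x * g h x)"
    unfolding UAP_rep_def by blast
  have mod: "n mod int N \<in> ZN N" for n using N by (simp add: ZN_def)
  show thesis
  proof (rule that[of H "pmf p" g "\<lambda>n. c (n mod int N)"])
    show "F (x + n) = M' * (\<Sum>h\<in>H. pmf p h * (c (n mod int N) h x * g h x))" for n x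
    proof -
      have "F (x + n) = shift (n mod int N) F x"
        by (simp add: shift_def ZN_fun_mod(2)[OF F])
      also have "measure_pmf.expectation p (\<lambda>h. c (n mod int N) h x * g h x) =
          (\<Sum>h\<in>H. pmf p h *\<^sub>R (c (n mod int N) h x * g h x))"
        using H by (intro integral_measure_pmf) auto
      ultimately show ?thesis using eq mod by (simp add: scaleR_conv_of_real)
    qed
    show "cmod (g h x) \<le> 1" if "h \<in> H" for h x
      using g that cmod_le_Linf_norm[OF N, of "g h" x] unfolding bounded_fun_def by force
  qed (use H c mod sum_pmf_eq_1 in auto)
qed

text \<open>By induction every representation bounds \<open>u\<close> by its constant
  \<open>M'\<close>, since the coefficients and the functions \<open>g h\<close> are at most 1. The
  infimum need not be attained, so this is used with \<open>M' < 1 + e\<close> for every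
  \<open>e\<close>.\<close>

lemma cmod_le_1_if_UAP_pow_norm:
  assumes N: "0 < N"
  shows "u \<in> ZN_fun N \<Longrightarrow> UAP_pow_norm N d u \<le> 1 \<Longrightarrow> cmod (u x) \<le> 1"
proof (induction d arbitrary: u x)
  case 0
  hence "ennreal (Linf_norm N u) \<le> 1"
    by (auto simp: const_norm_def top_unique split: if_splits)
  hence "Linf_norm N u \<le> 1" by simp
  thus ?case using cmod_le_Linf_norm[OF N 0(1), of x] by simp
next
  case (Suc d)
  have rep: "cmod (u x) \<le> M'" if rep: "UAP_rep N (UAP_pow_norm N d) u M'" for M'
  proof -
    from rep have M': "0 \<le> M'" by (simp add: UAP_rep_def)
    obtain H q and g :: "nat \<Rightarrow> int \<Rightarrow> complex" and C :: "int \<Rightarrow> nat \<Rightarrow> int \<Rightarrow> complex" where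
      H: "finite (H :: nat set)" "\<And>h. h \<in> H \<Longrightarrow> 0 \<le> q h" "sum q H = (1 :: real)"
      "\<And>h x. h \<in> H \<Longrightarrow> cmod (g h x) \<le> 1"
      "\<And>n h. h \<in> H \<Longrightarrow> C n h \<in> ZN_fun N" "\<And>n h. h \<in> H \<Longrightarrow> UAP_pow_norm N d (C n h) \<le> 1"
      "\<And>n x. u (x + n) = M' * (\<Sum>h\<in>H. q h * (C n h x * g h x))"
      using UAP_rep_expand[OF N rep Suc.prems(1)] by blast
    have "cmod (\<Sum>h\<in>H. q h * (C 0 h x * g h x)) \<le> (\<Sum>h\<in>H. q h)"
    proof (rule order_trans[OF norm_sum sum_mono])
      fix h assume h: "h \<in> H"
      have "cmod (C 0 h x) * cmod (g h x) \<le> 1"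
        using H(4)[OF h] Suc.IH[OF H(5)[OF h] H(6)[OF h]] by (intro mult_le_one) auto
      thus "cmod (q h * (C 0 h x * g h x)) \<le> q h"
        using H(2)[OF h] by (simp add: norm_mult mult_left_le)
    qed
    thus ?thesis using H(7)[of x 0] H(3) M' by (simp add: norm_mult mult_left_le)
  qed
  show ?case
  proof (rule field_le_epsilon)
    fix e :: real assume e: "0 < e"
    have "UAP_pow_norm N (Suc d) u < ennreal (1 + e)"
      using Suc.prems(2) e by (rule_tac le_less_trans) (auto simp flip: ennreal_1 intro!: ennreal_lessI simp del: ennreal_1)
    then obtain M' where "UAP_rep N (UAP_pow_norm N d) u M'" "ennreal M' < ennreal (1 + e)"
      by (auto simp: UAP_norm_def INF_less_iff)
    moreover from this have "M' < 1 + e" by (simp add: UAP_rep_def ennreal_less_iff)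
    ultimately show "cmod (u x) \<le> 1 + e" using rep[of M'] by simp
  qed
qed

lemma UAP_ball_Suc_rep:
  assumes N: "0 < N" and u: "u \<in> UAP_ball N (Suc d) M"
  obtains M' :: real and H q and g :: "nat \<Rightarrow> int \<Rightarrow> complex" and C :: "int \<Rightarrow> nat \<Rightarrow> int \<Rightarrow> complex" where
    "0 \<le> M'" "M' \<le> M" "finite (H :: nat set)" "\<And>h. h \<in> H \<Longrightarrow> 0 \<le> q h" "sum q H = (1 :: real)"
    "\<And>h x. h \<in> H \<Longrightarrow> cmod (g h x) \<le> 1"
    "\<And>n h. h \<in> H \<Longrightarrow> C n h \<in> UAP_ball N d 2" "\<And>n h x. h \<in> H \<Longrightarrow> cmod (C n h x) \<le> 1"
    "\<And>n x. u (x + n) = M' * (\<Sum>h\<in>H. q h * (C n h x * g h x))"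
proof -
  from u have uZ: "u \<in> ZN_fun N" and "UAP_norm N (UAP_pow_norm N d) u < ennreal M"
    by (auto simp: UAP_ball_def)
  then obtain M' where rep: "UAP_rep N (UAP_pow_norm N d) u M'" and "ennreal M' < ennreal M"
    by (auto simp: UAP_norm_def INF_less_iff)
  hence M': "0 \<le> M'" "M' \<le> M" by (auto simp: UAP_rep_def ennreal_less_iff)
  obtain H q and g :: "nat \<Rightarrow> int \<Rightarrow> complex" and C :: "int \<Rightarrow> nat \<Rightarrow> int \<Rightarrow> complex" where
    H: "finite (H :: nat set)" "\<And>h. h \<in> H \<Longrightarrow> 0 \<le> q h" "sum q H = (1 :: real)"
    "\<And>h x. h \<in> H \<Longrightarrow> cmod (g h x) \<le> 1"
    "\<And>n h. h \<in> H \<Longrightarrow> C n h \<in> ZN_fun N" "\<And>n h. h \<in> H \<Longrightarrow> UAP_pow_norm N d (C n h) \<le> 1"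
    "\<And>n x. u (x + n) = M' * (\<Sum>h\<in>H. q h * (C n h x * g h x))"
    using UAP_rep_expand[OF N rep uZ] by blast
  have "C n h \<in> UAP_ball N d 2" if "h \<in> H" for n h
    using H(5)[OF that] le_less_trans[OF H(6)[OF that], of 2] unfolding UAP_ball_def by simp
  thus thesis
    using that[OF M' H(1-4) _ _ H(7)] cmod_le_1_if_UAP_pow_norm[OF N H(5,6)] by blast
qed

text \<open>Shifting \<open>F\<close> by \<open>t\<close> only reindexes the coefficients by
  \<open>n + t\<close> and keeps the functions \<open>g\<close>, so no induction on \<open>d\<close>
  takes place; at order 0 only constants have finite norm.\<close>

lemma UAP_pow_norm_shift:
  assumes N: "0 < N" and F: "F \<in> ZN_fun N"
  shows "UAP_pow_norm N d (\<lambda>x. F (x + t)) \<le> UAP_pow_norm N d F"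
proof (cases d)
  case 0
  thus ?thesis by (auto simp: const_norm_def)
next
  case (Suc e)
  have "UAP_rep N nA (\<lambda>x. F (x + t)) M'" if rep: "UAP_rep N nA F M'" for nA M'
  proof -
    from rep obtain H :: "nat set" and p g c where *: "0 \<le> M'" "finite H" "H \<noteq> {}" "set_pmf p \<subseteq> H"
      "\<forall>h\<in>H. bounded_fun N (g h)" "\<forall>n\<in>ZN N. \<forall>h\<in>H. c n h \<in> ZN_fun N \<and> nA (c n h) \<le> 1"
      and eq: "\<forall>n\<in>ZN N. \<forall>x. shift n F x =
           complex_of_real M' * measure_pmf.expectation p (\<lambda>h. c n h x * g h x)"
      unfolding UAP_rep_def by blast
    have mod: "n mod int N \<in> ZN N" for n using N by (simp add: ZN_def)
    have "shift n (\<lambda>x. F (x + t)) x = shift ((n + t) mod int N) F x" for n x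
      by (simp add: shift_def ZN_fun_mod(2)[OF F] add.assoc)
    thus ?thesis unfolding UAP_rep_def using * eq mod
      by (intro conjI exI[of _ H] exI[of _ p] exI[of _ g] exI[of _ "\<lambda>n. c ((n + t) mod int N)"]) auto
  qed
  thus ?thesis by (auto simp: Suc UAP_norm_def intro!: INF_superset_mono)
qed

lemma UAP_ball_shift:
  assumes "0 < N" "u \<in> UAP_ball N d M" shows "(\<lambda>x. u (x + t)) \<in> UAP_ball N d M"
  using assms UAP_pow_norm_shift[OF assms(1), of u d t] ZN_fun_shift[of u N t]
  unfolding UAP_ball_def by (auto intro: le_less_trans)

text \<open>
  Bounds on the complexity of partitions have to be uniform in \<open>N\<close>.  Instead of tracking explicit
  constants, this is expressed through classes of partitions in which \<open>N\<close> varies.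
\<close>

definition determined :: "nat \<Rightarrow> nat \<Rightarrow> (int \<Rightarrow> int \<Rightarrow> bool) \<Rightarrow> real \<Rightarrow> nat \<Rightarrow> real \<Rightarrow> bool" where
  "determined d N R \<theta> m \<epsilon> \<longleftrightarrow> (\<exists>U E. U \<subseteq> UAP_ball N d 2 \<and> finite U \<and> card U \<le> m \<and>
     E \<in> ZN_fun N \<and> avg (ZN N) (\<lambda>x. of_bool (E x)) \<le> \<theta> \<and>
     (\<forall>x y. \<not> E x \<longrightarrow> (\<forall>u\<in>U. cmod (u x - u y) \<le> \<epsilon>) \<longrightarrow> R x y))"

text \<open>The pair \<open>m\<close>, \<epsilon> is chosen after \<theta> but uniformly in the
  class. An exceptional set has to be allowed because values of \<open>U\<close> near the boundary
  between two atoms do not determine the atom.\<close>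

definition tame :: "nat \<Rightarrow> (nat \<times> (int \<Rightarrow> int \<Rightarrow> bool)) set \<Rightarrow> bool" where
  "tame d \<K> \<longleftrightarrow> (\<forall>(N, R)\<in>\<K>. 0 < N \<and> zrel N R) \<and>
     (\<forall>\<theta>>0. \<exists>m. \<exists>\<epsilon>>0. \<forall>(N, R)\<in>\<K>. determined d N R \<theta> m \<epsilon>)"

lemma determined_mono:
  assumes "determined d N R \<theta> m \<epsilon>" "\<theta> \<le> \<theta>'" "m \<le> m'" "\<epsilon>' \<le> \<epsilon>"
  shows "determined d N R \<theta>' m' \<epsilon>'"
proof -
  from assms(1) obtain U E where U: "U \<subseteq> UAP_ball N d 2" "finite U" "card U \<le> m"
    and E: "E \<in> ZN_fun N" "avg (ZN N) (\<lambda>x. of_bool (E x)) \<le> \<theta>"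
    and R: "\<forall>x y. \<not> E x \<longrightarrow> (\<forall>u\<in>U. cmod (u x - u y) \<le> \<epsilon>) \<longrightarrow> R x y"
    unfolding determined_def by blast
  have "R x y" if "\<not> E x" "\<forall>u\<in>U. cmod (u x - u y) \<le> \<epsilon>'" for x y
  proof -
    have "\<forall>u\<in>U. cmod (u x - u y) \<le> \<epsilon>" using that(2) assms(4) order_trans by blast
    thus ?thesis using R that(1) by blast
  qed
  thus ?thesis unfolding determined_def using U E assms(2,3)
    by (intro exI[of _ U] exI[of _ E]) simp
qed

lemma determined_shift:
  assumes N: "0 < N" and det: "determined d N R \<theta> m \<epsilon>"
  shows "determined d N (shift_rel t R) \<theta> m \<epsilon>"
proof -
  from det obtain U E where U: "U \<subseteq> UAP_ball N d 2" "finite U" "card U \<le> m"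
    and E: "E \<in> ZN_fun N" "avg (ZN N) (\<lambda>x. of_bool (E x)) \<le> \<theta>"
    and R: "\<forall>x y. \<not> E x \<longrightarrow> (\<forall>u\<in>U. cmod (u x - u y) \<le> \<epsilon>) \<longrightarrow> R x y"
    unfolding determined_def by blast
  define U' where "U' = (\<lambda>u x. u (x + t)) ` U"
  have "U' \<subseteq> UAP_ball N d 2" "finite U'" "card U' \<le> m"
    unfolding U'_def using U UAP_ball_shift[OF N] le_trans[OF card_image_le[OF U(2)] U(3)] by auto
  moreover have "avg (ZN N) (\<lambda>x. of_bool (E (x + t))) \<le> \<theta>"
    using avg_ZN_shift[OF ZN_fun_comp[OF E(1)], of of_bool t] E(2) by simp
  moreover have "\<forall>x y. \<not> E (x + t) \<longrightarrow> (\<forall>u\<in>U'. cmod (u x - u y) \<le> \<epsilon>) \<longrightarrow> shift_rel t R x y"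
    using R by (auto simp: U'_def shift_rel_def)
  ultimately show ?thesis
    unfolding determined_def using ZN_fun_shift[OF E(1), of t] by blast
qed

lemma determined_join:
  fixes \<theta> :: real
  assumes "finite \<Q>" "\<And>Q. Q \<in> \<Q> \<Longrightarrow> determined d N Q \<theta> m \<epsilon>"
  shows "determined d N (\<lambda>x y. \<forall>Q\<in>\<Q>. Q x y) (card \<Q> * \<theta>) (card \<Q> * m) \<epsilon>"
proof -
  have "\<forall>Q\<in>\<Q>. \<exists>U. \<exists>E. U \<subseteq> UAP_ball N d 2 \<and> finite U \<and> card U \<le> m \<and>
     E \<in> ZN_fun N \<and> avg (ZN N) (\<lambda>x. of_bool (E x)) \<le> \<theta> \<and>
     (\<forall>x y. \<not> E x \<longrightarrow> (\<forall>u\<in>U. cmod (u x - u y) \<le> \<epsilon>) \<longrightarrow> Q x y)"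
    using assms(2) unfolding determined_def by blast
  then obtain U E where U: "\<And>Q. Q \<in> \<Q> \<Longrightarrow> U Q \<subseteq> UAP_ball N d 2 \<and> finite (U Q) \<and> card (U Q) \<le> m"
    and E: "\<And>Q. Q \<in> \<Q> \<Longrightarrow> E Q \<in> ZN_fun N \<and> avg (ZN N) (\<lambda>x. of_bool (E Q x)) \<le> \<theta>"
    and R: "\<And>Q x y. Q \<in> \<Q> \<Longrightarrow> \<not> E Q x \<Longrightarrow> (\<forall>u\<in>U Q. cmod (u x - u y) \<le> \<epsilon>) \<Longrightarrow> Q x y"
    by metis
  define E' where "E' x \<longleftrightarrow> (\<exists>Q. Q \<in> \<Q> \<and> E Q x)" for x
  have "card (\<Union>(U ` \<Q>)) \<le> (\<Sum>Q\<in>\<Q>. card (U Q))" by (rule card_UN_le[OF assms(1)])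
  also have "\<dots> \<le> card \<Q> * m" using U sum_bounded_above[of \<Q> "\<lambda>Q. card (U Q)" m] by simp
  finally have "card (\<Union>(U ` \<Q>)) \<le> card \<Q> * m" .
  moreover have "avg (ZN N) (\<lambda>x. of_bool (E' x)) \<le> card \<Q> * \<theta>"
  proof -
    have "avg (ZN N) (\<lambda>x. of_bool (E' x)) \<le> avg (ZN N) (\<lambda>x. \<Sum>Q\<in>\<Q>. of_bool (E Q x))"
    proof (rule avg_mono)
      fix x
      show "of_bool (E' x) \<le> (\<Sum>Q\<in>\<Q>. of_bool (E Q x) :: real)"
      proof (cases "E' x")
        case True
        then obtain Q where Q: "Q \<in> \<Q>" "E Q x" by (auto simp: E'_def)
        show ?thesis
          using member_le_sum[OF Q(1) _ assms(1), of "\<lambda>Q. of_bool (E Q x) :: real"] Q True by simp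
      qed (simp add: sum_nonneg)
    qed
    also have "\<dots> = (\<Sum>Q\<in>\<Q>. avg (ZN N) (\<lambda>x. of_bool (E Q x)))" by (rule avg_sum)
    also have "\<dots> \<le> card \<Q> * \<theta>"
      using E sum_bounded_above[of \<Q> "\<lambda>Q. avg (ZN N) (\<lambda>x. of_bool (E Q x))" \<theta>] by simp
    finally show ?thesis .
  qed
  moreover have "E' \<in> ZN_fun N" unfolding E'_def using E by (intro ZN_fun_Bex) auto
  moreover have "\<forall>x y. \<not> E' x \<longrightarrow> (\<forall>u\<in>\<Union>(U ` \<Q>). cmod (u x - u y) \<le> \<epsilon>) \<longrightarrow> (\<forall>Q\<in>\<Q>. Q x y)"
    by (intro allI impI ballI, rule R) (auto simp: E'_def)
  moreover have "\<Union>(U ` \<Q>) \<subseteq> UAP_ball N d 2" "finite (\<Union>(U ` \<Q>))" using U assms(1) by auto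
  ultimately show ?thesis unfolding determined_def
    by (intro exI[of _ "\<Union>(U ` \<Q>)"] exI[of _ E']) simp
qed

lemma tame_trivial: "tame d {(N, \<lambda>_ _. True) | N. 0 < N}"
proof -
  have "determined d N (\<lambda>_ _. True) \<theta> 0 1" if "0 < \<theta>" for N \<theta>
    unfolding determined_def using that
    by (intro exI[of _ "{}"] exI[of _ "\<lambda>_. False"]) (simp add: ZN_fun_def avg_def)
  moreover have "zrel N (\<lambda>_ _. True)" for N by (rule zrelI) auto
  ultimately show ?thesis unfolding tame_def
    by (intro conjI allI impI, force, rule_tac exI[of _ 0], rule_tac exI[of _ 1]) auto
qed

lemma tame_Un:
  assumes "tame d \<K>" "tame d \<K>'" shows "tame d (\<K> \<union> \<K>')"
  unfolding tame_def
proof (intro conjI allI impI)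
  show "\<forall>(N, R)\<in>\<K> \<union> \<K>'. 0 < N \<and> zrel N R" using assms by (auto simp: tame_def)
  fix \<theta> :: real assume \<theta>: "0 < \<theta>"
  obtain m \<epsilon> where 1: "\<epsilon> > 0" "\<forall>(N, R)\<in>\<K>. determined d N R \<theta> m \<epsilon>"
    using assms(1) \<theta> unfolding tame_def by blast
  obtain m' \<epsilon>' where 2: "\<epsilon>' > 0" "\<forall>(N, R)\<in>\<K>'. determined d N R \<theta> m' \<epsilon>'"
    using assms(2) \<theta> unfolding tame_def by blast
  have "\<forall>(N, R)\<in>\<K> \<union> \<K>'. determined d N R \<theta> (max m m') (min \<epsilon> \<epsilon>')"
    using 1 2 by (auto elim!: determined_mono)
  thus "\<exists>m. \<exists>\<epsilon>>0. \<forall>(N, R)\<in>\<K> \<union> \<K>'. determined d N R \<theta> m \<epsilon>"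
    using 1 2 by (intro exI[of _ "max m m'"] exI[of _ "min \<epsilon> \<epsilon>'"]) auto
qed

text \<open>One round of refinement. The shifts are unrestricted because the balls
  \<open>UAP_ball N d 2\<close> are shift-invariant; only the number of partitions joined affects
  the complexity.\<close>

definition join_class :: "nat \<Rightarrow> (nat \<times> (int \<Rightarrow> int \<Rightarrow> bool)) set \<Rightarrow> (nat \<times> (int \<Rightarrow> int \<Rightarrow> bool)) set" where
  "join_class L \<K> = {(N, \<lambda>x y. \<forall>Q\<in>\<Q>. Q x y) | N \<Q>. 0 < N \<and> finite \<Q> \<and> card \<Q> \<le> L \<and>
     (\<forall>Q\<in>\<Q>. \<exists>t R. (N, R) \<in> \<K> \<and> Q = shift_rel t R)}"

lemma join_classD:
  assumes "(N, R) \<in> join_class L \<K>"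
  shows "\<exists>\<Q>. R = (\<lambda>x y. \<forall>Q\<in>\<Q>. Q x y) \<and> 0 < N \<and> finite \<Q> \<and> card \<Q> \<le> L \<and>
    (\<forall>Q\<in>\<Q>. \<exists>t R. (N, R) \<in> \<K> \<and> Q = shift_rel t R)"
  using assms unfolding join_class_def by blast

lemma tame_join:
  assumes "tame d \<K>" shows "tame d (join_class L \<K>)"
proof -
  have \<K>: "0 < N" "zrel N R" if "(N, R) \<in> \<K>" for N R
    using assms that by (auto simp: tame_def)
  have 1: "0 < N \<and> zrel N R" if R: "(N, R) \<in> join_class L \<K>" for N R
  proof -
    obtain \<Q> where \<Q>: "R = (\<lambda>x y. \<forall>Q\<in>\<Q>. Q x y)" "0 < N" "finite \<Q>" "card \<Q> \<le> L"
      "\<forall>Q\<in>\<Q>. \<exists>t R. (N, R) \<in> \<K> \<and> Q = shift_rel t R"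
      using join_classD[OF R] by (elim exE conjE) (rule that)
    have "zrel N Q" if Q: "Q \<in> \<Q>" for Q
    proof -
      obtain t R' where "(N, R') \<in> \<K>" "Q = shift_rel t R'" using \<Q>(5) Q by blast
      thus ?thesis using \<K>(2) zrel_shift by simp
    qed
    thus ?thesis unfolding \<Q>(1) using \<Q>(2) zrel_join by simp
  qed
  have 2: "\<exists>m. \<exists>\<epsilon>>0. \<forall>(N, R)\<in>join_class L \<K>. determined d N R \<theta> m \<epsilon>" if \<theta>: "0 < \<theta>" for \<theta>
  proof -
    \<comment> \<open>At most \<open>L\<close> exceptional sets of this density add up to at most
      \<theta>; the increment by 1 covers \<open>L = 0\<close>.\<close>
    have "0 < \<theta> / (L + 1)" using \<theta> by simp
    then obtain m \<epsilon> where \<epsilon>: "\<epsilon> > 0" and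
      det: "\<forall>(N, R) \<in> \<K>. determined d N R (\<theta> / (L + 1)) m \<epsilon>"
      using assms unfolding tame_def by blast
    have "determined d N R \<theta> (L * m) \<epsilon>" if R: "(N, R) \<in> join_class L \<K>" for N R
    proof -
      obtain \<Q> where \<Q>: "R = (\<lambda>x y. \<forall>Q\<in>\<Q>. Q x y)" "0 < N" "finite \<Q>" "card \<Q> \<le> L"
        "\<forall>Q\<in>\<Q>. \<exists>t R. (N, R) \<in> \<K> \<and> Q = shift_rel t R"
        using join_classD[OF R] by (elim exE conjE) (rule that)
      have "determined d N Q (\<theta> / (L + 1)) m \<epsilon>" if Q: "Q \<in> \<Q>" for Q
      proof -
        obtain t R' where "(N, R') \<in> \<K>" "Q = shift_rel t R'" using \<Q>(5) Q by blast
        thus ?thesis using det determined_shift[OF \<Q>(2)] by auto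
      qed
      hence "determined d N R (card \<Q> * (\<theta> / (L + 1))) (card \<Q> * m) \<epsilon>"
        unfolding \<Q>(1) by (rule determined_join[OF \<Q>(3)])
      moreover have "card \<Q> * (\<theta> / (L + 1)) \<le> \<theta>"
      proof -
        have "card \<Q> * \<theta> \<le> (L + 1) * \<theta>" using \<Q>(4) \<theta> by (intro mult_right_mono) auto
        thus ?thesis by (simp add: field_simps)
      qed
      ultimately show ?thesis using \<Q>(4) by (elim determined_mono) auto
    qed
    thus ?thesis using \<epsilon> by blast
  qed
  show ?thesis unfolding tame_def using 1 2 by blast
qed

text \<open>One partition has to serve all scales \<open>s\<close>, since tameness asks for
  exceptional sets of arbitrarily small density. The factor 2 counts the walls in the real and in
  the imaginary direction. That the atoms have small diameter is supplied separately, by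
  \<open>grid_exists\<close>.\<close>

definition grids :: "nat \<Rightarrow> real \<Rightarrow> (nat \<times> (int \<Rightarrow> int \<Rightarrow> bool)) set" where
  "grids d \<rho> = {(N, G). 0 < N \<and> zrel N G \<and> (\<exists>u\<in>UAP_ball N d 2. \<forall>s. \<exists>E\<in>ZN_fun N.
     avg (ZN N) (\<lambda>x. of_bool (E x)) \<le> 2 * (1 / 2) ^ s \<and>
     (\<forall>x y. \<not> E x \<longrightarrow> cmod (u x - u y) \<le> \<rho> / 4 ^ (s + 3) \<longrightarrow> G x y))}"

lemma tame_grids:
  assumes \<rho>: "0 < \<rho>" shows "tame d (grids d \<rho>)"
proof -
  have "\<exists>m. \<exists>\<epsilon>>0. \<forall>(N, R)\<in>grids d \<rho>. determined d N R \<theta> m \<epsilon>" if \<theta>: "0 < \<theta>" for \<theta>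
  proof -
    obtain s where "(1 / 2) ^ s < \<theta> / 2"
      using real_arch_pow_inv[of "\<theta> / 2" "1 / 2 :: real"] \<theta> by auto
    hence s: "2 * (1 / 2) ^ s \<le> \<theta>" by simp
    have "determined d N G \<theta> 1 (\<rho> / 4 ^ (s + 3))" if G: "(N, G) \<in> grids d \<rho>" for N G
    proof -
      from G obtain u E where "u \<in> UAP_ball N d 2" "E \<in> ZN_fun N"
        "avg (ZN N) (\<lambda>x. of_bool (E x)) \<le> 2 * (1 / 2) ^ s"
        "\<forall>x y. \<not> E x \<longrightarrow> cmod (u x - u y) \<le> \<rho> / 4 ^ (s + 3) \<longrightarrow> G x y"
        unfolding grids_def by blast
      thus ?thesis unfolding determined_def using s
        by (intro exI[of _ "{u}"] exI[of _ E]) simp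
    qed
    moreover have "0 < \<rho> / 4 ^ (s + 3)" using \<rho> by simp
    ultimately show ?thesis by blast
  qed
  thus ?thesis unfolding tame_def by (auto simp: grids_def)
qed

text \<open>
  An average over the offsets \<open>\<alpha>\<close> shows that some offset is good at all scales at once: the
  scale \<open>s\<close> is given the weight \<open>2 ^ s\<close>, and finitely many scales suffice, since a density
  below \<open>1 / N\<close> vanishes.
\<close>

lemma generic_offset:
  fixes w :: "int \<Rightarrow> real"
  assumes N: "0 < N" and \<rho>: "0 < \<rho>"
  shows "\<exists>\<alpha>. \<forall>s. avg (ZN N) (\<lambda>x. of_bool (\<exists>z::int. \<bar>w x - \<alpha> - \<rho> * z\<bar> \<le> \<rho> / 4 ^ (s + 2))) \<le> (1 / 2) ^ s"
proof -
  \<comment> \<open>At scale \<open>S\<close> the density bound is below \<open>1 / N\<close>. The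
    offsets tried are the multiples of \<open>\<rho> / Q\<close>, fine enough that even at this
    scale a neighbourhood of a wall has radius \<open>b \<ge> 1\<close> in these units, so that the
    count \<open>2 * b + 1\<close> is at most \<open>3 * b\<close>.\<close>
  define S where "S = N"
  have S: "N < 2 ^ S" unfolding S_def by simp
  define Q :: nat where "Q = 4 ^ (S + 3)"
  have Q0: "Q > 0" by (simp add: Q_def)
  define near where "near q s x \<longleftrightarrow> (\<exists>z::int. \<bar>w x - \<rho> * q / Q - \<rho> * z\<bar> \<le> \<rho> / 4 ^ (s + 2))" for q s :: nat and x
  have count: "(\<Sum>q<Q. of_bool (near q s x)) \<le> Q * (3 / 4 ^ (s + 2) :: real)" if s: "s \<le> S" for s x
  proof -
    define a where "a = Q * w x / \<rho>"
    define b :: real where "b = Q / 4 ^ (s + 2)"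
    have b1: "1 \<le> b"
      unfolding b_def Q_def using power_increasing[of "s + 2" "S + 3" "4 :: real"] s by simp
    have "{q. q < Q \<and> near q s x} \<subseteq> (\<lambda>p. nat (p mod int Q)) ` {\<lceil>a - b\<rceil>..\<lfloor>a + b\<rfloor>}"
    proof
      fix q assume "q \<in> {q. q < Q \<and> near q s x}"
      then obtain z :: int where q: "q < Q" and z: "\<bar>w x - \<rho> * q / Q - \<rho> * z\<bar> \<le> \<rho> / 4 ^ (s + 2)"
        by (auto simp: near_def)
      define p where "p = int q + int Q * z"
      have "a - p = (w x - \<rho> * q / Q - \<rho> * z) * (Q / \<rho>)"
        using Q0 \<rho> by (simp add: a_def p_def field_simps)
      hence "\<bar>a - p\<bar> = \<bar>w x - \<rho> * q / Q - \<rho> * z\<bar> * (Q / \<rho>)"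
        using \<rho> by (simp add: abs_mult)
      also have "\<dots> \<le> \<rho> / 4 ^ (s + 2) * (Q / \<rho>)"
        using \<rho> by (intro mult_right_mono z) auto
      also have "\<dots> = b" using \<rho> by (simp add: b_def)
      finally have "\<bar>a - p\<bar> \<le> b" .
      hence "p \<in> {\<lceil>a - b\<rceil>..\<lfloor>a + b\<rfloor>}" by (auto simp: ceiling_le_iff le_floor_iff)
      moreover have "q = nat (p mod int Q)" using q by (simp add: p_def)
      ultimately show "q \<in> (\<lambda>p. nat (p mod int Q)) ` {\<lceil>a - b\<rceil>..\<lfloor>a + b\<rfloor>}" by blast
    qed
    hence "card {q. q < Q \<and> near q s x} \<le> card {\<lceil>a - b\<rceil>..\<lfloor>a + b\<rfloor>}"
      by (meson card_image_le card_mono finite_atLeastAtMost_int finite_imageI le_trans)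
    hence "real (card {q. q < Q \<and> near q s x}) \<le> real (nat (\<lfloor>a + b\<rfloor> - \<lceil>a - b\<rceil> + 1))"
      by (simp add: algebra_simps)
    also have "\<dots> \<le> 2 * b + 1" using b1 by linarith
    also have "\<dots> \<le> 3 * b" using b1 by simp
    finally have "real (card {q. q < Q \<and> near q s x}) \<le> 3 * b" .
    moreover have "{..<Q} \<inter> {q. near q s x} = {q. q < Q \<and> near q s x}" by auto
    ultimately show ?thesis by (simp add: b_def)
  qed
  define dens where "dens q s = avg (ZN N) (\<lambda>x. of_bool (near q s x))" for q s
  have dens0: "0 \<le> dens q s" for q s unfolding dens_def by (intro avg_nonneg) simp
  have sum_dens: "(\<Sum>q<Q. dens q s) \<le> Q * (3 / 4 ^ (s + 2))" if "s \<le> S" for s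
  proof -
    have "(\<Sum>q<Q. dens q s) = avg (ZN N) (\<lambda>x. \<Sum>q<Q. of_bool (near q s x))"
      unfolding dens_def by (simp only: avg_sum)
    also have "\<dots> \<le> avg (ZN N) (\<lambda>x. Q * (3 / 4 ^ (s + 2)))"
      using count[OF that] by (intro avg_mono)
    finally show ?thesis using N by (simp only: avg_ZN_const)
  qed
  \<comment> \<open>Otherwise the weighted total over all offsets would be at least
    \<open>Q\<close>, whereas it is at most \<open>Q * (3 / 16) * 2\<close>.\<close>
  have "\<exists>q<Q. (\<Sum>s\<le>S. 2 ^ s * dens q s) \<le> 1"
  proof (rule ccontr)
    assume "\<not> ?thesis"
    hence "(\<Sum>q<Q. 1) \<le> (\<Sum>q<Q. \<Sum>s\<le>S. 2 ^ s * dens q s)"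
      by (intro sum_mono) (auto simp: not_le intro: less_imp_le)
    also have "\<dots> = (\<Sum>s\<le>S. 2 ^ s * (\<Sum>q<Q. dens q s))"
      unfolding sum_distrib_left by (rule sum.swap)
    also have "\<dots> \<le> (\<Sum>s\<le>S. 2 ^ s * (Q * (3 / 4 ^ (s + 2))))"
      using sum_dens by (intro sum_mono mult_left_mono) auto
    also have "\<dots> = (\<Sum>s\<le>S. Q * (3 / 16) * (1 / 2) ^ s)"
    proof (intro sum.cong refl)
      fix s
      have "(4::real) ^ s = 2 ^ s * 2 ^ s" by (simp flip: power_mult_distrib)
      thus "2 ^ s * (Q * (3 / 4 ^ (s + 2))) = Q * (3 / 16) * (1 / 2 :: real) ^ s"
        by (simp add: power_add field_simps)
    qed
    also have "\<dots> = Q * (3 / 16) * (\<Sum>s\<le>S. (1 / 2) ^ s)" by (simp add: sum_distrib_left)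
    finally have "1 \<le> 3 / 16 * (\<Sum>s\<le>S. (1 / 2 :: real) ^ s)" using Q0 by simp
    moreover have "(\<Sum>s\<le>S. (1 / 2 :: real) ^ s) = 2 - (1 / 2) ^ S" by (induction S) auto
    moreover have "(0 :: real) \<le> (1 / 2) ^ S" by simp
    ultimately show False by linarith
  qed
  then obtain q where q: "(\<Sum>s\<le>S. 2 ^ s * dens q s) \<le> 1" by blast
  have le: "dens q s \<le> (1 / 2) ^ s" if "s \<le> S" for s
  proof -
    have "2 ^ s * dens q s \<le> (\<Sum>s\<le>S. 2 ^ s * dens q s)"
      using that dens0 by (intro member_le_sum) auto
    with q have "2 ^ s * dens q s \<le> 1" by simp
    thus ?thesis by (simp add: field_simps)
  qed
  have "dens q s \<le> (1 / 2) ^ s" if "S < s" for s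
  proof -
    have "dens q S < 1 / N"
    proof -
      have "real N < 2 ^ S" using S by (metis of_nat_less_iff of_nat_numeral of_nat_power)
      hence "(1 / 2) ^ S < 1 / real N" using N by (simp add: field_simps)
      thus ?thesis using le[of S] by simp
    qed
    hence "real (card (ZN N \<inter> {x. near q S x})) < 1" using N by (simp add: dens_def avg_ZN field_simps)
    hence "ZN N \<inter> {x. near q S x} = {}" by simp
    moreover have "near q S x" if "near q s x" for x
    proof -
      have "\<rho> / 4 ^ (s + 2) \<le> \<rho> / 4 ^ (S + 2)"
        using \<rho> \<open>S < s\<close> by (intro divide_left_mono power_increasing) auto
      thus ?thesis using that unfolding near_def by (meson order_trans)
    qed
    ultimately have "ZN N \<inter> {x. near q s x} = {}" by blast
    thus ?thesis by (simp add: dens_def avg_ZN)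
  qed
  hence "dens q s \<le> (1 / 2) ^ s" for s using le by (cases "s \<le> S") auto
  thus ?thesis unfolding dens_def near_def by (intro exI[of _ "\<rho> * q / Q"]) auto
qed

lemma floor_eq_if_close:
  fixes a b :: real
  assumes "\<bar>a - b\<bar> \<le> \<eta>" "\<And>z::int. \<not> \<bar>a - z\<bar> \<le> \<eta>" shows "\<lfloor>a\<rfloor> = \<lfloor>b\<rfloor>"
proof (rule ccontr)
  assume "\<lfloor>a\<rfloor> \<noteq> \<lfloor>b\<rfloor>"
  then consider "\<lfloor>a\<rfloor> < \<lfloor>b\<rfloor>" | "\<lfloor>b\<rfloor> < \<lfloor>a\<rfloor>" by linarith
  thus False
  proof cases
    case 1
    hence "\<bar>a - of_int \<lfloor>b\<rfloor>\<bar> \<le> \<bar>a - b\<bar>" by linarith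
    thus ?thesis using assms(1) assms(2)[of "\<lfloor>b\<rfloor>"] by linarith
  next
    case 2
    hence "\<bar>a - of_int \<lfloor>a\<rfloor>\<bar> \<le> \<bar>a - b\<bar>" by linarith
    thus ?thesis using assms(1) assms(2)[of "\<lfloor>a\<rfloor>"] by linarith
  qed
qed

text \<open>Real and imaginary part are cut into cells of side \<open>\<rho> / 2\<close>, with
  offsets that are good at all scales. A value farther than \<eta> from the walls has the same floor
  as every value within \<eta> of it, so the \<eta>-neighbourhood of the walls can serve as the
  exceptional set.\<close>

lemma grid_exists:
  assumes N: "0 < N" and u: "u \<in> UAP_ball N d 2" and \<rho>: "0 < \<rho>"
  shows "\<exists>G. (N, G) \<in> grids d \<rho> \<and> (\<forall>x y. G x y \<longrightarrow> cmod (u x - u y) \<le> \<rho>)"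
proof -
  define r where "r = \<rho> / 2"
  have r: "0 < r" using \<rho> by (simp add: r_def)
  have uZ: "u \<in> ZN_fun N" using u by (simp add: UAP_ball_def)
  have step: "\<exists>\<alpha>. \<forall>s. avg (ZN N) (\<lambda>x. of_bool (\<exists>z::int. \<bar>w x - \<alpha> - r * z\<bar> \<le> r / 4 ^ (s + 2))) \<le> (1 / 2) ^ s"
    for w :: "int \<Rightarrow> real" by (rule generic_offset[OF N r])
  obtain \<alpha> where \<alpha>: "\<And>s. avg (ZN N) (\<lambda>x. of_bool (\<exists>z::int. \<bar>Re (u x) - \<alpha> - r * z\<bar> \<le> r / 4 ^ (s + 2))) \<le> (1 / 2) ^ s"
    using step[of "\<lambda>x. Re (u x)"] by blast
  obtain \<beta> where \<beta>: "\<And>s. avg (ZN N) (\<lambda>x. of_bool (\<exists>z::int. \<bar>Im (u x) - \<beta> - r * z\<bar> \<le> r / 4 ^ (s + 2))) \<le> (1 / 2) ^ s"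
    using step[of "\<lambda>x. Im (u x)"] by blast
  define G where "G x y \<longleftrightarrow> \<lfloor>(Re (u x) - \<alpha>) / r\<rfloor> = \<lfloor>(Re (u y) - \<alpha>) / r\<rfloor> \<and>
     \<lfloor>(Im (u x) - \<beta>) / r\<rfloor> = \<lfloor>(Im (u y) - \<beta>) / r\<rfloor>" for x y
  have same: "\<bar>a - b\<bar> \<le> r" if "\<lfloor>(a - \<gamma>) / r\<rfloor> = \<lfloor>(b - \<gamma>) / r\<rfloor>" for a b \<gamma>
  proof -
    have "\<bar>(a - \<gamma>) / r - (b - \<gamma>) / r\<bar> \<le> 1" using that by linarith
    hence "\<bar>a - b\<bar> / r \<le> 1" using r by (simp add: diff_divide_distrib[symmetric])
    thus ?thesis using r by simp
  qed
  have close: "\<lfloor>(a - \<gamma>) / r\<rfloor> = \<lfloor>(b - \<gamma>) / r\<rfloor>"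
    if "\<not> (\<exists>z::int. \<bar>a - \<gamma> - r * z\<bar> \<le> \<eta>)" "\<bar>a - b\<bar> \<le> \<eta>" for a b \<gamma> \<eta>
  proof (rule floor_eq_if_close)
    show "\<bar>(a - \<gamma>) / r - (b - \<gamma>) / r\<bar> \<le> \<eta> / r"
      using that(2) r by (simp add: diff_divide_distrib[symmetric] divide_right_mono)
    show "\<not> \<bar>(a - \<gamma>) / r - of_int z\<bar> \<le> \<eta> / r" for z
    proof -
      have "(a - \<gamma>) / r - of_int z = (a - \<gamma> - r * z) / r" using r by (simp add: field_simps)
      thus ?thesis using that(1) r by (simp add: divide_le_cancel)
    qed
  qed
  have "zrel N G"
    using ZN_funD(1)[OF uZ] by (intro zrelI) (auto simp: G_def)
  moreover have "cmod (u x - u y) \<le> \<rho>" if "G x y" for x y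
    using same[of "Re (u x)" \<alpha> "Re (u y)"] same[of "Im (u x)" \<beta> "Im (u y)"] that
      cmod_le[of "u x - u y"] by (simp add: G_def r_def)
  moreover have "\<exists>E\<in>ZN_fun N. avg (ZN N) (\<lambda>x. of_bool (E x)) \<le> 2 * (1 / 2) ^ s \<and>
     (\<forall>x y. \<not> E x \<longrightarrow> cmod (u x - u y) \<le> \<rho> / 4 ^ (s + 3) \<longrightarrow> G x y)" for s
  proof -
    define \<eta> where "\<eta> = r / 4 ^ (s + 2)"
    define E1 where "E1 x \<longleftrightarrow> (\<exists>z::int. \<bar>Re (u x) - \<alpha> - r * z\<bar> \<le> \<eta>)" for x
    define E2 where "E2 x \<longleftrightarrow> (\<exists>z::int. \<bar>Im (u x) - \<beta> - r * z\<bar> \<le> \<eta>)" for x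
    have "(\<lambda>x. E1 x \<or> E2 x) \<in> ZN_fun N"
      using uZ by (simp add: ZN_fun_def E1_def E2_def)
    moreover have "avg (ZN N) (\<lambda>x. of_bool (E1 x \<or> E2 x)) \<le> 2 * (1 / 2) ^ s"
    proof -
      have "avg (ZN N) (\<lambda>x. of_bool (E1 x \<or> E2 x)) \<le> avg (ZN N) (\<lambda>x. of_bool (E1 x) + of_bool (E2 x))"
        by (intro avg_mono) auto
      also have "\<dots> = avg (ZN N) (\<lambda>x. of_bool (E1 x)) + avg (ZN N) (\<lambda>x. of_bool (E2 x))"
        by (rule avg_add)
      finally show ?thesis using \<alpha>[of s] \<beta>[of s] unfolding E1_def E2_def \<eta>_def by linarith
    qed
    moreover have "G x y" if "\<not> (E1 x \<or> E2 x)" "cmod (u x - u y) \<le> \<rho> / 4 ^ (s + 3)" for x y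
    proof -
      have "\<rho> / 4 ^ (s + 3) \<le> \<eta>" using \<rho> by (simp add: \<eta>_def r_def power_add field_simps)
      hence "\<bar>Re (u x) - Re (u y)\<bar> \<le> \<eta>" "\<bar>Im (u x) - Im (u y)\<bar> \<le> \<eta>"
        using that(2) abs_Re_le_cmod[of "u x - u y"] abs_Im_le_cmod[of "u x - u y"] by auto
      thus ?thesis using that(1) close unfolding G_def E1_def E2_def by blast
    qed
    ultimately show ?thesis by (intro bexI[of _ "\<lambda>x. E1 x \<or> E2 x"]) auto
  qed
  ultimately have "(N, G) \<in> grids d \<rho>" "\<forall>x y. G x y \<longrightarrow> cmod (u x - u y) \<le> \<rho>"
    using u N unfolding grids_def by auto
  thus ?thesis by blast
qed

section \<open>Recurrence and energy increments\<close>

definition ret :: "nat \<Rightarrow> nat \<Rightarrow> (int \<Rightarrow> bool) \<Rightarrow> int \<Rightarrow> nat \<Rightarrow> real" where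
  "ret N k \<Omega> \<mu> N1 =
     (\<Sum>r\<le>N1. avg (ZN N) (\<lambda>x. of_bool (\<forall>j<k. \<Omega> (x + \<mu> * int r * int j)))) / (real N1 + 1)"

text \<open>
  It is essential that the admissible size of the exceptional set \<open>E\<close> does not depend on \<open>m\<close>,
  \<open>\<epsilon>\<close> and \<open>M\<close>: in the induction, the complexity of a partition is fixed only after this error.
\<close>

definition config :: "nat \<Rightarrow> nat \<Rightarrow> nat \<Rightarrow> real \<Rightarrow> nat \<Rightarrow> real \<Rightarrow> real \<Rightarrow>
    (int \<Rightarrow> bool) \<Rightarrow> (int \<Rightarrow> bool) \<Rightarrow> (int \<Rightarrow> bool) \<Rightarrow> bool" where
  "config N d k \<delta> m \<epsilon> M S \<Omega> E \<longleftrightarrow> 0 < N \<and> S \<in> ZN_fun N \<and> \<Omega> \<in> ZN_fun N \<and> E \<in> ZN_fun N \<and>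
     \<delta> \<le> avg (ZN N) (\<lambda>x. of_bool (S x)) \<and>
     avg (ZN N) (\<lambda>x. of_bool (E x)) \<le> \<delta>\<^sup>2 / (16 * real k) \<and>
     (\<exists>U\<subseteq>UAP_ball N d M. finite U \<and> card U \<le> m \<and>
       (\<forall>x y. S x \<longrightarrow> (\<forall>u\<in>U. cmod (u x - u y) \<le> \<epsilon>) \<longrightarrow> \<Omega> y \<or> E y))"

definition recurrent :: "nat \<Rightarrow> bool" where
  "recurrent d \<longleftrightarrow> (\<forall>k\<ge>1. \<forall>\<delta>>0. \<forall>m. \<forall>\<epsilon>>0. \<forall>M>0. \<exists>c>0. \<forall>N S \<Omega> E \<mu> N1.
     config N d k \<delta> m \<epsilon> M S \<Omega> E \<longrightarrow> c \<le> ret N k \<Omega> \<mu> N1)"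

text \<open>At order 0 the functions in \<open>U\<close> are constant, so a single point of
  \<open>S\<close> puts every point into \<open>\<Omega> \<union> E\<close>. As \<delta> \<le> 1,
  the \<open>k\<close> shifts of \<open>E\<close> together have density at most 1/16.\<close>

lemma recurrent_0: "recurrent 0"
  unfolding recurrent_def
proof (intro allI impI)
  fix k m :: nat and \<delta> \<epsilon> M :: real
  assume k: "1 \<le> k" and \<delta>: "0 < \<delta>" and \<epsilon>: "0 < \<epsilon>"
  have "1 / 2 \<le> ret N k \<Omega> \<mu> N1" if conf: "config N 0 k \<delta> m \<epsilon> M S \<Omega> E" for N S \<Omega> E \<mu> N1
  proof -
    from conf obtain U where N: "0 < N" and Z: "\<Omega> \<in> ZN_fun N" "E \<in> ZN_fun N"
      and S: "\<delta> \<le> avg (ZN N) (\<lambda>x. of_bool (S x))"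
      and E: "avg (ZN N) (\<lambda>x. of_bool (E x)) \<le> \<delta>\<^sup>2 / (16 * real k)"
      and U: "U \<subseteq> UAP_ball N 0 M"
      and SU: "\<And>x y. S x \<Longrightarrow> (\<forall>u\<in>U. cmod (u x - u y) \<le> \<epsilon>) \<Longrightarrow> \<Omega> y \<or> E y"
      unfolding config_def by blast
    have const: "u x = u y" if "u \<in> U" for u x y
      using U that unfolding UAP_ball_def by (auto simp: const_norm_def split: if_splits)
    have "\<exists>x. S x"
    proof (rule ccontr)
      assume "\<not> ?thesis"
      thus False using S \<delta> by (simp add: avg_def)
    qed
    then obtain x0 where "S x0" ..
    moreover have "cmod (u x0 - u y) \<le> \<epsilon>" if "u \<in> U" for u y
      using const[OF that, of x0 y] \<epsilon> by simp
    ultimately have \<Omega>E: "\<Omega> y \<or> E y" for y using SU[of x0 y] by blast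
    have "\<delta> \<le> 1"
    proof -
      have "avg (ZN N) (\<lambda>x. of_bool (S x)) \<le> avg (ZN N) (\<lambda>x. 1)" by (intro avg_mono) simp
      thus ?thesis using S N by (simp only: avg_ZN_const)
    qed
    hence "\<delta>\<^sup>2 \<le> 1" using \<delta> by (simp add: power_le_one)
    hence "\<delta>\<^sup>2 / (16 * real k) \<le> 1 / (16 * real k)" using k by (intro divide_right_mono) auto
    hence E': "avg (ZN N) (\<lambda>x. of_bool (E x)) \<le> 1 / (16 * real k)" using E by linarith
    have "1 / 2 \<le> avg (ZN N) (\<lambda>x. of_bool (\<forall>j<k. \<Omega> (x + \<mu> * int r * int j)))" for r :: nat
    proof -
      have "1 - (\<Sum>j<k. of_bool (E (x + \<mu> * int r * int j))) \<le> (of_bool (\<forall>j<k. \<Omega> (x + \<mu> * int r * int j)) :: real)" for x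
      proof (cases "\<forall>j<k. \<Omega> (x + \<mu> * int r * int j)")
        case True
        thus ?thesis by (simp add: sum_nonneg)
      next
        case False
        then obtain j where "j < k" "E (x + \<mu> * int r * int j)" using \<Omega>E by blast
        thus ?thesis
          using member_le_sum[of j "{..<k}" "\<lambda>j. of_bool (E (x + \<mu> * int r * int j)) :: real"] False by simp
      qed
      hence "avg (ZN N) (\<lambda>x. 1 - (\<Sum>j<k. of_bool (E (x + \<mu> * int r * int j))))
          \<le> avg (ZN N) (\<lambda>x. of_bool (\<forall>j<k. \<Omega> (x + \<mu> * int r * int j)))"
        by (intro avg_mono)
      moreover have "avg (ZN N) (\<lambda>x. 1 - (\<Sum>j<k. of_bool (E (x + \<mu> * int r * int j))))
          = 1 - (\<Sum>j<k. avg (ZN N) (\<lambda>x. of_bool (E (x + \<mu> * int r * int j))))"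
        unfolding avg_diff avg_ZN_const[OF N] avg_sum ..
      moreover have "avg (ZN N) (\<lambda>x. of_bool (E (x + \<mu> * int r * int j))) \<le> 1 / (16 * real k)" for j
        using avg_ZN_shift[OF ZN_fun_comp[OF Z(2)], of of_bool "\<mu> * int r * int j"] E' by simp
      hence "(\<Sum>j<k. avg (ZN N) (\<lambda>x. of_bool (E (x + \<mu> * int r * int j)))) \<le> k * (1 / (16 * real k))"
        using sum_bounded_above[of "{..<k}" "\<lambda>j. avg (ZN N) (\<lambda>x. of_bool (E (x + \<mu> * int r * int j)))"
          "1 / (16 * real k)"] unfolding card_lessThan by blast
      ultimately show ?thesis using k by simp
    qed
    hence "(\<Sum>r\<le>N1. 1 / 2) \<le> (\<Sum>r\<le>N1. avg (ZN N) (\<lambda>x. of_bool (\<forall>j<k. \<Omega> (x + \<mu> * int r * int j))))"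
      by (intro sum_mono)
    thus ?thesis by (simp add: ret_def field_simps)
  qed
  moreover have "0 < (1 / 2 :: real)" by simp
  ultimately show "\<exists>c>0. \<forall>N S \<Omega> E \<mu> N1. config N 0 k \<delta> m \<epsilon> M S \<Omega> E \<longrightarrow> c \<le> ret N k \<Omega> \<mu> N1"
    by blast
qed

text \<open>The sets \<open>W\<close> are unions of atoms of \<open>R\<close>. The error bound is
  the one allowed in \<open>config\<close> at density \<open>\<delta> / 2\<close>; the other half of
  the density is given up to the exceptional set of the partition.\<close>

definition recurrent_class ::
  "(nat \<times> (int \<Rightarrow> int \<Rightarrow> bool)) set \<Rightarrow> nat \<Rightarrow> real \<Rightarrow> real \<Rightarrow> bool" where
  "recurrent_class \<K> K \<delta> c \<longleftrightarrow> (\<forall>N R W \<Omega> \<mu> N1. (N, R) \<in> \<K> \<longrightarrow>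
     (\<forall>x y. R x y \<longrightarrow> W x = W y) \<longrightarrow> \<Omega> \<in> ZN_fun N \<longrightarrow> \<delta> \<le> avg (ZN N) (\<lambda>x. of_bool (W x)) \<longrightarrow>
     avg (ZN N) (\<lambda>x. of_bool (W x \<and> \<not> \<Omega> x)) \<le> \<delta>\<^sup>2 / (64 * real K) \<longrightarrow> c \<le> ret N K \<Omega> \<mu> N1)"

text \<open>If the functions in \<open>U\<close> take nearly the same values at a second point as at
  a point of \<open>W\<close> outside the exceptional set, then both points lie in one atom, so the
  second is in \<open>W\<close> too. The part of \<open>W\<close> missed by \<Omega> can therefore
  serve as the error set of \<open>config\<close>.\<close>

lemma tame_recurrent:
  assumes rec: "recurrent d" and tame: "tame d \<K>" and K: "1 \<le> K" and \<delta>: "0 < \<delta>"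
  shows "\<exists>c>0. recurrent_class \<K> K \<delta> c"
proof -
  have "0 < \<delta> / 2" using \<delta> by simp
  then obtain m \<epsilon> where \<epsilon>: "\<epsilon> > 0" and det: "\<forall>(N, R)\<in>\<K>. determined d N R (\<delta> / 2) m \<epsilon>"
    using tame unfolding tame_def by blast
  have "\<forall>m. \<forall>\<epsilon>>0. \<forall>M>0. \<exists>c>0. \<forall>N S \<Omega> E \<mu> N1.
     config N d K (\<delta> / 2) m \<epsilon> M S \<Omega> E \<longrightarrow> c \<le> ret N K \<Omega> \<mu> N1"
    using rec K \<delta> unfolding recurrent_def by simp
  then obtain c where c: "c > 0"
    "\<forall>N S \<Omega> E \<mu> N1. config N d K (\<delta> / 2) m \<epsilon> 2 S \<Omega> E \<longrightarrow> c \<le> ret N K \<Omega> \<mu> N1"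
    using \<epsilon> by (metis zero_less_numeral)
  have "c \<le> ret N K \<Omega> \<mu> N1"
    if R: "(N, R) \<in> \<K>" and W: "\<forall>x y. R x y \<longrightarrow> W x = W y" and \<Omega>: "\<Omega> \<in> ZN_fun N"
      and W1: "\<delta> \<le> avg (ZN N) (\<lambda>x. of_bool (W x))"
      and W2: "avg (ZN N) (\<lambda>x. of_bool (W x \<and> \<not> \<Omega> x)) \<le> \<delta>\<^sup>2 / (64 * real K)" for N R W \<Omega> \<mu> N1
  proof -
    from R tame have N: "0 < N" and zR: "zrel N R" by (auto simp: tame_def)
    from R det have "determined d N R (\<delta> / 2) m \<epsilon>" by blast
    then obtain U E where U: "U \<subseteq> UAP_ball N d 2" "finite U" "card U \<le> m"
      and E: "E \<in> ZN_fun N" "avg (ZN N) (\<lambda>x. of_bool (E x)) \<le> \<delta> / 2"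
      and RU: "\<And>x y. \<not> E x \<Longrightarrow> (\<forall>u\<in>U. cmod (u x - u y) \<le> \<epsilon>) \<Longrightarrow> R x y"
      unfolding determined_def by blast
    have WZ: "W \<in> ZN_fun N" using zrel_invariant_ZN_fun[OF zR] W by blast
    define S where "S x \<longleftrightarrow> W x \<and> \<not> E x" for x
    define E' where "E' x \<longleftrightarrow> W x \<and> \<not> \<Omega> x" for x
    have "config N d K (\<delta> / 2) m \<epsilon> 2 S \<Omega> E'"
      unfolding config_def
    proof (intro conjI exI[of _ U] allI impI)
      show "S \<in> ZN_fun N" unfolding S_def by (rule ZN_fun_comp2[OF WZ E(1)])
      show "E' \<in> ZN_fun N" unfolding E'_def by (rule ZN_fun_comp2[OF WZ \<Omega>])
      have "avg (ZN N) (\<lambda>x. of_bool (W x) - of_bool (E x)) \<le> avg (ZN N) (\<lambda>x. of_bool (S x))"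
        by (intro avg_mono) (auto simp: S_def)
      thus "\<delta> / 2 \<le> avg (ZN N) (\<lambda>x. of_bool (S x))" using W1 E(2) unfolding avg_diff by linarith
      show "avg (ZN N) (\<lambda>x. of_bool (E' x)) \<le> (\<delta> / 2)\<^sup>2 / (16 * real K)"
        using W2 by (simp add: E'_def power_divide)
      show "\<Omega> y \<or> E' y" if "S x" "\<forall>u\<in>U. cmod (u x - u y) \<le> \<epsilon>" for x y
        using that RU[of x y] W unfolding S_def E'_def by blast
    qed (use N \<Omega> U in auto)
    thus ?thesis using c(2) by blast
  qed
  thus ?thesis using c(1) unfolding recurrent_class_def by blast
qed

section \<open>Energy increments\<close>

definition stable :: "nat \<Rightarrow> real \<Rightarrow> nat \<Rightarrow> real \<Rightarrow> nat \<Rightarrow> (int \<Rightarrow> real) \<Rightarrow> (int \<Rightarrow> int \<Rightarrow> bool) \<Rightarrow> bool" where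
  "stable d \<rho> L \<epsilon> N F R \<longleftrightarrow> (\<forall>R'. (N, R') \<in> join_class L (insert (N, R) (grids d \<rho>)) \<longrightarrow> R' \<le> R \<longrightarrow>
     energy N F R' \<le> energy N F R + \<epsilon>)"

lemma join_classI:
  assumes "0 < N" "finite \<Q>" "card \<Q> \<le> L" "\<And>Q. Q \<in> \<Q> \<Longrightarrow> \<exists>t R. (N, R) \<in> \<K> \<and> Q = shift_rel t R"
  shows "(N, \<lambda>x y. \<forall>Q\<in>\<Q>. Q x y) \<in> join_class L \<K>"
  unfolding join_class_def using assms by (intro CollectI exI[of _ N] exI[of _ \<Q>]) simp

lemma join_class_mono:
  assumes "\<K> \<subseteq> \<K>'" shows "join_class L \<K> \<subseteq> join_class L \<K>'"
proof clarify
  fix N R assume "(N, R) \<in> join_class L \<K>"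
  then obtain \<Q> where \<Q>: "R = (\<lambda>x y. \<forall>Q\<in>\<Q>. Q x y)" "0 < N" "finite \<Q>" "card \<Q> \<le> L"
    "\<forall>Q\<in>\<Q>. \<exists>t R. (N, R) \<in> \<K> \<and> Q = shift_rel t R"
    by (elim join_classD[THEN exE] conjE) (rule that)
  show "(N, R) \<in> join_class L \<K>'"
    unfolding \<Q>(1) using \<Q>(5) assms by (intro join_classI \<Q>(2-4)) blast
qed

text \<open>A partition that is not stable has a refinement with energy larger by more than
  \<epsilon>, and energies lie between 0 and \<open>B\<^sup>2\<close>. The induction runs over whole
  classes with a budget of \<open>T\<close> increments, so that the final class is fixed before
  \<open>N\<close>, \<open>R\<close> and \<open>F\<close>.\<close>

lemma stable_refinement:
  assumes \<rho>: "0 < \<rho>" and \<epsilon>: "0 < \<epsilon>" and tame: "tame d \<K>"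
  shows "\<exists>\<K>'. tame d \<K>' \<and> (\<forall>N R F. (N, R) \<in> \<K> \<longrightarrow> (\<forall>x. \<bar>F x\<bar> \<le> B) \<longrightarrow>
    (\<exists>R'. (N, R') \<in> \<K>' \<and> R' \<le> R \<and> stable d \<rho> L \<epsilon> N F R'))"
proof -
  have *: "\<exists>\<K>'. tame d \<K>' \<and> (\<forall>N R F. (N, R) \<in> \<K> \<longrightarrow> (\<forall>x. \<bar>F x\<bar> \<le> B) \<longrightarrow> B\<^sup>2 < energy N F R + real T * \<epsilon> \<longrightarrow>
    (\<exists>R'. (N, R') \<in> \<K>' \<and> R' \<le> R \<and> stable d \<rho> L \<epsilon> N F R'))" if "tame d \<K>" for T \<K>
    using that
  proof (induction T arbitrary: \<K>)
    case 0
    have "energy N F R \<le> B\<^sup>2" if "(N, R) \<in> \<K>" "\<forall>x. \<bar>F x\<bar> \<le> B" for N R F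
      using energy_bounds(2)[of N R F B] that 0 by (auto simp: tame_def)
    hence "\<forall>N R F. (N, R) \<in> \<K> \<longrightarrow> (\<forall>x. \<bar>F x\<bar> \<le> B) \<longrightarrow> \<not> B\<^sup>2 < energy N F R + real 0 * \<epsilon>"
      by (simp add: not_less)
    thus ?case using 0 by blast
  next
    case (Suc T)
    define \<K>s where "\<K>s = join_class L (\<K> \<union> grids d \<rho>)"
    have tames: "tame d \<K>s" unfolding \<K>s_def by (intro tame_join tame_Un Suc.prems tame_grids \<rho>)
    obtain \<K>' where \<K>': "tame d \<K>'" and
      IH: "\<And>N R F. (N, R) \<in> \<K>s \<Longrightarrow> (\<forall>x. \<bar>F x\<bar> \<le> B) \<Longrightarrow> B\<^sup>2 < energy N F R + real T * \<epsilon> \<Longrightarrow>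
        \<exists>R'. (N, R') \<in> \<K>' \<and> R' \<le> R \<and> stable d \<rho> L \<epsilon> N F R'"
      using Suc.IH[OF tames] by blast
    have "\<exists>R'. (N, R') \<in> \<K> \<union> \<K>' \<and> R' \<le> R \<and> stable d \<rho> L \<epsilon> N F R'"
      if R: "(N, R) \<in> \<K>" and F: "\<forall>x. \<bar>F x\<bar> \<le> B" and en: "B\<^sup>2 < energy N F R + real (Suc T) * \<epsilon>" for N R F
    proof (cases "stable d \<rho> L \<epsilon> N F R")
      case True
      thus ?thesis using R by blast
    next
      case False
      then obtain R' where R': "(N, R') \<in> join_class L (insert (N, R) (grids d \<rho>))" "R' \<le> R"
        "energy N F R + \<epsilon> < energy N F R'"
        unfolding stable_def by (auto simp: not_le)
      have "join_class L (insert (N, R) (grids d \<rho>)) \<subseteq> \<K>s"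
        unfolding \<K>s_def using R by (intro join_class_mono) auto
      hence "(N, R') \<in> \<K>s" using R'(1) by blast
      moreover have "B\<^sup>2 < energy N F R' + real T * \<epsilon>" using en R'(3) by (simp add: algebra_simps)
      ultimately obtain R'' where "(N, R'') \<in> \<K>'" "R'' \<le> R'" "stable d \<rho> L \<epsilon> N F R''"
        using IH F by blast
      thus ?thesis using R'(2) order_trans by blast
    qed
    thus ?case using tame_Un[OF Suc.prems \<K>'] by blast
  qed
  obtain T :: nat where T: "B\<^sup>2 < real T * \<epsilon>" using reals_Archimedean3[OF \<epsilon>] by blast
  obtain \<K>' where \<K>': "tame d \<K>'" and
    IH: "\<And>N R F. (N, R) \<in> \<K> \<Longrightarrow> (\<forall>x. \<bar>F x\<bar> \<le> B) \<Longrightarrow> B\<^sup>2 < energy N F R + real T * \<epsilon> \<Longrightarrow>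
      \<exists>R'. (N, R') \<in> \<K>' \<and> R' \<le> R \<and> stable d \<rho> L \<epsilon> N F R'"
    using *[OF tame, of T] by blast
  have "\<exists>R'. (N, R') \<in> \<K>' \<and> R' \<le> R \<and> stable d \<rho> L \<epsilon> N F R'"
    if "(N, R) \<in> \<K>" "\<forall>x. \<bar>F x\<bar> \<le> B" for N R F
  proof (rule IH[OF that])
    have "0 \<le> energy N F R" using energy_bounds(1)[of N R F B] that tame by (auto simp: tame_def)
    thus "B\<^sup>2 < energy N F R + real T * \<epsilon>" using T by linarith
  qed
  thus ?thesis using \<K>' by blast
qed

section \<open>Progressions on a single atom\<close>

text \<open>The pair \<open>a\<close>, \<open>s\<close> may vary with \<open>z\<close>, because each
  atom has its own colouring of the \<open>K\<close> shifts.\<close>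

definition hit :: "nat \<Rightarrow> nat \<Rightarrow> (int \<Rightarrow> bool) \<Rightarrow> int \<Rightarrow> int \<Rightarrow> bool" where
  "hit K k \<Omega> n z \<longleftrightarrow> (\<exists>a<K. \<exists>s\<in>{1..K}. \<forall>i<k. \<Omega> (z + n * int (a + s * i)))"

text \<open>Among the points with \<open>S\<close> at the start of the progression, those that meet
  \<open>E\<close> or at which some \<open>u\<close> moves by more than \<epsilon> are discarded. In
  units of \<open>card A\<close> there remains \<open>\<delta>/4 - \<delta>/8 - \<delta>/16\<close>,
  the second term from the weight of \<open>E\<close> in the hypothesis and the third from
  Chebyshev's inequality.\<close>

lemma hit_count:
  fixes A :: "int set" and \<kappa> \<delta> \<epsilon> :: real
  assumes A: "finite A" and k: "1 \<le> k" and \<delta>: "0 < \<delta>" and \<epsilon>: "0 < \<epsilon>"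
    and U: "finite U" "card U \<le> m"
    and as: "1 \<le> s" "s \<le> K" "\<forall>i<k. a + s * i < K"
    and close: "\<And>u i. u \<in> U \<Longrightarrow> i < k \<Longrightarrow>
      (\<Sum>z\<in>A. (cmod (u (z + n * int a) - u (z + n * int (a + s * i))))\<^sup>2) \<le> \<kappa> * card A"
    and \<kappa>: "0 \<le> \<kappa>" "\<kappa> * (real m * real k) \<le> \<epsilon>\<^sup>2 * (\<delta> / 16)"
    and F: "\<And>j. j < K \<Longrightarrow> \<delta> / 4 * card A \<le>
      (\<Sum>z\<in>A. of_bool (S (z + n * int j)) - 8 * real k / \<delta> * of_bool (E (z + n * int j)))"
    and SU: "\<And>x y. S x \<Longrightarrow> (\<forall>u\<in>U. cmod (u x - u y) \<le> \<epsilon>) \<Longrightarrow> \<Omega> y \<or> E y"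
  shows "\<delta> / 16 * card A \<le> (\<Sum>z\<in>A. of_bool (hit K k \<Omega> n z))"
proof -
  define p where "p i = n * int (a + s * i)" for i
  have aK: "a < K" using as(3) k by (auto dest: spec[of _ 0])
  \<comment> \<open>As \<open>S\<close> has density at most 1, nonnegativity of the weighted
    difference already makes \<open>E\<close> sparse at each term of the progression.\<close>
  have Esum: "(\<Sum>z\<in>A. of_bool (E (z + p i))) \<le> \<delta> / (8 * real k) * card A" if i: "i < k" for i
  proof -
    have "a + s * i < K" using as(3) i by simp
    from F[OF this] have "\<delta> / 4 * real (card A) + 8 * real k / \<delta> * (\<Sum>z\<in>A. of_bool (E (z + p i))) \<le> (\<Sum>z\<in>A. of_bool (S (z + p i)))"
      unfolding p_def sum_subtractf sum_distrib_left[symmetric] by linarith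
    also have "\<dots> \<le> (\<Sum>z\<in>A. 1)" by (intro sum_mono) simp
    finally have "\<delta> / 4 * real (card A) + 8 * real k / \<delta> * (\<Sum>z\<in>A. of_bool (E (z + p i))) \<le> real (card A)"
      unfolding real_of_card .
    moreover have "0 \<le> \<delta> / 4 * real (card A)" using \<delta> by simp
    ultimately have "8 * real k / \<delta> * (\<Sum>z\<in>A. of_bool (E (z + p i))) \<le> real (card A)" by linarith
    hence "\<delta> / (8 * real k) * (8 * real k / \<delta> * (\<Sum>z\<in>A. of_bool (E (z + p i)))) \<le> \<delta> / (8 * real k) * real (card A)"
      using \<delta> by (intro mult_left_mono) auto
    moreover have "\<delta> / (8 * real k) * (8 * real k / \<delta> * y) = y" for y using \<delta> k by simp
    ultimately show ?thesis by metis
  qed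
  have Ssum: "\<delta> / 4 * card A \<le> (\<Sum>z\<in>A. of_bool (S (z + p 0)))"
  proof -
    have "\<delta> / 4 * card A \<le> (\<Sum>z\<in>A. of_bool (S (z + p 0)) - 8 * real k / \<delta> * of_bool (E (z + p 0)))"
      using F[OF aK] by (simp add: p_def)
    also have "\<dots> \<le> (\<Sum>z\<in>A. of_bool (S (z + p 0)))" using \<delta> by (intro sum_mono) simp
    finally show ?thesis .
  qed
  have pt: "of_bool (S (z + p 0)) - (\<Sum>i<k. of_bool (E (z + p i)))
      - (\<Sum>u\<in>U. \<Sum>i<k. (cmod (u (z + p 0) - u (z + p i)))\<^sup>2 / \<epsilon>\<^sup>2) \<le> of_bool (hit K k \<Omega> n z)" for z
  proof -
    have E0: "0 \<le> (\<Sum>i<k. of_bool (E (z + p i)) :: real)" by (intro sum_nonneg) simp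
    have D0: "0 \<le> (\<Sum>u\<in>U. \<Sum>i<k. (cmod (u (z + p 0) - u (z + p i)))\<^sup>2 / \<epsilon>\<^sup>2)"
      by (intro sum_nonneg) simp
    have b: "of_bool (S (z + p 0)) \<le> (1 :: real)" "0 \<le> (of_bool (hit K k \<Omega> n z) :: real)" by simp_all
    consider "\<not> S (z + p 0)" | i where "i < k" "E (z + p i)"
      | u i where "u \<in> U" "i < k" "\<epsilon> < cmod (u (z + p 0) - u (z + p i))"
      | "S (z + p 0)" "\<forall>i<k. \<not> E (z + p i)" "\<forall>i<k. \<forall>u\<in>U. cmod (u (z + p 0) - u (z + p i)) \<le> \<epsilon>"
      by (meson not_le)
    thus ?thesis
    proof cases
      case 1
      hence "of_bool (S (z + p 0)) = (0 :: real)" by simp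
      thus ?thesis using E0 D0 b(2) by linarith
    next
      case 2
      hence "1 \<le> (\<Sum>i<k. of_bool (E (z + p i)) :: real)"
        using member_le_sum[of i "{..<k}" "\<lambda>i. of_bool (E (z + p i)) :: real"] by simp
      thus ?thesis using D0 b by linarith
    next
      case 3
      have "1 \<le> (cmod (u (z + p 0) - u (z + p i)))\<^sup>2 / \<epsilon>\<^sup>2"
        using 3(3) \<epsilon> by (simp add: power_mono less_imp_le)
      also have "\<dots> \<le> (\<Sum>i<k. (cmod (u (z + p 0) - u (z + p i)))\<^sup>2 / \<epsilon>\<^sup>2)"
        using 3(2) by (intro member_le_sum[of i "{..<k}" "\<lambda>i. (cmod (u (z + p 0) - u (z + p i)))\<^sup>2 / \<epsilon>\<^sup>2"]) auto
      also have "\<dots> \<le> (\<Sum>u\<in>U. \<Sum>i<k. (cmod (u (z + p 0) - u (z + p i)))\<^sup>2 / \<epsilon>\<^sup>2)"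
        using 3(1) U by (intro member_le_sum[of u U "\<lambda>u. \<Sum>i<k. (cmod (u (z + p 0) - u (z + p i)))\<^sup>2 / \<epsilon>\<^sup>2"] sum_nonneg) auto
      finally show ?thesis using E0 b by linarith
    next
      case 4
      have "\<Omega> (z + p i)" if "i < k" for i using SU[of "z + p 0" "z + p i"] 4 that by blast
      hence "hit K k \<Omega> n z" unfolding hit_def p_def using aK as(1,2) atLeastAtMost_iff by blast
      hence "of_bool (hit K k \<Omega> n z) = (1 :: real)" by simp
      thus ?thesis using E0 D0 b(1) by linarith
    qed
  qed
  have "(\<Sum>z\<in>A. of_bool (S (z + p 0)) - (\<Sum>i<k. of_bool (E (z + p i)))
      - (\<Sum>u\<in>U. \<Sum>i<k. (cmod (u (z + p 0) - u (z + p i)))\<^sup>2 / \<epsilon>\<^sup>2)) \<le> (\<Sum>z\<in>A. of_bool (hit K k \<Omega> n z))"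
    by (intro sum_mono pt)
  moreover have "(\<Sum>z\<in>A. of_bool (S (z + p 0)) - (\<Sum>i<k. of_bool (E (z + p i)))
      - (\<Sum>u\<in>U. \<Sum>i<k. (cmod (u (z + p 0) - u (z + p i)))\<^sup>2 / \<epsilon>\<^sup>2)) =
    (\<Sum>z\<in>A. of_bool (S (z + p 0))) - (\<Sum>i<k. \<Sum>z\<in>A. of_bool (E (z + p i)))
      - (\<Sum>u\<in>U. \<Sum>i<k. (\<Sum>z\<in>A. (cmod (u (z + p 0) - u (z + p i)))\<^sup>2) / \<epsilon>\<^sup>2)"
  proof -
    have 1: "(\<Sum>z\<in>A. \<Sum>i<k. of_bool (E (z + p i)) :: real) = (\<Sum>i<k. \<Sum>z\<in>A. of_bool (E (z + p i)))"
      by (rule sum.swap)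
    have "(\<Sum>z\<in>A. \<Sum>u\<in>U. \<Sum>i<k. (cmod (u (z + p 0) - u (z + p i)))\<^sup>2 / \<epsilon>\<^sup>2)
        = (\<Sum>u\<in>U. \<Sum>z\<in>A. \<Sum>i<k. (cmod (u (z + p 0) - u (z + p i)))\<^sup>2 / \<epsilon>\<^sup>2)" by (rule sum.swap)
    also have "\<dots> = (\<Sum>u\<in>U. \<Sum>i<k. \<Sum>z\<in>A. (cmod (u (z + p 0) - u (z + p i)))\<^sup>2 / \<epsilon>\<^sup>2)"
      by (intro sum.cong refl sum.swap)
    finally show ?thesis by (simp only: sum_subtractf 1 sum_divide_distrib)
  qed
  moreover have "(\<Sum>i<k. \<Sum>z\<in>A. of_bool (E (z + p i))) \<le> \<delta> / 8 * card A"
  proof -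
    have "(\<Sum>i<k. \<Sum>z\<in>A. of_bool (E (z + p i))) \<le> (\<Sum>i<k. \<delta> / (8 * real k) * card A)"
      by (intro sum_mono Esum) simp
    also have "\<dots> = \<delta> / 8 * card A" using k by simp
    finally show ?thesis .
  qed
  moreover have "(\<Sum>u\<in>U. \<Sum>i<k. (\<Sum>z\<in>A. (cmod (u (z + p 0) - u (z + p i)))\<^sup>2) / \<epsilon>\<^sup>2) \<le> \<delta> / 16 * card A"
  proof -
    have "(\<Sum>u\<in>U. \<Sum>i<k. (\<Sum>z\<in>A. (cmod (u (z + p 0) - u (z + p i)))\<^sup>2) / \<epsilon>\<^sup>2) \<le> (\<Sum>u\<in>U. \<Sum>i<k. \<kappa> * card A / \<epsilon>\<^sup>2)"
      using close by (intro sum_mono divide_right_mono) (auto simp: p_def)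
    also have "\<dots> = card U * k * (\<kappa> * card A / \<epsilon>\<^sup>2)" by simp
    also have "\<dots> \<le> m * k * (\<kappa> * card A / \<epsilon>\<^sup>2)"
      using U(2) \<kappa>(1) by (intro mult_right_mono) (auto simp flip: of_nat_mult intro: mult_right_mono)
    also have "\<dots> = \<kappa> * (real m * real k) / \<epsilon>\<^sup>2 * card A" by simp
    also have "\<dots> \<le> \<delta> / 16 * card A"
      using \<kappa>(2) \<epsilon> by (intro mult_right_mono) (auto simp: field_simps)
    finally show ?thesis .
  qed
  ultimately show ?thesis using Ssum by linarith
qed

lemma norm_add5_power2_le:
  fixes a b c d e :: "'a :: real_normed_vector"
  shows "(norm (a + b + c + d + e))\<^sup>2 \<le>
    5 * ((norm a)\<^sup>2 + (norm b)\<^sup>2 + (norm c)\<^sup>2 + (norm d)\<^sup>2 + (norm e)\<^sup>2)"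
proof -
  have "(v + w + x + y + z)\<^sup>2 \<le> 5 * (v\<^sup>2 + w\<^sup>2 + x\<^sup>2 + y\<^sup>2 + z\<^sup>2)" for v w x y z :: real
  proof -
    have "0 \<le> (v - w)\<^sup>2 + (v - x)\<^sup>2 + (v - y)\<^sup>2 + (v - z)\<^sup>2 + (w - x)\<^sup>2 + (w - y)\<^sup>2 + (w - z)\<^sup>2
      + (x - y)\<^sup>2 + (x - z)\<^sup>2 + (y - z)\<^sup>2"
      by (intro add_nonneg_nonneg zero_le_power2)
    thus ?thesis by (simp add: power2_eq_square algebra_simps)
  qed
  moreover have "(norm (a + b + c + d + e))\<^sup>2 \<le> (norm a + norm b + norm c + norm d + norm e)\<^sup>2"
    by (intro power_mono norm_triangle_mono) auto
  ultimately show ?thesis using order_trans by blast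
qed

definition colouring_bound :: "real \<Rightarrow> nat \<Rightarrow> bool" where
  "colouring_bound \<eta> C \<longleftrightarrow> 1 \<le> C \<and>
    (\<forall>K n A (g :: nat \<Rightarrow> int \<Rightarrow> complex) (c :: nat \<Rightarrow> nat \<Rightarrow> complex).
    1 \<le> n \<longrightarrow> finite A \<longrightarrow> A \<noteq> {} \<longrightarrow>
    (\<forall>s<n. \<forall>z\<in>A. cmod (g s z) \<le> 1) \<longrightarrow> (\<forall>j<K. \<forall>s<n. cmod (c j s) \<le> 1) \<longrightarrow>
    (\<exists>col :: nat \<Rightarrow> nat. card (col ` {..<K}) \<le> C \<and> (\<forall>i<K. \<forall>j<K. col i = col j \<longrightarrow>
      (\<Sum>z\<in>A. (cmod ((\<Sum>s<n. c i s * g s z) / n - (\<Sum>s<n. c j s * g s z) / n))\<^sup>2) \<le> \<eta> * real (card A))))"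

lemma colouring_bound_exists: "0 < \<eta> \<Longrightarrow> \<exists>C. colouring_bound \<eta> C"
  unfolding colouring_bound_def by (rule total_boundedness_colouring)

text \<open>Two shifts are compared along a chain of five differences: pass to the sample, freeze
  its coefficients at \<open>ctr\<close>, use the colour, and undo the first two. Each contributes
  at most \<open>\<kappa> / 25\<close> and the squared five-term inequality costs a factor 5.
  Freezing produces the constant coefficients that \<open>colouring_bound\<close> handles.\<close>

lemma fibre_colouring:
  fixes v :: "nat \<Rightarrow> int \<Rightarrow> complex" and C :: "nat \<Rightarrow> nat \<Rightarrow> int \<Rightarrow> complex" and A :: "int set"
    and M M' \<kappa> \<eta> \<rho> :: real
  assumes cb: "colouring_bound \<eta> B" and A: "finite A" "A \<noteq> {}" and D: "1 \<le> D"
    and M: "0 \<le> M'" "M' \<le> M" and \<kappa>: "0 \<le> \<kappa>" "M\<^sup>2 * \<eta> \<le> \<kappa> / 25" "M\<^sup>2 * \<rho>\<^sup>2 \<le> \<kappa> / 25"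
    and g: "\<And>s z. cmod (g s z) \<le> 1" and C: "\<And>j s z. cmod (C j s z) \<le> 1"
    and const: "\<And>j s z. j < K \<Longrightarrow> s < D \<Longrightarrow> z \<in> A \<Longrightarrow> cmod (C j s z - C j s ctr) \<le> \<rho>"
    and approx: "\<And>j. j < K \<Longrightarrow>
      (\<Sum>z\<in>A. (cmod (v j z - M' * ((\<Sum>s<D. C j s z * g s z) / D)))\<^sup>2) \<le> \<kappa> / 25 * card A"
  shows "\<exists>col :: nat \<Rightarrow> nat. card (col ` {..<K}) \<le> B \<and> (\<forall>i<K. \<forall>j<K. col i = col j \<longrightarrow>
    (\<Sum>z\<in>A. (cmod (v i z - v j z))\<^sup>2) \<le> \<kappa> * card A)"
proof -
  define P where "P j z = (\<Sum>s<D. C j s z * g s z) / D" for j z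
  define P' where "P' j z = (\<Sum>s<D. C j s ctr * g s z) / D" for j z
  have "\<exists>col :: nat \<Rightarrow> nat. card (col ` {..<K}) \<le> B \<and> (\<forall>i<K. \<forall>j<K. col i = col j \<longrightarrow>
    (\<Sum>z\<in>A. (cmod (P' i z - P' j z))\<^sup>2) \<le> \<eta> * card A)"
    using cb A D g C unfolding colouring_bound_def P'_def by simp
  then obtain col :: "nat \<Rightarrow> nat" where col: "card (col ` {..<K}) \<le> B" and
    cl: "\<And>i j. i < K \<Longrightarrow> j < K \<Longrightarrow> col i = col j \<Longrightarrow> (\<Sum>z\<in>A. (cmod (P' i z - P' j z))\<^sup>2) \<le> \<eta> * card A"
    by blast
  have MM: "M'\<^sup>2 \<le> M\<^sup>2" using M by (intro power_mono)
  have PP: "M'\<^sup>2 * (cmod (P j z - P' j z))\<^sup>2 \<le> \<kappa> / 25" if "j < K" "z \<in> A" for j z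
  proof -
    have "cmod (P j z - P' j z) = cmod (\<Sum>s<D. (C j s z - C j s ctr) * g s z) / D"
      by (simp add: P_def P'_def diff_divide_distrib[symmetric] sum_subtractf[symmetric]
          left_diff_distrib norm_divide)
    also have "\<dots> \<le> (\<Sum>s<D. \<rho>) / D"
    proof (intro divide_right_mono order_trans[OF norm_sum sum_mono])
      fix s assume "s \<in> {..<D}"
      hence "cmod (C j s z - C j s ctr) * cmod (g s z) \<le> \<rho> * 1"
        using const that g by (intro mult_mono) (auto intro: order_trans[OF norm_ge_zero])
      thus "cmod ((C j s z - C j s ctr) * g s z) \<le> \<rho>" by (simp add: norm_mult)
    qed simp
    finally have "cmod (P j z - P' j z) \<le> \<rho>" using D by simp
    hence "(cmod (P j z - P' j z))\<^sup>2 \<le> \<rho>\<^sup>2" by (intro power_mono) auto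
    hence "M'\<^sup>2 * (cmod (P j z - P' j z))\<^sup>2 \<le> M\<^sup>2 * \<rho>\<^sup>2" using MM by (intro mult_mono) auto
    thus ?thesis using \<kappa>(3) by linarith
  qed
  have PPs: "(\<Sum>z\<in>A. M'\<^sup>2 * (cmod (P j z - P' j z))\<^sup>2) \<le> \<kappa> / 25 * card A" if "j < K" for j
    using sum_bounded_above[of A "\<lambda>z. M'\<^sup>2 * (cmod (P j z - P' j z))\<^sup>2" "\<kappa> / 25"] PP[OF that]
    by (simp only: mult.commute)
  have "(\<Sum>z\<in>A. (cmod (v i z - v j z))\<^sup>2) \<le> \<kappa> * card A" if ij: "i < K" "j < K" "col i = col j" for i j
  proof -
    have pt: "(cmod (v i z - v j z))\<^sup>2 \<le> 5 * ((cmod (v i z - M' * P i z))\<^sup>2 + M'\<^sup>2 * (cmod (P i z - P' i z))\<^sup>2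
      + M'\<^sup>2 * (cmod (P' i z - P' j z))\<^sup>2 + M'\<^sup>2 * (cmod (P j z - P' j z))\<^sup>2 + (cmod (v j z - M' * P j z))\<^sup>2)" for z
    proof -
      have sq: "(cmod (complex_of_real M' * y))\<^sup>2 = M'\<^sup>2 * (cmod y)\<^sup>2" for y
        by (simp add: norm_mult power_mult_distrib)
      have "v i z - v j z = (v i z - M' * P i z) + M' * (P i z - P' i z) + M' * (P' i z - P' j z)
          + M' * (P' j z - P j z) + (M' * P j z - v j z)"
        by (simp add: algebra_simps)
      thus ?thesis
        using norm_add5_power2_le[of "v i z - M' * P i z" "M' * (P i z - P' i z)" "M' * (P' i z - P' j z)"
          "M' * (P' j z - P j z)" "M' * P j z - v j z"]
        by (simp only: sq norm_minus_commute[of "P' j z" "P j z"] norm_minus_commute[of "M' * P j z" "v j z"])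
    qed
    have "(\<Sum>z\<in>A. (cmod (v i z - v j z))\<^sup>2) \<le> 5 * ((\<Sum>z\<in>A. (cmod (v i z - M' * P i z))\<^sup>2)
        + (\<Sum>z\<in>A. M'\<^sup>2 * (cmod (P i z - P' i z))\<^sup>2) + M'\<^sup>2 * (\<Sum>z\<in>A. (cmod (P' i z - P' j z))\<^sup>2)
        + (\<Sum>z\<in>A. M'\<^sup>2 * (cmod (P j z - P' j z))\<^sup>2) + (\<Sum>z\<in>A. (cmod (v j z - M' * P j z))\<^sup>2))"
      by (rule order_trans, rule sum_mono, rule pt) (simp only: sum.distrib sum_distrib_left[symmetric] order_refl)
    moreover have "M'\<^sup>2 * (\<Sum>z\<in>A. (cmod (P' i z - P' j z))\<^sup>2) \<le> \<kappa> / 25 * card A"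
    proof -
      have "M'\<^sup>2 * (\<Sum>z\<in>A. (cmod (P' i z - P' j z))\<^sup>2) \<le> M\<^sup>2 * (\<eta> * card A)"
        using MM cl[OF ij] by (intro mult_mono sum_nonneg) auto
      also have "\<dots> = M\<^sup>2 * \<eta> * card A" by simp
      also have "\<dots> \<le> \<kappa> / 25 * card A" using \<kappa>(2) by (intro mult_right_mono) auto
      finally show ?thesis .
    qed
    moreover have "x \<le> \<kappa> * card A" if "x \<le> 5 * (a + b + c + d + e)" "c \<le> \<kappa> / 25 * card A"
      "b \<le> \<kappa> / 25 * card A" "d \<le> \<kappa> / 25 * card A" "a \<le> \<kappa> / 25 * card A" "e \<le> \<kappa> / 25 * card A"
      for x a b c d e :: real
      using that by simp
    ultimately show ?thesis
      using PPs[OF ij(1)] PPs[OF ij(2)] approx[OF ij(1)] approx[OF ij(2)] unfolding P_def by blast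
  qed
  thus ?thesis using col by blast
qed

lemma card_combined_colouring:
  fixes col :: "'u \<Rightarrow> nat \<Rightarrow> nat"
  assumes "finite U" "card U \<le> m" "1 \<le> C" "\<And>u. u \<in> U \<Longrightarrow> card (col u ` {..<K}) \<le> C"
  shows "card ((\<lambda>j. restrict (\<lambda>u. col u j) U) ` {..<K}) \<le> C ^ m"
proof -
  have "(\<lambda>j. restrict (\<lambda>u. col u j) U) ` {..<K} \<subseteq> (\<Pi>\<^sub>E u\<in>U. col u ` {..<K})"
    by (auto simp: PiE_def Pi_def)
  hence "card ((\<lambda>j. restrict (\<lambda>u. col u j) U) ` {..<K}) \<le> card (\<Pi>\<^sub>E u\<in>U. col u ` {..<K})"
    using assms(1) by (intro card_mono finite_PiE) auto
  also have "\<dots> = (\<Prod>u\<in>U. card (col u ` {..<K}))" by (rule card_PiE[OF assms(1)])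
  also have "\<dots> \<le> (\<Prod>u\<in>U. C)" using assms(4) by (intro prod_mono) auto
  also have "\<dots> \<le> C ^ m" using assms(2,3) by (simp add: power_increasing)
  finally show ?thesis .
qed

text \<open>The sample is drawn for all pairs of \<open>j < K\<close> and \<open>x\<close> at once,
  so the same functions \<open>g s\<close> serve every shift and only the coefficients vary with
  \<open>j\<close>. This is what allows the shifts to be compared with each other.\<close>

lemma sampled_representation:
  assumes N: "0 < N" and u: "u \<in> UAP_ball N (Suc d) M" and D: "1 \<le> D"
  shows "\<exists>(M' :: real) (g :: nat \<Rightarrow> int \<Rightarrow> complex) (C :: nat \<Rightarrow> nat \<Rightarrow> int \<Rightarrow> complex). 0 \<le> M' \<and> M' \<le> M \<and>
    (\<forall>s z. cmod (g s z) \<le> 1) \<and> (\<forall>j s. C j s \<in> UAP_ball N d 2) \<and> (\<forall>j s z. cmod (C j s z) \<le> 1) \<and>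
    avg (ZN N) (\<lambda>x. \<Sum>j<K. (cmod (u (x + n * int j) - M' * ((\<Sum>s<D. C j s x * g s x) / D)))\<^sup>2)
      \<le> K * M\<^sup>2 / D"
proof -
  obtain M' :: real and H q and g :: "nat \<Rightarrow> int \<Rightarrow> complex" and C :: "int \<Rightarrow> nat \<Rightarrow> int \<Rightarrow> complex" where
    M': "0 \<le> M'" "M' \<le> M" and H: "finite (H :: nat set)" "\<And>h. h \<in> H \<Longrightarrow> 0 \<le> q h" "sum q H = (1 :: real)"
    and g: "\<And>h x. h \<in> H \<Longrightarrow> cmod (g h x) \<le> 1"
    and C: "\<And>n h. h \<in> H \<Longrightarrow> C n h \<in> UAP_ball N d 2" "\<And>n h x. h \<in> H \<Longrightarrow> cmod (C n h x) \<le> 1"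
    and rep: "\<And>n x. u (x + n) = M' * (\<Sum>h\<in>H. q h * (C n h x * g h x))"
    using UAP_ball_Suc_rep[OF N u] by blast
  define \<phi> where "\<phi> t h = (case t of (j, x) \<Rightarrow> C (n * int j) h x * g h x)" for t :: "nat \<times> int" and h
  have \<phi>1: "cmod (\<phi> t h) \<le> 1" if "t \<in> {..<K} \<times> ZN N" "h \<in> H" for t h
    using g[OF that(2)] C(2)[OF that(2)] unfolding \<phi>_def
    by (cases t) (auto simp: norm_mult intro!: mult_le_one)
  have "\<exists>w. (\<forall>s. w s \<in> H) \<and>
    (\<Sum>t\<in>{..<K} \<times> ZN N. (cmod (\<Sum>s<D. \<phi> t (w s) - (\<Sum>h\<in>H. q h * \<phi> t h)))\<^sup>2)
      \<le> real D * real (card ({..<K} \<times> ZN N))"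
    by (rule sampling[OF H \<phi>1])
  then obtain w where w: "\<And>s. w s \<in> H" and
    le: "(\<Sum>t\<in>{..<K} \<times> ZN N. (cmod (\<Sum>s<D. \<phi> t (w s) - (\<Sum>h\<in>H. q h * \<phi> t h)))\<^sup>2)
      \<le> real D * real (card ({..<K} \<times> ZN N))" by blast
  have sq: "(cmod (u (x + n * int j) - M' * ((\<Sum>s<D. C (n * int j) (w s) x * g (w s) x) / D)))\<^sup>2 =
      M'\<^sup>2 / D\<^sup>2 * (cmod (\<Sum>s<D. \<phi> (j, x) (w s) - (\<Sum>h\<in>H. q h * \<phi> (j, x) h)))\<^sup>2" for x j
  proof -
    have "u (x + n * int j) - M' * ((\<Sum>s<D. C (n * int j) (w s) x * g (w s) x) / D) =
       - (M' / D) * (\<Sum>s<D. \<phi> (j, x) (w s) - (\<Sum>h\<in>H. q h * \<phi> (j, x) h))"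
      using D unfolding rep by (simp add: \<phi>_def sum_subtractf field_simps)
    thus ?thesis by (simp add: norm_mult norm_divide power_mult_distrib power_divide)
  qed
  have "(\<Sum>x\<in>ZN N. \<Sum>j<K. (cmod (u (x + n * int j) - M' * ((\<Sum>s<D. C (n * int j) (w s) x * g (w s) x) / D)))\<^sup>2)
      = M'\<^sup>2 / D\<^sup>2 * (\<Sum>x\<in>ZN N. \<Sum>j<K. (cmod (\<Sum>s<D. \<phi> (j, x) (w s) - (\<Sum>h\<in>H. q h * \<phi> (j, x) h)))\<^sup>2)"
    unfolding sq sum_distrib_left ..
  also have "(\<Sum>x\<in>ZN N. \<Sum>j<K. (cmod (\<Sum>s<D. \<phi> (j, x) (w s) - (\<Sum>h\<in>H. q h * \<phi> (j, x) h)))\<^sup>2) =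
      (\<Sum>t\<in>{..<K} \<times> ZN N. (cmod (\<Sum>s<D. \<phi> t (w s) - (\<Sum>h\<in>H. q h * \<phi> t h)))\<^sup>2)"
    by (subst sum.swap) (simp add: sum.cartesian_product)
  also have "M'\<^sup>2 / D\<^sup>2 * \<dots> \<le> M\<^sup>2 / D\<^sup>2 * (real D * real (card ({..<K} \<times> ZN N)))"
    using M' le by (intro mult_mono divide_right_mono power_mono sum_nonneg) auto
  also have "\<dots> = K * M\<^sup>2 / D * N" using D by (simp add: card_cartesian_product power2_eq_square)
  finally have "avg (ZN N) (\<lambda>x. \<Sum>j<K. (cmod (u (x + n * int j) - M' * ((\<Sum>s<D. C (n * int j) (w s) x * g (w s) x) / D)))\<^sup>2)
      \<le> K * M\<^sup>2 / D" using N unfolding avg_ZN by (simp add: pos_divide_le_eq)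
  thus ?thesis using M' g C w
    by (intro exI[of _ M'] exI[of _ "\<lambda>s. g (w s)"] exI[of _ "\<lambda>j s. C (n * int j) (w s)"]) auto
qed

section \<open>Refinements on which the sampled coefficients are nearly constant\<close>

lemma shift_rel_join:
  "shift_rel t (\<lambda>x y. \<forall>Q\<in>\<Q>. Q x y) = (\<lambda>x y. \<forall>Q\<in>shift_rel t ` \<Q>. Q x y)"
  by (auto simp: shift_rel_def fun_eq_iff)

text \<open>What almost periodicity provides on an atom of \<open>B\<close>. One function
  \<open>e\<close> dominates the squared errors of all shifts, so that its conditional expectation
  controls them together.\<close>

definition fibre_structure ::
  "nat \<Rightarrow> real \<Rightarrow> real \<Rightarrow> nat \<Rightarrow> nat \<Rightarrow> int \<Rightarrow> (int \<Rightarrow> int \<Rightarrow> bool) \<Rightarrow> (int \<Rightarrow> real) \<Rightarrow> (int \<Rightarrow> complex) \<Rightarrow> bool" where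
  "fibre_structure N M \<rho> K D n B e u \<longleftrightarrow>
     (\<exists>(M' :: real) (g :: nat \<Rightarrow> int \<Rightarrow> complex) (C :: nat \<Rightarrow> nat \<Rightarrow> int \<Rightarrow> complex). 0 \<le> M' \<and> M' \<le> M \<and>
       (\<forall>s z. cmod (g s z) \<le> 1) \<and> (\<forall>j s z. cmod (C j s z) \<le> 1) \<and>
       (\<forall>j<K. \<forall>s<D. \<forall>x y. B x y \<longrightarrow> cmod (C j s x - C j s y) \<le> \<rho>) \<and>
       (\<forall>j<K. \<forall>x. (cmod (u (x + n * int j) - M' * ((\<Sum>s<D. C j s x * g s x) / D)))\<^sup>2 \<le> e x))"

text \<open>The join contains the shift of \<open>R\<close> by every \<open>n * j\<close>, in order
  that \<open>B\<close> shifted back by \<open>n * j\<close> refines \<open>R\<close>; only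
  refinements of \<open>R\<close> are compared in \<open>stable\<close>. It also contains one grid
  for each of the at most \<open>m * K * D\<close> sampled coefficients.\<close>

lemma fibre_relation:
  assumes N: "0 < N" and U: "U \<subseteq> UAP_ball N (Suc d) M" "finite U" "card U \<le> m"
    and \<rho>: "0 < \<rho>" and D: "1 \<le> D" and R: "zrel N R"
  shows "\<exists>B e. zrel N B \<and> (\<forall>x. 0 \<le> e x) \<and> avg (ZN N) e \<le> m * (K * M\<^sup>2 / D) \<and>
    (\<forall>j<K. (N, shift_rel (- (n * int j)) B) \<in> join_class (K + m * K * D) (insert (N, R) (grids d \<rho>)) \<and>
       shift_rel (- (n * int j)) B \<le> R) \<and>
    (\<forall>u\<in>U. fibre_structure N M \<rho> K D n B e u)"
proof -
  define err where "err u M' g C x = (\<Sum>j<K. (cmod (u (x + n * int j) - complex_of_real M' * ((\<Sum>s<D. C j s x * g s x) / D)))\<^sup>2)"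
    for u :: "int \<Rightarrow> complex" and M' :: real and g :: "nat \<Rightarrow> int \<Rightarrow> complex" and C :: "nat \<Rightarrow> nat \<Rightarrow> int \<Rightarrow> complex" and x
  define P where "P u M' g C \<longleftrightarrow> 0 \<le> M' \<and> M' \<le> M \<and>
    (\<forall>s z. cmod (g s z) \<le> 1) \<and> (\<forall>j s. C j s \<in> UAP_ball N d 2) \<and> (\<forall>j s z. cmod (C j s z) \<le> 1) \<and>
    avg (ZN N) (err u M' g C) \<le> K * M\<^sup>2 / D"
    for u :: "int \<Rightarrow> complex" and M' :: real and g :: "nat \<Rightarrow> int \<Rightarrow> complex" and C :: "nat \<Rightarrow> nat \<Rightarrow> int \<Rightarrow> complex"
  have "\<forall>u\<in>U. \<exists>M' g C. P u M' g C"
    unfolding P_def err_def using sampled_representation[OF N _ D, of _ d M n K] U(1) by blast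
  then obtain M' g C where P: "\<And>u. u \<in> U \<Longrightarrow> P u (M' u) (g u) (C u)" by metis
  have "\<forall>u\<in>U. \<forall>j s. \<exists>G. (N, G) \<in> grids d \<rho> \<and> (\<forall>x y. G x y \<longrightarrow> cmod (C u j s x - C u j s y) \<le> \<rho>)"
  proof (intro ballI allI)
    fix u j s assume "u \<in> U"
    hence "C u j s \<in> UAP_ball N d 2" using P unfolding P_def by blast
    thus "\<exists>G. (N, G) \<in> grids d \<rho> \<and> (\<forall>x y. G x y \<longrightarrow> cmod (C u j s x - C u j s y) \<le> \<rho>)"
      by (rule grid_exists[OF N _ \<rho>])
  qed
  then obtain G where G: "\<And>u j s. u \<in> U \<Longrightarrow> (N, G u j s) \<in> grids d \<rho>"
    "\<And>u j s x y. u \<in> U \<Longrightarrow> G u j s x y \<Longrightarrow> cmod (C u j s x - C u j s y) \<le> \<rho>" by metis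
  define \<Q> where "\<Q> = (\<lambda>j. shift_rel (n * int j) R) ` {..<K} \<union> (\<lambda>(u, j, s). G u j s) ` (U \<times> {..<K} \<times> {..<D})"
  define B where "B = (\<lambda>x y. \<forall>Q\<in>\<Q>. Q x y)"
  define e where "e x = (\<Sum>u\<in>U. err u (M' u) (g u) (C u) x)" for x
  have err0: "0 \<le> err u M' g C x" for u M' g C x unfolding err_def by (intro sum_nonneg) simp
  have fin: "finite \<Q>" unfolding \<Q>_def using U(2) by simp
  have card: "card \<Q> \<le> K + m * K * D"
  proof -
    have "card \<Q> \<le> card ((\<lambda>j. shift_rel (n * int j) R) ` {..<K}) + card ((\<lambda>(u, j, s). G u j s) ` (U \<times> {..<K} \<times> {..<D}))"
      unfolding \<Q>_def by (rule card_Un_le)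
    also have "\<dots> \<le> card {..<K} + card (U \<times> {..<K} \<times> {..<D})"
      using U(2) by (intro add_mono card_image_le) auto
    also have "\<dots> \<le> K + m * K * D" using U(3) by (simp add: card_cartesian_product mult.assoc)
    finally show ?thesis .
  qed
  have gens: "\<exists>t R'. (N, R') \<in> insert (N, R) (grids d \<rho>) \<and> Q = shift_rel t R'" if "Q \<in> \<Q>" for Q
  proof -
    from that consider j where "Q = shift_rel (n * int j) R" | u j s where "u \<in> U" "Q = G u j s"
      unfolding \<Q>_def by auto
    thus ?thesis
    proof cases
      case 2
      thus ?thesis using G(1) by (intro exI[of _ 0] exI[of _ Q]) simp
    qed blast
  qed
  have zgen: "zrel N Q" if Q: "Q \<in> \<Q>" for Q
  proof -
    obtain t R' where R': "(N, R') \<in> insert (N, R) (grids d \<rho>)" "Q = shift_rel t R'" using gens[OF Q] by blast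
    hence "zrel N R'" using R by (auto simp: grids_def)
    thus ?thesis using R'(2) zrel_shift by simp
  qed
  have "zrel N B" unfolding B_def by (rule zrel_join[OF zgen])
  moreover have "\<forall>x. 0 \<le> e x" unfolding e_def using err0 by (intro allI sum_nonneg)
  moreover have "avg (ZN N) e \<le> m * (K * M\<^sup>2 / D)"
  proof -
    have "avg (ZN N) e = (\<Sum>u\<in>U. avg (ZN N) (err u (M' u) (g u) (C u)))"
      unfolding e_def by (rule avg_sum)
    also have "\<dots> \<le> (\<Sum>u\<in>U. K * M\<^sup>2 / D)" using P unfolding P_def by (intro sum_mono) blast
    also have "\<dots> = card U * (K * M\<^sup>2 / D)" by simp
    also have "\<dots> \<le> m * (K * M\<^sup>2 / D)" using U(3) by (intro mult_right_mono) auto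
    finally show ?thesis .
  qed
  moreover have "(N, shift_rel t B) \<in> join_class (K + m * K * D) (insert (N, R) (grids d \<rho>))" for t
    unfolding B_def shift_rel_join
  proof (rule join_classI[OF N])
    show "card (shift_rel t ` \<Q>) \<le> K + m * K * D" using card card_image_le[OF fin] le_trans by blast
    fix Q assume "Q \<in> shift_rel t ` \<Q>"
    then obtain Q' where Q': "Q' \<in> \<Q>" "Q = shift_rel t Q'" by blast
    then obtain s R' where "(N, R') \<in> insert (N, R) (grids d \<rho>)" "Q' = shift_rel s R'" using gens by blast
    thus "\<exists>t R'. (N, R') \<in> insert (N, R) (grids d \<rho>) \<and> Q = shift_rel t R'"
      using Q'(2) shift_rel_shift_rel by blast
  qed (use fin in simp)
  moreover have "shift_rel (- (n * int j)) B \<le> R" if "j < K" for j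
  proof -
    have "B \<le> shift_rel (n * int j) R" using that unfolding B_def \<Q>_def by auto
    moreover have "shift_rel t B \<le> shift_rel t Q" if "B \<le> Q" for t Q
      using that unfolding shift_rel_def le_fun_def by blast
    ultimately have "shift_rel (- (n * int j)) B \<le> shift_rel (- (n * int j)) (shift_rel (n * int j) R)"
      by blast
    thus ?thesis by (simp add: shift_rel_shift_rel)
  qed
  moreover have "fibre_structure N M \<rho> K D n B e u" if u: "u \<in> U" for u
    unfolding fibre_structure_def
  proof (intro exI[of _ "M' u"] exI[of _ "g u"] exI[of _ "C u"] conjI allI impI)
    fix j s x y assume "j < K" "s < D" "B x y"
    moreover from this have "G u j s \<in> \<Q>" using u unfolding \<Q>_def by force
    ultimately have "G u j s x y" unfolding B_def by blast
    thus "cmod (C u j s x - C u j s y) \<le> \<rho>" using G(2)[OF u] by blast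
  next
    fix j x assume j: "j < K"
    have "(cmod (u (x + n * int j) - complex_of_real (M' u) * ((\<Sum>s<D. C u j s x * g u s x) / D)))\<^sup>2
        \<le> err u (M' u) (g u) (C u) x"
      unfolding err_def using j
      by (intro member_le_sum[of j "{..<K}" "\<lambda>j. (cmod (u (x + n * int j) - complex_of_real (M' u) * ((\<Sum>s<D. C u j s x * g u s x) / D)))\<^sup>2"]) auto
    also have "\<dots> \<le> e x" unfolding e_def using u U(2) err0
      by (intro member_le_sum[of u U "\<lambda>u. err u (M' u) (g u) (C u) x"]) auto
    finally show "(cmod (u (x + n * int j) - complex_of_real (M' u) * ((\<Sum>s<D. C u j s x * g u s x) / D)))\<^sup>2 \<le> e x" .
  qed (use P[OF u] in \<open>auto simp: P_def\<close>)
  ultimately show ?thesis by blast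
qed

lemma cexp_eq_atom_average:
  "cexp N R f x = (\<Sum>z\<in>{z \<in> ZN N. R x z}. f z) / card {z \<in> ZN N. R x z}"
proof -
  have "ZN N \<inter> {z. R x z} = {z \<in> ZN N. R x z}" by auto
  thus ?thesis unfolding cexp_def by simp
qed

text \<open>Colours are tuples indexed by the functions \<open>u\<close>, and this fixes the colour
  type under the quantifier.\<close>

definition vdw_property :: "nat \<Rightarrow> nat \<Rightarrow> nat \<Rightarrow> bool" where
  "vdw_property k C K \<longleftrightarrow> 1 \<le> K \<and> (\<forall>col :: nat \<Rightarrow> (int \<Rightarrow> complex) \<Rightarrow> nat. card (col ` {..<K}) \<le> C \<longrightarrow>
     (\<exists>a s. 1 \<le> s \<and> s \<le> K \<and> (\<forall>i<k. a + s * i < K) \<and> (\<forall>i<k. col (a + s * i) = col a)))"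

text \<open>Each \<open>u\<close> colours the \<open>K\<close> shifts by proximity on the atom of
  \<open>x\<close>. The combined colouring has at most \<open>C0 ^ m\<close> colours, and along a
  monochromatic progression the shifts are close for all \<open>u\<close> simultaneously.\<close>

lemma fibre_hit:
  fixes \<kappa> \<delta> \<epsilon> \<eta> \<rho> M :: real
  assumes N: "0 < N" and B: "zrel N B" and k: "1 \<le> k" and \<delta>: "0 < \<delta>" and \<epsilon>: "0 < \<epsilon>" and D: "1 \<le> D"
    and U: "finite U" "card U \<le> m" "\<And>u. u \<in> U \<Longrightarrow> fibre_structure N M \<rho> K D n B e u"
    and cb: "colouring_bound \<eta> C0" and vdw: "vdw_property k (C0 ^ m) K"
    and \<kappa>: "0 \<le> \<kappa>" "\<kappa> * (real m * real k) \<le> \<epsilon>\<^sup>2 * (\<delta> / 16)" "M\<^sup>2 * \<eta> \<le> \<kappa> / 25" "M\<^sup>2 * \<rho>\<^sup>2 \<le> \<kappa> / 25"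
    and SU: "\<And>x y. S x \<Longrightarrow> (\<forall>u\<in>U. cmod (u x - u y) \<le> \<epsilon>) \<Longrightarrow> \<Omega> y \<or> E y"
    and e: "cexp N B e x \<le> \<kappa> / 25"
    and F: "\<And>j. j < K \<Longrightarrow> \<delta> / 4 \<le>
      cexp N B (\<lambda>y. of_bool (S (y + n * int j)) - 8 * real k / \<delta> * of_bool (E (y + n * int j))) x"
  shows "\<delta> / 16 \<le> cexp N B (\<lambda>z. of_bool (hit K k \<Omega> n z)) x"
proof -
  define A where "A = {z \<in> ZN N. B x z}"
  have finA: "finite A" unfolding A_def by simp
  have "x mod int N \<in> A"
    unfolding A_def using N ZN_fun_mod(1)[OF zrel_ZN_fun[OF B], of x x] zrelD(1)[OF B, of x] by (simp add: ZN_def)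
  hence A: "A \<noteq> {}" by blast
  hence cA: "0 < real (card A)" using finA by (simp add: card_gt_0_iff)
  have K: "1 \<le> K" using vdw by (simp add: vdw_property_def)
  have sum_e: "(\<Sum>z\<in>A. e z) \<le> \<kappa> / 25 * card A"
    using e cA unfolding cexp_eq_atom_average A_def[symmetric] by (simp only: pos_divide_le_eq)
  have sum_F: "\<delta> / 4 * card A \<le>
      (\<Sum>z\<in>A. of_bool (S (z + n * int j)) - 8 * real k / \<delta> * of_bool (E (z + n * int j)))" if "j < K" for j
    using F[OF that] cA unfolding cexp_eq_atom_average A_def[symmetric] by (simp only: pos_le_divide_eq)
  define good where "good u c \<longleftrightarrow> card (c ` {..<K}) \<le> C0 \<and> (\<forall>i<K. \<forall>j<K. c i = c j \<longrightarrow>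
      (\<Sum>z\<in>A. (cmod (u (z + n * int i) - u (z + n * int j)))\<^sup>2) \<le> \<kappa> * card A)"
    for u :: "int \<Rightarrow> complex" and c :: "nat \<Rightarrow> nat"
  have "\<exists>c. good u c" if u: "u \<in> U" for u
  proof -
    from U(3)[OF u] obtain M' :: real and g :: "nat \<Rightarrow> int \<Rightarrow> complex" and C :: "nat \<Rightarrow> nat \<Rightarrow> int \<Rightarrow> complex"
      where M': "0 \<le> M'" "M' \<le> M" and g: "\<And>s z. cmod (g s z) \<le> 1" and C: "\<And>j s z. cmod (C j s z) \<le> 1"
      and const: "\<And>j s x y. j < K \<Longrightarrow> s < D \<Longrightarrow> B x y \<Longrightarrow> cmod (C j s x - C j s y) \<le> \<rho>"
      and approx: "\<And>j x. j < K \<Longrightarrow>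
        (cmod (u (x + n * int j) - M' * ((\<Sum>s<D. C j s x * g s x) / D)))\<^sup>2 \<le> e x"
      unfolding fibre_structure_def by blast
    show ?thesis unfolding good_def
    proof (rule fibre_colouring[where v = "\<lambda>j z. u (z + n * int j)" and ctr = x and C = C and g = g,
        OF cb finA A D M' \<kappa>(1,3,4) g C])
      fix j s z assume "j < K" "s < D" "z \<in> A"
      thus "cmod (C j s z - C j s x) \<le> \<rho>" using const zrelD(2)[OF B] unfolding A_def by blast
    next
      fix j assume "j < K"
      hence "(\<Sum>z\<in>A. (cmod (u (z + n * int j) - M' * ((\<Sum>s<D. C j s z * g s z) / D)))\<^sup>2) \<le> (\<Sum>z\<in>A. e z)"
        by (intro sum_mono approx)
      thus "(\<Sum>z\<in>A. (cmod (u (z + n * int j) - M' * ((\<Sum>s<D. C j s z * g s z) / D)))\<^sup>2) \<le> \<kappa> / 25 * card A"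
        using sum_e by linarith
    qed
  qed
  then obtain col where good: "\<And>u. u \<in> U \<Longrightarrow> good u (col u)" by metis
  have col: "card (col u ` {..<K}) \<le> C0" if "u \<in> U" for u
    using good[OF that] unfolding good_def by blast
  have close: "(\<Sum>z\<in>A. (cmod (u (z + n * int i) - u (z + n * int j)))\<^sup>2) \<le> \<kappa> * card A"
    if "u \<in> U" "i < K" "j < K" "col u i = col u j" for u i j
    using good[OF that(1)] that(2-4) unfolding good_def by blast
  have "card ((\<lambda>j. restrict (\<lambda>u. col u j) U) ` {..<K}) \<le> C0 ^ m"
    using cb by (intro card_combined_colouring U col) (simp add: colouring_bound_def)
  then obtain a s where as: "1 \<le> s" "s \<le> K" "\<forall>i<k. a + s * i < K"
    and same: "\<forall>i<k. restrict (\<lambda>u. col u (a + s * i)) U = restrict (\<lambda>u. col u a) U"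
    using vdw unfolding vdw_property_def by blast
  have aK: "a < K" using as(3) k by (auto dest: spec[of _ 0])
  have "(\<Sum>z\<in>A. (cmod (u (z + n * int a) - u (z + n * int (a + s * i))))\<^sup>2) \<le> \<kappa> * card A"
    if "u \<in> U" "i < k" for u i
  proof (rule close[OF that(1) aK])
    show "a + s * i < K" using as(3) that(2) by blast
    show "col u a = col u (a + s * i)" using fun_cong[OF same[rule_format, OF that(2)], of u] that(1) by simp
  qed
  hence "\<delta> / 16 * card A \<le> (\<Sum>z\<in>A. of_bool (hit K k \<Omega> n z))"
    by (rule hit_count[OF finA k \<delta> \<epsilon> U(1,2) as _ \<kappa>(1,2) sum_F SU])
  thus ?thesis using cA unfolding cexp_eq_atom_average A_def[symmetric] by (simp only: pos_le_divide_eq)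
qed

section \<open>The inductive step\<close>

lemma member_le_double_sum:
  fixes f :: "'a \<Rightarrow> 'b \<Rightarrow> real"
  assumes "a \<in> A" "b \<in> B" "finite A" "finite B" "\<And>a b. 0 \<le> f a b"
  shows "f a b \<le> (\<Sum>a\<in>A. \<Sum>b\<in>B. f a b)"
proof -
  have "f a b \<le> (\<Sum>b\<in>B. f a b)" using assms by (intro member_le_sum) auto
  also have "\<dots> \<le> (\<Sum>a\<in>A. \<Sum>b\<in>B. f a b)"
    using assms by (intro member_le_sum[of a A "\<lambda>a. \<Sum>b\<in>B. f a b"] sum_nonneg) auto
  finally show ?thesis .
qed

text \<open>A hit at \<open>r\<close> with parameters \<open>a\<close> and \<open>s\<close> is a
  translate of a progression with difference \<open>\<mu> * r * s\<close>. For fixed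
  \<open>s\<close> the products \<open>r * s\<close> are distinct and at most \<open>N1\<close> when
  \<open>r \<le> N1 div K\<close>; the \<open>K\<close> choices each of \<open>a\<close> and
  \<open>s\<close> give the factor \<open>K^2\<close>.\<close>

lemma hit_progression_sum:
  assumes \<Omega>: "\<Omega> \<in> ZN_fun N" and K: "1 \<le> K"
  shows "(\<Sum>r\<le>N1 div K. avg (ZN N) (\<lambda>x. of_bool (hit K k \<Omega> (\<mu> * int r) x)))
    \<le> real K ^ 2 * (\<Sum>r\<le>N1. avg (ZN N) (\<lambda>x. of_bool (\<forall>j<k. \<Omega> (x + \<mu> * int r * int j))))"
proof -
  define h where "h q = avg (ZN N) (\<lambda>x. of_bool (\<forall>j<k. \<Omega> (x + \<mu> * int q * int j)))" for q :: nat
  have h0: "0 \<le> h q" for q unfolding h_def by (intro avg_nonneg) simp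
  have le: "avg (ZN N) (\<lambda>x. of_bool (hit K k \<Omega> (\<mu> * int r) x)) \<le> (\<Sum>a<K. \<Sum>s=1..K. h (r * s))" for r
  proof -
    have "avg (ZN N) (\<lambda>x. of_bool (hit K k \<Omega> (\<mu> * int r) x)) \<le>
      avg (ZN N) (\<lambda>x. \<Sum>a<K. \<Sum>s=1..K. of_bool (\<forall>i<k. \<Omega> (x + \<mu> * int r * int a + \<mu> * int (r * s) * int i)))"
    proof (rule avg_mono)
      fix x
      define f where "f a s = (of_bool (\<forall>i<k. \<Omega> (x + \<mu> * int r * int a + \<mu> * int (r * s) * int i)) :: real)" for a s
      have "of_bool (hit K k \<Omega> (\<mu> * int r) x) \<le> (\<Sum>a<K. \<Sum>s=1..K. f a s)"
      proof (cases "hit K k \<Omega> (\<mu> * int r) x")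
        case True
        then obtain a s where as: "a \<in> {..<K}" "s \<in> {1..K}" "\<forall>i<k. \<Omega> (x + \<mu> * int r * int (a + s * i))"
          unfolding hit_def by blast
        have "x + \<mu> * int r * int (a + s * i) = x + \<mu> * int r * int a + \<mu> * int (r * s) * int i" for i
          by (simp add: algebra_simps)
        hence "f a s = 1" using as(3) unfolding f_def by (simp only: of_bool_eq_1_iff)
        moreover have "f a s \<le> (\<Sum>a<K. \<Sum>s=1..K. f a s)"
          by (rule member_le_double_sum[OF as(1,2)]) (auto simp: f_def)
        ultimately show ?thesis using True by simp
      qed (simp add: sum_nonneg f_def)
      thus "of_bool (hit K k \<Omega> (\<mu> * int r) x) \<le> (\<Sum>a<K. \<Sum>s=1..K.
        of_bool (\<forall>i<k. \<Omega> (x + \<mu> * int r * int a + \<mu> * int (r * s) * int i)) :: real)"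
        unfolding f_def .
    qed
    also have "\<dots> = (\<Sum>a<K. \<Sum>s=1..K. avg (ZN N) (\<lambda>x. of_bool (\<forall>i<k. \<Omega> (x + \<mu> * int r * int a + \<mu> * int (r * s) * int i))))"
      unfolding avg_sum ..
    also have "\<dots> = (\<Sum>a<K. \<Sum>s=1..K. h (r * s))"
    proof (intro sum.cong refl)
      fix a s
      have "(\<lambda>x. \<forall>i<k. \<Omega> (x + \<mu> * int (r * s) * int i)) \<in> ZN_fun N"
        by (rule ZN_fun_Ball) (rule ZN_fun_shift[OF \<Omega>])
      hence "(\<lambda>x. of_bool (\<forall>i<k. \<Omega> (x + \<mu> * int (r * s) * int i)) :: real) \<in> ZN_fun N"
        by (rule ZN_fun_comp)
      from avg_ZN_shift[OF this, of "\<mu> * int r * int a"]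
      show "avg (ZN N) (\<lambda>x. of_bool (\<forall>i<k. \<Omega> (x + \<mu> * int r * int a + \<mu> * int (r * s) * int i))) = h (r * s)"
        unfolding h_def .
    qed
    finally show ?thesis .
  qed
  have dil: "(\<Sum>r\<le>N1 div K. h (r * s)) \<le> (\<Sum>q\<le>N1. h q)" if s: "s \<in> {1..K}" for s
  proof -
    have "inj_on (\<lambda>r. r * s) {..N1 div K}" using s by (intro inj_onI) auto
    hence "(\<Sum>r\<le>N1 div K. h (r * s)) = sum h ((\<lambda>r. r * s) ` {..N1 div K})" by (simp add: sum.reindex)
    also have "\<dots> \<le> (\<Sum>q\<le>N1. h q)"
    proof (intro sum_mono2 h0)
      show "(\<lambda>r. r * s) ` {..N1 div K} \<subseteq> {..N1}"
      proof clarsimp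
        fix r assume "r \<le> N1 div K"
        hence "r * s \<le> (N1 div K) * K" using s by (intro mult_le_mono) auto
        also have "\<dots> \<le> N1" by simp
        finally show "r * s \<le> N1" .
      qed
    qed auto
    finally show ?thesis .
  qed
  have "(\<Sum>r\<le>N1 div K. avg (ZN N) (\<lambda>x. of_bool (hit K k \<Omega> (\<mu> * int r) x)))
    \<le> (\<Sum>r\<le>N1 div K. \<Sum>a<K. \<Sum>s=1..K. h (r * s))" by (intro sum_mono le)
  also have "\<dots> = K * (\<Sum>s=1..K. \<Sum>r\<le>N1 div K. h (r * s))"
    unfolding sum_constant card_lessThan by (subst sum.swap) (simp add: sum_distrib_left)
  also have "\<dots> \<le> K * (\<Sum>s=1..K. \<Sum>q\<le>N1. h q)" using dil by (intro mult_left_mono sum_mono) auto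
  also have "\<dots> = real K ^ 2 * (\<Sum>q\<le>N1. h q)" by (simp add: power2_eq_square)
  finally show ?thesis unfolding h_def .
qed

text \<open>
  The coefficient of \<open>E\<close> makes a single inequality for \<open>test\<close> bound the density of \<open>S\<close> in an
  atom from below and that of \<open>E\<close> from above.
\<close>

definition test :: "nat \<Rightarrow> real \<Rightarrow> (int \<Rightarrow> bool) \<Rightarrow> (int \<Rightarrow> bool) \<Rightarrow> int \<Rightarrow> real" where
  "test k \<delta> S E x = of_bool (S x) - 8 * real k / \<delta> * of_bool (E x)"

lemma test_bounds:
  assumes "0 < \<delta>" shows "test k \<delta> S E x \<le> 1" "\<bar>test k \<delta> S E x\<bar> \<le> 1 + 8 * real k / \<delta>"
proof -
  define t where "t = 8 * real k / \<delta>"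
  have "0 \<le> t" using assms by (simp add: t_def)
  thus "test k \<delta> S E x \<le> 1" "\<bar>test k \<delta> S E x\<bar> \<le> 1 + 8 * real k / \<delta>"
    unfolding test_def t_def[symmetric] by (cases "S x"; cases "E x"; simp)+
qed

text \<open>Chebyshev's inequality for the change of the conditional expectation, whose mean square
  is the difference of the energies.\<close>

lemma energy_increment_deviation:
  assumes R: "zrel N R" and R': "zrel N R'" and le: "R' \<le> R" and N: "0 < N" and t: "0 < t"
    and en: "energy N f R' \<le> energy N f R + t\<^sup>2 * \<epsilon>"
  shows "avg (ZN N) (\<lambda>x. of_bool (t \<le> \<bar>cexp N R' f x - cexp N R f x\<bar>)) \<le> \<epsilon>"
proof -
  have "avg (ZN N) (\<lambda>x. of_bool (t \<le> \<bar>cexp N R' f x - cexp N R f x\<bar>)) \<le> (energy N f R' - energy N f R) / t\<^sup>2"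
    using markov_avg_square[OF t, of "ZN N" "\<lambda>x. cexp N R' f x - cexp N R f x"]
    unfolding energy_diff[OF R R' le N] .
  also have "\<dots> \<le> t\<^sup>2 * \<epsilon> / t\<^sup>2" using en by (intro divide_right_mono) auto
  finally show ?thesis using t by simp
qed

text \<open>Stability is used once for each \<open>j < K\<close>, on \<open>B\<close> shifted back
  by \<open>n * j\<close>. A deviation below \<open>\<delta> / 16\<close> turns the level
  \<open>5/16 * \<delta>\<close> into the \<open>\<delta> / 4\<close> required on an atom, and
  larger ones cost density \<open>c / (4 * K)\<close> for each \<open>j\<close>; large sampling
  errors cost another \<open>c / 4\<close>. The total loss \<open>c / 2\<close> is half of what
  recurrence supplies.\<close>

lemma hit_lower_bound:
  fixes \<kappa> \<delta> \<epsilon> \<eta> \<rho> M c :: real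
  assumes N: "0 < N" and k: "1 \<le> k" and \<delta>: "0 < \<delta>" and \<epsilon>: "0 < \<epsilon>" and D: "1 \<le> D" and \<rho>: "0 < \<rho>"
    and S: "S \<in> ZN_fun N" "E \<in> ZN_fun N"
    and U: "U \<subseteq> UAP_ball N (Suc d) M" "finite U" "card U \<le> m"
    and SU: "\<And>x y. S x \<Longrightarrow> (\<forall>u\<in>U. cmod (u x - u y) \<le> \<epsilon>) \<Longrightarrow> \<Omega> y \<or> E y"
    and cb: "colouring_bound \<eta> C0" and vdw: "vdw_property k (C0 ^ m) K"
    and \<kappa>: "0 < \<kappa>" "\<kappa> * (real m * real k) \<le> \<epsilon>\<^sup>2 * (\<delta> / 16)" "M\<^sup>2 * \<eta> \<le> \<kappa> / 25" "M\<^sup>2 * \<rho>\<^sup>2 \<le> \<kappa> / 25"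
    and R: "zrel N R"
    and stab: "stable d \<rho> (K + m * K * D) ((\<delta> / 16)\<^sup>2 * (c / (4 * real K))) N (test k \<delta> S E) R"
    and Dc: "m * (K * M\<^sup>2 / D) \<le> \<kappa> / 25 * (c / 4)"
  shows "\<delta> / 16 * (avg (ZN N) (\<lambda>x. of_bool (\<forall>j<K. 5 / 16 * \<delta> \<le> cexp N R (test k \<delta> S E) (x + n * int j))) - c / 2)
    \<le> avg (ZN N) (\<lambda>x. of_bool (hit K k \<Omega> n x))"
proof -
  define F where "F = test k \<delta> S E"
  have K: "1 \<le> K" using vdw by (simp add: vdw_property_def)
  have FZ: "F \<in> ZN_fun N" unfolding F_def test_def by (rule ZN_fun_comp2[OF S])
  obtain B e where B: "zrel N B" and e0: "\<And>x. 0 \<le> e x" and e: "avg (ZN N) e \<le> m * (K * M\<^sup>2 / D)"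
    and BR: "\<And>j. j < K \<Longrightarrow> (N, shift_rel (- (n * int j)) B) \<in> join_class (K + m * K * D) (insert (N, R) (grids d \<rho>))"
      "\<And>j. j < K \<Longrightarrow> shift_rel (- (n * int j)) B \<le> R"
    and fs: "\<And>u. u \<in> U \<Longrightarrow> fibre_structure N M \<rho> K D n B e u"
    using fibre_relation[OF N U \<rho> D R, of K n] by blast
  define nice where "nice x \<longleftrightarrow> (\<forall>j<K. \<delta> / 4 \<le> cexp N B (\<lambda>y. F (y + n * int j)) x) \<and> cexp N B e x \<le> \<kappa> / 25" for x
  define dev where "dev j x = \<bar>cexp N (shift_rel (- (n * int j)) B) F x - cexp N R F x\<bar>" for j x
  have dev: "avg (ZN N) (\<lambda>x. of_bool (\<delta> / 16 \<le> dev j (x + n * int j))) \<le> c / (4 * real K)" if j: "j < K" for j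
  proof -
    have zs: "zrel N (shift_rel (- (n * int j)) B)" by (rule zrel_shift[OF B])
    have "energy N F (shift_rel (- (n * int j)) B) \<le> energy N F R + (\<delta> / 16)\<^sup>2 * (c / (4 * real K))"
      unfolding F_def by (rule mp[OF mp[OF spec[OF stab[unfolded stable_def]] BR(1)[OF j]] BR(2)[OF j]])
    moreover have "0 < \<delta> / 16" using \<delta> by simp
    ultimately have "avg (ZN N) (\<lambda>x. of_bool (\<delta> / 16 \<le> dev j x)) \<le> c / (4 * real K)"
      unfolding dev_def by (intro energy_increment_deviation[OF R zs BR(2)[OF j] N])
    moreover have "(\<lambda>x. of_bool (\<delta> / 16 \<le> dev j x) :: real) \<in> ZN_fun N"
      unfolding dev_def by (rule ZN_fun_comp2[OF cexp_ZN_fun[OF zs] cexp_ZN_fun[OF R]])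
    ultimately show ?thesis
      using avg_ZN_shift[of "\<lambda>x. of_bool (\<delta> / 16 \<le> dev j x)" N "n * int j"] by linarith
  qed
  have devs: "(\<Sum>j<K. avg (ZN N) (\<lambda>x. of_bool (\<delta> / 16 \<le> dev j (x + n * int j)))) \<le> c / 4"
  proof -
    have "(\<Sum>j<K. avg (ZN N) (\<lambda>x. of_bool (\<delta> / 16 \<le> dev j (x + n * int j)))) \<le> (\<Sum>j<K. c / (4 * real K))"
      by (intro sum_mono dev) simp
    also have "\<dots> = c / 4" using K by simp
    finally show ?thesis .
  qed
  have "avg (ZN N) (\<lambda>x. of_bool (\<kappa> / 25 \<le> cexp N B e x)) \<le> avg (ZN N) (cexp N B e) / (\<kappa> / 25)"
    using \<kappa>(1) e0 by (intro markov_avg) (auto simp: cexp_def intro!: divide_nonneg_nonneg sum_nonneg)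
  also have "\<dots> = avg (ZN N) e / (\<kappa> / 25)" by (simp only: avg_cexp[OF B N])
  also have "\<dots> \<le> (\<kappa> / 25 * (c / 4)) / (\<kappa> / 25)"
    using order_trans[OF e Dc] \<kappa>(1) by (intro divide_right_mono) auto
  also have "\<dots> = c / 4" using \<kappa>(1) by simp
  finally have bad_e: "avg (ZN N) (\<lambda>x. of_bool (\<kappa> / 25 \<le> cexp N B e x)) \<le> c / 4" .
  have "avg (ZN N) (\<lambda>x. of_bool (\<forall>j<K. 5 / 16 * \<delta> \<le> cexp N R F (x + n * int j)))
    \<le> avg (ZN N) (\<lambda>x. of_bool (nice x) + (\<Sum>j<K. of_bool (\<delta> / 16 \<le> dev j (x + n * int j)))
        + of_bool (\<kappa> / 25 \<le> cexp N B e x))"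
  proof (rule avg_mono)
    fix x
    let ?d = "\<Sum>j<K. of_bool (\<delta> / 16 \<le> dev j (x + n * int j)) :: real"
    have d0: "0 \<le> ?d" by (intro sum_nonneg) simp
    show "of_bool (\<forall>j<K. 5 / 16 * \<delta> \<le> cexp N R F (x + n * int j)) \<le>
        of_bool (nice x) + ?d + of_bool (\<kappa> / 25 \<le> cexp N B e x)"
    proof (cases "(\<forall>j<K. 5 / 16 * \<delta> \<le> cexp N R F (x + n * int j)) \<and> \<not> nice x \<and> \<not> \<kappa> / 25 \<le> cexp N B e x")
      case True
      then obtain j where j: "j < K" "cexp N B (\<lambda>y. F (y + n * int j)) x < \<delta> / 4"
        unfolding nice_def by (auto simp: not_le)
      have "5 / 16 * \<delta> \<le> cexp N R F (x + n * int j)" using True j(1) by blast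
      hence "\<delta> / 16 \<le> dev j (x + n * int j)"
        using j(2) unfolding cexp_shift[OF B FZ] dev_def by linarith
      hence "1 \<le> ?d"
        using j(1) member_le_sum[of j "{..<K}" "\<lambda>j. of_bool (\<delta> / 16 \<le> dev j (x + n * int j)) :: real"] by simp
      thus ?thesis using True by simp
    qed (use d0 in auto)
  qed
  hence nice: "avg (ZN N) (\<lambda>x. of_bool (\<forall>j<K. 5 / 16 * \<delta> \<le> cexp N R F (x + n * int j))) - c / 2
      \<le> avg (ZN N) (\<lambda>x. of_bool (nice x))"
    using devs bad_e unfolding avg_add avg_sum by linarith
  have hit_nice: "\<delta> / 16 * of_bool (nice x) \<le> cexp N B (\<lambda>z. of_bool (hit K k \<Omega> n z)) x" for x
  proof (cases "nice x")
    case True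
    have "\<delta> / 16 \<le> cexp N B (\<lambda>z. of_bool (hit K k \<Omega> n z)) x"
      using True unfolding nice_def F_def test_def
      by (intro fibre_hit[OF N B k \<delta> \<epsilon> D U(2,3) fs cb vdw _ \<kappa>(2-4) SU]) (use \<kappa>(1) in auto)
    thus ?thesis using True by simp
  next
    case False
    thus ?thesis by (auto simp: cexp_def intro!: divide_nonneg_nonneg sum_nonneg)
  qed
  have "\<delta> / 16 * (avg (ZN N) (\<lambda>x. of_bool (\<forall>j<K. 5 / 16 * \<delta> \<le> cexp N R F (x + n * int j))) - c / 2)
    \<le> \<delta> / 16 * avg (ZN N) (\<lambda>x. of_bool (nice x))" using nice \<delta> by (intro mult_left_mono) auto
  also have "\<dots> = avg (ZN N) (\<lambda>x. \<delta> / 16 * of_bool (nice x))" by (simp only: avg_cmult)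
  also have "\<dots> \<le> avg (ZN N) (cexp N B (\<lambda>z. of_bool (hit K k \<Omega> n z)))" by (intro avg_mono hit_nice)
  also have "\<dots> = avg (ZN N) (\<lambda>z. of_bool (hit K k \<Omega> n z))" by (rule avg_cexp[OF B N])
  finally show ?thesis unfolding F_def .
qed

text \<open>The levels \<open>3/8\<close>, \<open>5/16\<close> and \<open>1/4\<close> of \<delta>
  leave a margin of \<open>\<delta> / 16\<close> for each of the two changes of partition, from
  \<open>R\<close> to \<open>R'\<close> and from \<open>R'\<close> to the shifts of
  \<open>B\<close>. In the final constant, \<open>\<delta> / 16\<close> times \<open>c / 2\<close>
  comes from \<open>hit_lower_bound\<close>, \<open>K^2\<close> from the choice of a progression
  among the \<open>K\<close> shifts, and one more \<open>K\<close> from passing from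
  \<open>N1 div K\<close> to \<open>N1\<close>.\<close>

lemma main_step:
  fixes \<kappa> \<delta> \<epsilon> \<eta> \<rho> M c :: real
  assumes conf: "config N (Suc d) k \<delta> m \<epsilon> M S \<Omega> E"
    and k: "1 \<le> k" and \<delta>: "0 < \<delta>" and \<epsilon>: "0 < \<epsilon>" and D: "1 \<le> D" and \<rho>: "0 < \<rho>"
    and cb: "colouring_bound \<eta> C0" and vdw: "vdw_property k (C0 ^ m) K"
    and \<kappa>: "0 < \<kappa>" "\<kappa> * (real m * real k) \<le> \<epsilon>\<^sup>2 * (\<delta> / 16)" "M\<^sup>2 * \<eta> \<le> \<kappa> / 25" "M\<^sup>2 * \<rho>\<^sup>2 \<le> \<kappa> / 25"
    and R: "(N, R) \<in> \<K>" "zrel N R" and R': "zrel N R'" "R' \<le> R"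
    and rc: "recurrent_class \<K> K (\<delta> / 8) c" and c: "0 < c"
    and gap: "energy N (test k \<delta> S E) R' \<le> energy N (test k \<delta> S E) R + (\<delta> / 16)\<^sup>2 * ((\<delta> / 8)\<^sup>2 / (64 * real K))"
    and stab: "stable d \<rho> (K + m * K * D) ((\<delta> / 16)\<^sup>2 * (c / (4 * real K))) N (test k \<delta> S E) R'"
    and Dc: "m * (K * M\<^sup>2 / D) \<le> \<kappa> / 25 * (c / 4)"
  shows "\<delta> * c / (32 * real K ^ 3) \<le> ret N k \<Omega> \<mu> N1"
proof -
  define F where "F = test k \<delta> S E"
  have K: "1 \<le> K" using vdw by (simp add: vdw_property_def)
  from conf have N: "0 < N" and Z: "S \<in> ZN_fun N" "\<Omega> \<in> ZN_fun N" "E \<in> ZN_fun N"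
    and S1: "\<delta> \<le> avg (ZN N) (\<lambda>x. of_bool (S x))"
    and E1: "avg (ZN N) (\<lambda>x. of_bool (E x)) \<le> \<delta>\<^sup>2 / (16 * real k)"
    unfolding config_def by auto
  from conf obtain U where U: "U \<subseteq> UAP_ball N (Suc d) M" "finite U" "card U \<le> m"
    and SU: "\<And>x y. S x \<Longrightarrow> (\<forall>u\<in>U. cmod (u x - u y) \<le> \<epsilon>) \<Longrightarrow> \<Omega> y \<or> E y"
    unfolding config_def by blast
  define W where "W x \<longleftrightarrow> 3 / 8 * \<delta> \<le> cexp N R F x" for x
  define \<Omega>' where "\<Omega>' x \<longleftrightarrow> 5 / 16 * \<delta> \<le> cexp N R' F x" for x
  have avgF: "\<delta> / 2 \<le> avg (ZN N) F"
  proof -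
    have "avg (ZN N) F = avg (ZN N) (\<lambda>x. of_bool (S x)) - 8 * real k / \<delta> * avg (ZN N) (\<lambda>x. of_bool (E x))"
      unfolding F_def test_def avg_diff avg_cmult ..
    moreover have "8 * real k / \<delta> * avg (ZN N) (\<lambda>x. of_bool (E x)) \<le> 8 * real k / \<delta> * (\<delta>\<^sup>2 / (16 * real k))"
      using E1 \<delta> by (intro mult_left_mono) auto
    moreover have "8 * real k / \<delta> * (\<delta>\<^sup>2 / (16 * real k)) = \<delta> / 2"
      using \<delta> k by (simp add: power2_eq_square field_simps)
    ultimately show ?thesis using S1 by linarith
  qed
  \<comment> \<open>Since \<open>F\<close> is at most 1, a mean of \<open>\<delta> / 2\<close>
    forces the level \<open>3/8 * \<delta>\<close> to be reached on density
    \<open>\<delta> / 8\<close>.\<close>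
  have W1: "\<delta> / 8 \<le> avg (ZN N) (\<lambda>x. of_bool (W x))"
  proof -
    have "cexp N R F x \<le> of_bool (W x) + 3 / 8 * \<delta>" for x
      using cexp_le[OF R(2) N, of F 1 x] test_bounds(1)[OF \<delta>] \<delta> by (cases "W x") (auto simp: F_def W_def)
    hence "avg (ZN N) (cexp N R F) \<le> avg (ZN N) (\<lambda>x. of_bool (W x) + 3 / 8 * \<delta>)" by (intro avg_mono)
    also have "\<dots> = avg (ZN N) (\<lambda>x. of_bool (W x)) + 3 / 8 * \<delta>"
      unfolding avg_add avg_ZN_const[OF N] ..
    finally show ?thesis using avgF avg_cexp[OF R(2) N, of F] by simp
  qed
  have "avg (ZN N) (\<lambda>x. of_bool (W x \<and> \<not> \<Omega>' x)) \<le>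
      avg (ZN N) (\<lambda>x. of_bool (\<delta> / 16 \<le> \<bar>cexp N R' F x - cexp N R F x\<bar>))"
  proof (rule avg_mono)
    fix x
    have "\<delta> / 16 \<le> \<bar>cexp N R' F x - cexp N R F x\<bar>" if "W x" "\<not> \<Omega>' x"
      using that unfolding W_def \<Omega>'_def by linarith
    thus "of_bool (W x \<and> \<not> \<Omega>' x) \<le> (of_bool (\<delta> / 16 \<le> \<bar>cexp N R' F x - cexp N R F x\<bar>) :: real)"
      by (simp only: of_bool_less_eq_iff) blast
  qed
  also have "\<dots> \<le> (\<delta> / 8)\<^sup>2 / (64 * real K)"
    by (rule energy_increment_deviation[OF R(2) R' N]) (use \<delta> gap in \<open>simp_all add: F_def\<close>)
  finally have W2: "avg (ZN N) (\<lambda>x. of_bool (W x \<and> \<not> \<Omega>' x)) \<le> (\<delta> / 8)\<^sup>2 / (64 * real K)" .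
  have "\<Omega>' \<in> ZN_fun N" unfolding \<Omega>'_def by (rule ZN_fun_comp[OF cexp_ZN_fun[OF R'(1)]])
  moreover have "\<forall>x y. R x y \<longrightarrow> W x = W y" unfolding W_def using cexp_cong[OF R(2)] by metis
  ultimately have ret: "c \<le> ret N K \<Omega>' \<mu> (N1 div K)"
    using rc R(1) W1 W2 unfolding recurrent_class_def by blast
  define p where "p r = avg (ZN N) (\<lambda>x. of_bool (\<forall>j<K. \<Omega>' (x + \<mu> * int r * int j)))" for r :: nat
  define h where "h r = avg (ZN N) (\<lambda>x. of_bool (hit K k \<Omega> (\<mu> * int r) x))" for r :: nat
  define T where "T = real (N1 div K) + 1"
  have T0: "0 < T" by (simp add: T_def)
  have ph: "\<delta> / 16 * (p r - c / 2) \<le> h r" for r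
    unfolding p_def h_def \<Omega>'_def F_def
    by (rule hit_lower_bound[OF N k \<delta> \<epsilon> D \<rho> Z(1,3) U SU cb vdw \<kappa> R'(1) stab Dc])
  have "c * T \<le> (\<Sum>r\<le>N1 div K. p r)"
    using ret T0 unfolding ret_def p_def T_def by (simp only: pos_le_divide_eq)
  hence "\<delta> / 16 * (c * T - T * (c / 2)) \<le> \<delta> / 16 * ((\<Sum>r\<le>N1 div K. p r) - T * (c / 2))"
    using \<delta> by (intro mult_left_mono diff_right_mono) auto
  also have "\<dots> = (\<Sum>r\<le>N1 div K. \<delta> / 16 * (p r - c / 2))"
    unfolding sum_distrib_left[symmetric] sum_subtractf by (simp add: T_def add.commute)
  also have "\<dots> \<le> (\<Sum>r\<le>N1 div K. h r)" by (intro sum_mono ph)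
  also have "\<dots> \<le> real K ^ 2 * (\<Sum>r\<le>N1. avg (ZN N) (\<lambda>x. of_bool (\<forall>j<k. \<Omega> (x + \<mu> * int r * int j))))"
    unfolding h_def by (rule hit_progression_sum[OF Z(2) K])
  also have "\<dots> = real K ^ 2 * (ret N k \<Omega> \<mu> N1 * (real N1 + 1))" by (simp add: ret_def)
  finally have le: "\<delta> * c / 32 * T \<le> real K ^ 2 * (ret N k \<Omega> \<mu> N1 * (real N1 + 1))"
    by (simp add: algebra_simps)
  have "N1 < (N1 div K + 1) * K"
    using K dividend_less_times_div[of K N1] by (simp add: mult.commute)
  hence "N1 + 1 \<le> (N1 div K + 1) * K" by simp
  hence "real (N1 + 1) \<le> real ((N1 div K + 1) * K)" by (simp only: of_nat_le_iff)
  hence "real N1 + 1 \<le> T * K" by (simp add: T_def algebra_simps)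
  hence "\<delta> * c / 32 * (real N1 + 1) \<le> \<delta> * c / 32 * (T * K)" using \<delta> c by (intro mult_left_mono) auto
  also have "\<dots> = \<delta> * c / 32 * T * K" by simp
  also have "\<dots> \<le> real K ^ 2 * (ret N k \<Omega> \<mu> N1 * (real N1 + 1)) * K" using le by (rule mult_right_mono) simp
  also have "\<dots> = (real K ^ 3 * ret N k \<Omega> \<mu> N1) * (real N1 + 1)" by (simp add: power2_eq_square power3_eq_cube)
  finally have "\<delta> * c / 32 \<le> real K ^ 3 * ret N k \<Omega> \<mu> N1" by (rule mult_right_le_imp_le) simp
  thus ?thesis using K by (simp add: field_simps)
qed

text \<open>The number of colours, the length \<open>K\<close> and the increment \<epsilon>0 are
  fixed once. A class of partitions then determines \<open>c\<close>, this determines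
  \<open>D\<close> and the stability threshold, and these determine the next class. The iteration
  ends because each failed energy comparison gains \<epsilon>0.\<close>

lemma recurrent_Suc:
  assumes rec: "recurrent d" shows "recurrent (Suc d)"
  unfolding recurrent_def
proof (intro allI impI)
  fix k m :: nat and \<delta> \<epsilon> M :: real
  assume k: "1 \<le> k" and \<delta>: "0 < \<delta>" and \<epsilon>: "0 < \<epsilon>" and M: "0 < M"
  \<comment> \<open>\<open>Suc m\<close> keeps the quotient meaningful for \<open>m = 0\<close>. The
    values of \<eta> and \<rho> are such that the colour error and the freezing error are both
    \<open>\<kappa> / 25\<close> after multiplication by \<open>M\<^sup>2\<close>.\<close>
  define \<kappa> where "\<kappa> = \<epsilon>\<^sup>2 * (\<delta> / 16) / (real (Suc m) * real k)"
  define \<eta> where "\<eta> = \<kappa> / (25 * M\<^sup>2)"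
  define \<rho> where "\<rho> = sqrt (\<kappa> / 25) / M"
  have \<kappa>0: "0 < \<kappa>" using k \<delta> \<epsilon> by (simp add: \<kappa>_def)
  have "\<kappa> * (real m * real k) \<le> \<kappa> * (real (Suc m) * real k)"
    using \<kappa>0 by (intro mult_left_mono mult_right_mono) auto
  also have "\<dots> = \<epsilon>\<^sup>2 * (\<delta> / 16)"
    unfolding \<kappa>_def using k by (intro nonzero_eq_divide_eq[THEN iffD1, OF _ refl]) simp
  finally have \<kappa>1: "\<kappa> * (real m * real k) \<le> \<epsilon>\<^sup>2 * (\<delta> / 16)" .
  have \<kappa>2: "M\<^sup>2 * \<eta> \<le> \<kappa> / 25" using M by (simp add: \<eta>_def)
  have \<kappa>3: "M\<^sup>2 * \<rho>\<^sup>2 \<le> \<kappa> / 25" using M \<kappa>0 by (simp add: \<rho>_def power_divide)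
  have \<rho>: "0 < \<rho>" using M \<kappa>0 by (simp add: \<rho>_def)
  have "0 < \<eta>" using M \<kappa>0 by (simp add: \<eta>_def)
  then obtain C0 where cb: "colouring_bound \<eta> C0" using colouring_bound_exists by blast
  have "\<exists>K. vdw_property k (C0 ^ m) K"
    unfolding vdw_property_def by (rule van_der_Waerden[OF k])
  then obtain K where vdw: "vdw_property k (C0 ^ m) K" ..
  hence K: "1 \<le> K" by (simp add: vdw_property_def)
  define B where "B = 1 + 8 * real k / \<delta>"
  \<comment> \<open>With this gap, the set where the two conditional expectations differ by at least
    \<open>\<delta> / 16\<close> has at most the density that \<open>recurrent_class\<close>
    tolerates for sets of density \<open>\<delta> / 8\<close>.\<close>
  define \<epsilon>0 where "\<epsilon>0 = (\<delta> / 16)\<^sup>2 * ((\<delta> / 8)\<^sup>2 / (64 * real K))"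
  have \<epsilon>0: "0 < \<epsilon>0" using \<delta> K by (simp add: \<epsilon>0_def)
  have FB: "\<forall>x. \<bar>test k \<delta> S E x\<bar> \<le> B" for S E
    using test_bounds(2)[OF \<delta>] by (simp add: B_def)
  \<comment> \<open>The energy hypothesis says that fewer than \<open>T\<close> increments by
    \<epsilon>0 are still possible, which makes the case 0 vacuous.\<close>
  have *: "\<exists>c>0. \<forall>N S \<Omega> E \<mu> N1 R. config N (Suc d) k \<delta> m \<epsilon> M S \<Omega> E \<longrightarrow> (N, R) \<in> \<K> \<longrightarrow>
     B\<^sup>2 < energy N (test k \<delta> S E) R + real T * \<epsilon>0 \<longrightarrow> c \<le> ret N k \<Omega> \<mu> N1" if "tame d \<K>" for T \<K>
    using that
  proof (induction T arbitrary: \<K>)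
    case 0
    have "energy N (test k \<delta> S E) R \<le> B\<^sup>2" if "(N, R) \<in> \<K>" for N S E R
    proof (rule energy_bounds(2))
      show "zrel N R" "0 < N" using 0 that unfolding tame_def by auto
      show "\<bar>test k \<delta> S E x\<bar> \<le> B" for x using FB by blast
    qed
    hence "\<not> B\<^sup>2 < energy N (test k \<delta> S E) R + real 0 * \<epsilon>0" if "(N, R) \<in> \<K>" for N S E R
      using that by (simp add: not_less)
    thus ?case using zero_less_one by blast
  next
    case (Suc T)
    have "0 < \<delta> / 8" using \<delta> by simp
    then obtain c where c: "0 < c" and rc: "recurrent_class \<K> K (\<delta> / 8) c"
      using tame_recurrent[OF rec Suc.prems K] by blast
    define D where "D = Suc (nat \<lceil>real m * (real K * M\<^sup>2) / (\<kappa> / 25 * (c / 4))\<rceil>)"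
    have D: "1 \<le> D" by (simp add: D_def)
    have q0: "0 < \<kappa> / 25 * (c / 4)" using \<kappa>0 c by simp
    have "real m * (real K * M\<^sup>2) / (\<kappa> / 25 * (c / 4)) \<le> real D"
      unfolding D_def by linarith
    hence "real m * (real K * M\<^sup>2) \<le> real D * (\<kappa> / 25 * (c / 4))"
      using q0 by (simp only: pos_divide_le_eq)
    hence "real m * (real K * M\<^sup>2) / real D \<le> \<kappa> / 25 * (c / 4)"
      using D by (simp add: pos_divide_le_eq mult.commute)
    hence Dc: "m * (K * M\<^sup>2 / D) \<le> \<kappa> / 25 * (c / 4)" by (simp only: times_divide_eq_right)
    define \<epsilon>' where "\<epsilon>' = (\<delta> / 16)\<^sup>2 * (c / (4 * real K))"
    have \<epsilon>': "0 < \<epsilon>'" using \<delta> c K by (simp add: \<epsilon>'_def)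
    obtain \<K>' where \<K>': "tame d \<K>'" and stab: "\<And>N R F. (N, R) \<in> \<K> \<Longrightarrow> (\<forall>x. \<bar>F x\<bar> \<le> B) \<Longrightarrow>
        \<exists>R'. (N, R') \<in> \<K>' \<and> R' \<le> R \<and> stable d \<rho> (K + m * K * D) \<epsilon>' N F R'"
      using stable_refinement[OF \<rho> \<epsilon>' Suc.prems, of B "K + m * K * D"] by blast
    obtain c' where c': "0 < c'" and IH: "\<And>N S \<Omega> E \<mu> N1 R. config N (Suc d) k \<delta> m \<epsilon> M S \<Omega> E \<Longrightarrow> (N, R) \<in> \<K>' \<Longrightarrow>
       B\<^sup>2 < energy N (test k \<delta> S E) R + real T * \<epsilon>0 \<Longrightarrow> c' \<le> ret N k \<Omega> \<mu> N1"
      using Suc.IH[OF \<K>'] by blast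
    define c'' where "c'' = min c' (\<delta> * c / (32 * real K ^ 3))"
    have c'': "0 < c''" using c c' \<delta> K by (simp add: c''_def)
    have "c'' \<le> ret N k \<Omega> \<mu> N1"
      if conf: "config N (Suc d) k \<delta> m \<epsilon> M S \<Omega> E" and R: "(N, R) \<in> \<K>"
        and en: "B\<^sup>2 < energy N (test k \<delta> S E) R + real (Suc T) * \<epsilon>0" for N S \<Omega> E \<mu> N1 R
    proof -
      obtain R' where R': "(N, R') \<in> \<K>'" "R' \<le> R" and st: "stable d \<rho> (K + m * K * D) \<epsilon>' N (test k \<delta> S E) R'"
        using stab[OF R FB] by blast
      have z: "zrel N R" "zrel N R'" using R R'(1) Suc.prems \<K>' unfolding tame_def by auto
      show ?thesis
      proof (cases "energy N (test k \<delta> S E) R' \<le> energy N (test k \<delta> S E) R + \<epsilon>0")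
        case True
        have "\<delta> * c / (32 * real K ^ 3) \<le> ret N k \<Omega> \<mu> N1"
          by (rule main_step[OF conf k \<delta> \<epsilon> D \<rho> cb vdw \<kappa>0 \<kappa>1 \<kappa>2 \<kappa>3 R z R'(2) rc c
              True[unfolded \<epsilon>0_def] st[unfolded \<epsilon>'_def] Dc])
        thus ?thesis by (simp add: c''_def)
      next
        case False
        hence "B\<^sup>2 < energy N (test k \<delta> S E) R' + real T * \<epsilon>0" using en by (simp add: algebra_simps)
        from IH[OF conf R'(1) this, of \<mu> N1] show ?thesis by (simp add: c''_def)
      qed
    qed
    thus ?case using c'' by blast
  qed
  obtain T :: nat where T: "B\<^sup>2 < real T * \<epsilon>0" using reals_Archimedean3[OF \<epsilon>0] by blast
  obtain c where c: "0 < c" and main: "\<And>N S \<Omega> E \<mu> N1 R. config N (Suc d) k \<delta> m \<epsilon> M S \<Omega> E \<Longrightarrow>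
      (N, R) \<in> {(N, \<lambda>_ _. True) | N. 0 < N} \<Longrightarrow>
      B\<^sup>2 < energy N (test k \<delta> S E) R + real T * \<epsilon>0 \<Longrightarrow> c \<le> ret N k \<Omega> \<mu> N1"
    using *[OF tame_trivial, of T] by blast
  have "c \<le> ret N k \<Omega> \<mu> N1" if conf: "config N (Suc d) k \<delta> m \<epsilon> M S \<Omega> E" for N S \<Omega> E \<mu> N1
  proof (rule main[OF conf, of "\<lambda>_ _. True"])
    have N: "0 < N" using conf by (simp add: config_def)
    thus "(N, \<lambda>_ _. True) \<in> {(N, \<lambda>_ _. True) | N. 0 < N}" by blast
    have "0 \<le> energy N (test k \<delta> S E) (\<lambda>_ _. True)"
      unfolding energy_def by (intro avg_nonneg) simp
    thus "B\<^sup>2 < energy N (test k \<delta> S E) (\<lambda>_ _. True) + real T * \<epsilon>0" using T by linarith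
  qed
  thus "\<exists>c>0. \<forall>N S \<Omega> E \<mu> N1. config N (Suc d) k \<delta> m \<epsilon> M S \<Omega> E \<longrightarrow> c \<le> ret N k \<Omega> \<mu> N1"
    using c by blast
qed

section \<open>Deduction of the theorem\<close>

lemma recurrent: "recurrent d"
  by (induction d) (auto intro: recurrent_0 recurrent_Suc)

text \<open>From the level \<open>\<delta> / 2\<close> of \<open>fUAP\<close>, a change by at most
  \<open>\<delta> / 4\<close> and an approximation error below \<open>\<delta> / 8\<close> leave
  \<open>\<delta> / 8\<close> for \<open>fU\<close>. Chebyshev's inequality bounds the density of
  larger errors by \<open>\<delta>^2 / (16384 k^2)\<close>. The only almost periodic function
  involved is \<open>fUAP\<close>, so \<open>m = 1\<close>.\<close>

lemma config_of_approximation: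
  fixes fU fUAP :: "int \<Rightarrow> real"
  assumes k: "1 \<le> k" and \<delta>: "0 < \<delta>" and N: "0 < N"
    and fU: "fU \<in> ZN_fun N" "\<And>x. fU x \<in> {0..1}" and fUAP: "fUAP \<in> ZN_fun N"
    and L2: "L2_norm N (\<lambda>x. fU x - fUAP x) \<le> \<delta>\<^sup>2 / (1024 * real k)"
    and avg: "\<delta> \<le> avg (ZN N) fU"
    and norm: "UAP_pow_norm N d (\<lambda>x. complex_of_real (fUAP x)) < ennreal M"
  shows "config N d k (\<delta> / 4) 1 (\<delta> / 4) M (\<lambda>x. \<delta> / 2 \<le> fUAP x) (\<lambda>x. \<delta> / 8 \<le> fU x)
    (\<lambda>x. \<delta> / 8 \<le> \<bar>fU x - fUAP x\<bar>)"
proof -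
  let ?S = "\<lambda>x. \<delta> / 2 \<le> fUAP x" and ?E = "\<lambda>x. \<delta> / 8 \<le> \<bar>fU x - fUAP x\<bar>"
  define \<tau> where "\<tau> = \<delta>\<^sup>2 / (1024 * real k)"
  have "avg (ZN N) fU \<le> avg (ZN N) (\<lambda>_. 1)" using fU(2) by (intro avg_mono) simp
  hence \<delta>1: "\<delta> \<le> 1" using avg N by (simp add: avg_ZN_const)
  have d2: "avg (ZN N) (\<lambda>x. (fU x - fUAP x)\<^sup>2) \<le> \<tau>\<^sup>2"
  proof -
    have "0 \<le> avg (ZN N) (\<lambda>x. (fU x - fUAP x)\<^sup>2)" by (intro avg_nonneg) simp
    moreover have "sqrt (avg (ZN N) (\<lambda>x. (fU x - fUAP x)\<^sup>2)) \<le> \<tau>"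
      using L2 by (simp add: L2_norm_def \<tau>_def)
    moreover have "0 \<le> \<tau>" using k by (simp add: \<tau>_def)
    ultimately show ?thesis by (simp add: real_sqrt_le_iff' sqrt_le_D)
  qed
  have "0 < \<delta> / 8" using \<delta> by simp
  from markov_avg_square[OF this, of "ZN N" "\<lambda>x. fU x - fUAP x"]
  have "avg (ZN N) (\<lambda>x. of_bool (?E x)) \<le> avg (ZN N) (\<lambda>x. (fU x - fUAP x)\<^sup>2) / (\<delta> / 8)\<^sup>2" .
  also have "\<dots> \<le> \<tau>\<^sup>2 / (\<delta> / 8)\<^sup>2" using d2 by (intro divide_right_mono) auto
  also have "\<dots> = \<delta>\<^sup>2 / (16384 * (real k)\<^sup>2)"
    using \<delta> k by (simp add: \<tau>_def power2_eq_square field_simps)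
  also have "\<dots> \<le> \<delta>\<^sup>2 / (16384 * real k)"
    using k by (intro divide_left_mono mult_left_mono) (auto simp: power2_eq_square)
  finally have E: "avg (ZN N) (\<lambda>x. of_bool (?E x)) \<le> \<delta>\<^sup>2 / (16384 * real k)" .
  also have "\<dots> \<le> \<delta>\<^sup>2 / 16384" using k by (intro divide_left_mono) auto
  also have "\<dots> \<le> \<delta> / 16384" using \<delta> \<delta>1 by (simp add: power2_eq_square)
  finally have E': "avg (ZN N) (\<lambda>x. of_bool (?E x)) \<le> \<delta> / 16384" .
  \<comment> \<open>Off both sets \<open>fU\<close> is below
    \<open>\<delta> / 2 + \<delta> / 8\<close>, so the mean \<delta> leaves
    \<open>3/8 * \<delta>\<close> for the two densities together.\<close>
  have "fU x \<le> of_bool (?S x) + of_bool (?E x) + 5 / 8 * \<delta>" for x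
  proof (cases "?S x \<or> ?E x")
    case True
    hence "1 \<le> (of_bool (?S x) + of_bool (?E x) :: real)" by auto
    moreover have "fU x \<le> 1" using fU(2) by simp
    ultimately show ?thesis using \<delta> by linarith
  next
    case False
    hence "fU x \<le> 5 / 8 * \<delta>" by linarith
    thus ?thesis using False by simp
  qed
  hence "avg (ZN N) fU \<le> avg (ZN N) (\<lambda>x. of_bool (?S x) + of_bool (?E x) + 5 / 8 * \<delta>)"
    by (intro avg_mono)
  also have "\<dots> = avg (ZN N) (\<lambda>x. of_bool (?S x)) + avg (ZN N) (\<lambda>x. of_bool (?E x)) + 5 / 8 * \<delta>"
    unfolding avg_add avg_ZN_const[OF N] ..
  finally have S: "\<delta> / 4 \<le> avg (ZN N) (\<lambda>x. of_bool (?S x))" using avg E' \<delta> by linarith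
  show ?thesis unfolding config_def
  proof (intro conjI exI[of _ "{\<lambda>x. complex_of_real (fUAP x)}"] allI impI)
    show "avg (ZN N) (\<lambda>x. of_bool (?E x)) \<le> (\<delta> / 4)\<^sup>2 / (16 * real k)"
    proof (rule order_trans[OF E])
      have "\<delta>\<^sup>2 / (16384 * real k) \<le> \<delta>\<^sup>2 / (256 * real k)"
        using k by (intro divide_left_mono) auto
      also have "\<dots> = (\<delta> / 4)\<^sup>2 / (16 * real k)" by (simp add: power_divide)
      finally show "\<delta>\<^sup>2 / (16384 * real k) \<le> (\<delta> / 4)\<^sup>2 / (16 * real k)" .
    qed
    show "{\<lambda>x. complex_of_real (fUAP x)} \<subseteq> UAP_ball N d M"
      using norm ZN_fun_comp[OF fUAP, of complex_of_real] by (simp add: UAP_ball_def)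
    show "\<delta> / 8 \<le> fU y \<or> \<delta> / 8 \<le> \<bar>fU y - fUAP y\<bar>"
      if "\<delta> / 2 \<le> fUAP x" "\<forall>u\<in>{\<lambda>x. complex_of_real (fUAP x)}. cmod (u x - u y) \<le> \<delta> / 4" for x y
    proof -
      have "cmod (complex_of_real (fUAP x) - complex_of_real (fUAP y)) \<le> \<delta> / 4" using that(2) by simp
      hence "\<bar>fUAP x - fUAP y\<bar> \<le> \<delta> / 4" by (simp only: of_real_diff[symmetric] norm_of_real)
      thus ?thesis using that(1) by linarith
    qed
  qed (use N S in \<open>auto intro: ZN_fun_comp[OF fUAP] ZN_fun_comp[OF fU(1)] ZN_fun_comp2[OF fU(1) fUAP]\<close>)
qed

theorem theorem3p3:
  fixes d k :: nat and \<delta> M :: real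
  assumes "k \<ge> 1" and "0 < \<delta>" and "0 < M"
  shows "\<exists>c0::real. 0 < c0 \<and>
    (\<forall>(N::nat) (fU :: int \<Rightarrow> real) (fUAP :: int \<Rightarrow> real).
       prime N \<longrightarrow>
       fU \<in> ZN_fun N \<longrightarrow> (\<forall>x. fU x \<in> {0..1}) \<longrightarrow>
       fUAP \<in> ZN_fun N \<longrightarrow> (\<forall>x. fUAP x \<in> {0..1}) \<longrightarrow>
       L2_norm N (\<lambda>x. fU x - fUAP x) \<le> \<delta>\<^sup>2 / (1024 * real k) \<longrightarrow>
       avg (ZN N) fU \<ge> \<delta> \<longrightarrow>
       UAP_pow_norm N d (\<lambda>x. complex_of_real (fUAP x)) < ennreal M \<longrightarrow>
       (\<forall>\<mu>\<in>ZN N. \<forall>N1::nat. 1 \<le> N1 \<longrightarrow>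
          avg (ZN N \<times> {0..N1})
            (\<lambda>(x, r). \<Prod>j=0..k-1. shift (\<mu> * int j * int r) fU x) \<ge> c0))"
proof -
  have \<delta>4: "0 < \<delta> / 4" using assms(2) by simp
  obtain c where c: "0 < c" and
    main: "\<And>N S \<Omega> E \<mu> N1. config N d k (\<delta> / 4) 1 (\<delta> / 4) M S \<Omega> E \<Longrightarrow> c \<le> ret N k \<Omega> \<mu> N1"
    using recurrent[of d, unfolded recurrent_def, rule_format, OF assms(1) \<delta>4 \<delta>4 assms(3), of 1] by blast
  \<comment> \<open>The product is at least \<open>(\<delta> / 8) ^ k\<close> where the whole
    progression lies in the set \<open>\<delta> / 8 \<le> fU\<close>, and it is nonnegative
    elsewhere.\<close>
  have "(\<delta> / 8) ^ k * c \<le> avg (ZN N \<times> {0..N1}) (\<lambda>(x, r). \<Prod>j=0..k-1. shift (\<mu> * int j * int r) fU x)"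
    if N: "prime N" and fU: "fU \<in> ZN_fun N" "\<forall>x. fU x \<in> {0..1}" and fUAP: "fUAP \<in> ZN_fun N"
      and L2: "L2_norm N (\<lambda>x. fU x - fUAP x) \<le> \<delta>\<^sup>2 / (1024 * real k)"
      and avg: "avg (ZN N) fU \<ge> \<delta>"
      and norm: "UAP_pow_norm N d (\<lambda>x. complex_of_real (fUAP x)) < ennreal M"
    for N :: nat and fU fUAP :: "int \<Rightarrow> real" and \<mu> :: int and N1 :: nat
  proof -
    have N0: "0 < N" using N by (simp add: prime_gt_0_nat)
    have ret: "c \<le> ret N k (\<lambda>x. \<delta> / 8 \<le> fU x) \<mu> N1"
      by (rule main, rule config_of_approximation[OF assms(1,2) N0 fU(1) _ fUAP L2 avg norm]) (use fU(2) in blast)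
    define f where "f x r = (\<Prod>j=0..k-1. shift (\<mu> * int j * int r) fU x)" for x and r :: nat
    have pt: "(\<delta> / 8) ^ k * of_bool (\<forall>j<k. \<delta> / 8 \<le> fU (x + \<mu> * int r * int j)) \<le> f x r" for x and r :: nat
    proof (cases "\<forall>j<k. \<delta> / 8 \<le> fU (x + \<mu> * int r * int j)")
      case True
      have "(\<delta> / 8) ^ k = (\<Prod>j=0..k-1. \<delta> / 8)" using assms(1) by simp
      also have "\<dots> \<le> f x r"
        unfolding f_def shift_def
      proof (intro prod_mono conjI)
        fix j assume "j \<in> {0..k-1}"
        hence "j < k" using assms(1) by auto
        thus "\<delta> / 8 \<le> fU (x + \<mu> * int j * int r)" using True by (simp add: mult.assoc mult.commute[of "int j"])
      qed (use assms(2) in simp)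
      finally show ?thesis using True by simp
    next
      case False
      have "0 \<le> f x r" unfolding f_def shift_def using fU(2) by (intro prod_nonneg) auto
      moreover have "of_bool (\<forall>j<k. \<delta> / 8 \<le> fU (x + \<mu> * int r * int j)) = (0 :: real)"
        using False by (simp only: of_bool_eq_0_iff not_False_eq_True)
      ultimately show ?thesis by (simp only: mult_zero_right)
    qed
    have "(\<delta> / 8) ^ k * c \<le> (\<delta> / 8) ^ k * ret N k (\<lambda>x. \<delta> / 8 \<le> fU x) \<mu> N1"
      using ret assms(2) by (intro mult_left_mono) auto
    also have "\<dots> = (\<Sum>r\<le>N1. avg (ZN N) (\<lambda>x. (\<delta> / 8) ^ k * of_bool (\<forall>j<k. \<delta> / 8 \<le> fU (x + \<mu> * int r * int j)))) / (real N1 + 1)"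
      unfolding ret_def avg_cmult sum_distrib_left[symmetric] by simp
    also have "\<dots> \<le> (\<Sum>r\<le>N1. avg (ZN N) (\<lambda>x. f x r)) / (real N1 + 1)"
      by (intro divide_right_mono sum_mono avg_mono pt) simp
    also have "\<dots> = avg (ZN N \<times> {0..N1}) (\<lambda>(x, r). f x r)"
    proof -
      have "(\<Sum>r\<le>N1. avg (ZN N) (\<lambda>x. f x r)) = (\<Sum>x\<in>ZN N. \<Sum>r\<le>N1. f x r) / N"
        unfolding avg_ZN sum_divide_distrib[symmetric] by (subst sum.swap) simp
      thus ?thesis
        unfolding avg_def by (simp add: sum.cartesian_product[symmetric] card_cartesian_product atMost_atLeast0 field_simps)
    qed
    finally show ?thesis unfolding f_def .
  qed
  moreover have "0 < (\<delta> / 8) ^ k * c" using c assms(2) by simp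
  ultimately show ?thesis by (intro exI[of _ "(\<delta> / 8) ^ k * c"]) blast
qed

end
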